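(* Let $u$ be the mild solution, for each noise level $\lambda>0$, of the stochastic heat equation on $(0,L)$ with Neumann boundary conditions $$\partial_t u_t(x)=\tfrac12\Delta u_t(x)+\lambda\,\sigma(u_t(x))\,\dot w(t,x),\qquad \partial_xu_t(0)=\partial_xu_t(L)=0,$$ with initial function $u_0$. Then the nonlinear noise excitation index of the solution is $4$; that is, for every $t>0$, $$\overline e(t)=\underline e(t)=4 .$$
   Context: Fix $L>0$. $\dot w$ denotes space-time white noise on $(0,\infty)\times(0,L)$ and $\lambda>0$ is the level of the noise. Assumptions on $\sigma$: $\sigma:\mathbf R\to\mathbf R$ is Lipschitz continuous, $\sigma(0)=0$, and with $l_\sigma:=\inf_{x\ne0}|\sigma(x)/x|$ and $L_\sigma:=\sup_{x\neq 0}|\sigma(x)/x|$ one has $0<l_\sigma\le L_\sigma<\infty$. Assumptions on $u_0$: $u_0:[0,L]\to[0,\infty)$ is a nonrandom, bounded, measurable function, compactly supported in $[0,L]$, and not almost everywhere zero (it is not required to be bounded below away from zero). Neither $\sigma$ nor $u_0$ depends on $\lambda$. Mild solution: let $p_N(t,x,y)$ be the Neumann heat kernel on $[0,L]$ (the fundamental solution of $\partial_t=\frac12\Delta$ on $(0,L)$ with zero normal derivative at the boundary). The mild solution is the unique predictable random field $u$ (with respect to the filtration of the white noise) with initial function $u_0$ such that $\sup_{x\in[0,L]}\sup_{t\in[0,T]}\mathrm E|u_t(x)|^k<\infty$ for all $T>0$ and $k\in[2,\infty)$ and, almost surely for each $t>0$ and $x\in[0,L]$, $$u_t(x)=\int_0^L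 u_0(y)p_N(t,x,y)\,dy+\lambda\int_0^L\int_0^t p_N(t-s,x,y)\,\sigma(u_s(y))\,w(ds\,dy),$$ the last integral being a Walsh stochastic integral. Existence and uniqueness of this solution are known. Energy of the solution at time $t$: $\mathcal E_t(\lambda):=\sqrt{\mathrm E\left(\|u_t\|_{L^2[0,L]}^2\right)}$. Upper and lower excitation indices at time $t$: $$\overline e(t):=\limsup_{\lambda\to\infty}\frac{\log\log\mathcal E_t(\lambda)}{\log\lambda},\qquad \underline e(t):=\liminf_{\lambda\to\infty}\frac{\log\log\mathcal E_t(\lambda)}{\log\lambda}.$$ When they are equal, the common value (required to be strictly positive) is called the nonlinear noise excitation index at time $t$. Convention: $\log\log r:=-\infty$ for $r\le1$. *)

theory Defs
  imports "HOL-Probability.Probability"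
begin

definition noise_sets :: "real \<Rightarrow> (real \<times> real) set set" where
  "noise_sets L = {A \<in> sets borel. A \<subseteq> {0<..} \<times> {0<..<L} \<and> emeasure lborel A < \<infinity>}"

text \<open>The constant 0 counts as a (degenerate) centred Gaussian.\<close>

definition centred_gaussian :: "'w measure \<Rightarrow> ('w \<Rightarrow> real) \<Rightarrow> bool" where
  "centred_gaussian M X \<longleftrightarrow>
     X \<in> borel_measurable M \<and>
     ((AE \<omega> in M. X \<omega> = 0) \<or> (\<exists>s>0. distributed M lborel X (normal_density 0 s)))"

text \<open>Space-time white noise on \<open>(0,\<infinity>) \<times> (0,L)\<close>: a centred Gaussian process indexed by the Borel
  sets of finite area, whose covariance is the area of the intersection.\<close>

definition white_noise :: "'w measure \<Rightarrow> real \<Rightarrow> ((real \<times> real) set \<Rightarrow> 'w \<Rightarrow> real) \<Rightarrow> bool" where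
  "white_noise M L W \<longleftrightarrow>
     (\<forall>\<A> c. finite \<A> \<and> \<A> \<subseteq> noise_sets L \<longrightarrow>
        centred_gaussian M (\<lambda>\<omega>. \<Sum>A\<in>\<A>. c A * W A \<omega>)) \<and>
     (\<forall>A\<in>noise_sets L. \<forall>B\<in>noise_sets L.
        prob_space.expectation M (\<lambda>\<omega>. W A \<omega> * W B \<omega>) = measure lborel (A \<inter> B))"

text \<open>The filtration of the noise, augmented by the null sets. Making it right-continuous as well
  would not change the predictable \<open>\<sigma>\<close>-algebra below.\<close>

definition noise_filtration ::
    "'w measure \<Rightarrow> real \<Rightarrow> ((real \<times> real) set \<Rightarrow> 'w \<Rightarrow> real) \<Rightarrow> real \<Rightarrow> 'w measure" where
  "noise_filtration M L W t =
     sigma (space M)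
       ({W A -` B \<inter> space M | A B. A \<in> noise_sets L \<and> A \<subseteq> {0<..t} \<times> UNIV \<and> B \<in> sets borel}
        \<union> null_sets M)"

definition predictable_algebra ::
    "'w measure \<Rightarrow> (real \<Rightarrow> 'w measure) \<Rightarrow> real set \<Rightarrow> (real \<times> real \<times> 'w) measure" where
  "predictable_algebra M F D =
     sigma ({0<..} \<times> D \<times> space M)
       {{a<..b} \<times> A \<times> G | a b A G.
          0 \<le> a \<and> a < b \<and> A \<in> sets borel \<and> A \<subseteq> D \<and> G \<in> sets (F a)}"

definition predictable ::
    "'w measure \<Rightarrow> (real \<Rightarrow> 'w measure) \<Rightarrow> real set \<Rightarrow> (real \<Rightarrow> real \<Rightarrow> 'w \<Rightarrow> real) \<Rightarrow> bool" where
  "predictable M F D f \<longleftrightarrow>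
     (\<lambda>(s, y, \<omega>). f s y \<omega>) \<in> borel_measurable (predictable_algebra M F D)"

text \<open>The quadruple \<open>(X, a, b, A)\<close> stands for the elementary integrand
  \<open>X(\<omega>) 1\<^bsub>(a,b]\<^esub>(s) 1\<^bsub>A\<^esub>(y)\<close>; a finite list of quadruples stands for the sum of these.\<close>

type_synonym 'w elementary = "('w \<Rightarrow> real) \<times> real \<times> real \<times> real set"

definition elementary_integrands ::
    "'w measure \<Rightarrow> real \<Rightarrow> ((real \<times> real) set \<Rightarrow> 'w \<Rightarrow> real) \<Rightarrow> 'w elementary set" where
  "elementary_integrands M L W =
     {(X, a, b, A). 0 \<le> a \<and> a < b \<and> A \<in> sets borel \<and> A \<subseteq> {0<..<L} \<and>
        X \<in> borel_measurable (noise_filtration M L W a) \<and> bounded (X ` space M)}"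

definition simple_integrand :: "'w elementary list \<Rightarrow> real \<Rightarrow> real \<Rightarrow> 'w \<Rightarrow> real" where
  "simple_integrand es s y \<omega> =
     (\<Sum>(X, a, b, A) \<leftarrow> es. X \<omega> * indicator {a<..b} s * indicator A y)"

definition simple_walsh_integral ::
    "((real \<times> real) set \<Rightarrow> 'w \<Rightarrow> real) \<Rightarrow> 'w elementary list \<Rightarrow> 'w \<Rightarrow> real" where
  "simple_walsh_integral W es \<omega> = (\<Sum>(X, a, b, A) \<leftarrow> es. X \<omega> * W ({a<..b} \<times> A) \<omega>)"

definition walsh_norm_sq :: "'w measure \<Rightarrow> real \<Rightarrow> (real \<Rightarrow> real \<Rightarrow> 'w \<Rightarrow> real) \<Rightarrow> ennreal" where
  "walsh_norm_sq M L f =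
     (\<integral>\<^sup>+s\<in>{0<..}. (\<integral>\<^sup>+y\<in>{0<..<L}. (\<integral>\<^sup>+\<omega>. ennreal ((f s y \<omega>)\<^sup>2) \<partial>M) \<partial>lborel) \<partial>lborel)"

text \<open>\<open>J\<close> is a version of \<open>\<integral>\<integral> f(s,y) w(ds dy)\<close> over \<open>(0,\<infinity>) \<times> (0,L)\<close>: the mean-square limit of
  the integrals of simple integrands that approximate the predictable \<open>f\<close>.\<close>

definition has_walsh_integral ::
    "'w measure \<Rightarrow> real \<Rightarrow> ((real \<times> real) set \<Rightarrow> 'w \<Rightarrow> real) \<Rightarrow>
     (real \<Rightarrow> real \<Rightarrow> 'w \<Rightarrow> real) \<Rightarrow> ('w \<Rightarrow> real) \<Rightarrow> bool" where
  "has_walsh_integral M L W f J \<longleftrightarrow>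
     predictable M (noise_filtration M L W) {0<..<L} f \<and>
     walsh_norm_sq M L f < \<infinity> \<and>
     J \<in> borel_measurable M \<and>
     (\<exists>es. (\<forall>n. set (es n) \<subseteq> elementary_integrands M L W) \<and>
        (\<lambda>n. walsh_norm_sq M L (\<lambda>s y \<omega>. f s y \<omega> - simple_integrand (es n) s y \<omega>)) \<longlonglongrightarrow> 0 \<and>
        (\<lambda>n. \<integral>\<^sup>+\<omega>. ennreal ((J \<omega> - simple_walsh_integral W (es n) \<omega>)\<^sup>2) \<partial>M) \<longlonglongrightarrow> 0)"

text \<open>\<open>p t x y\<close> is the fundamental solution with pole \<open>x\<close>: in \<open>(t, y)\<close> it solves
  \<open>\<partial>\<^sub>t = 1/2 \<partial>\<^sub>y\<^sub>y\<close> with zero normal derivative, classically up to the boundary, and it tends weakly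
  to the unit mass at \<open>x\<close> as \<open>t\<close> decreases to 0. Its cosine coefficients in \<open>y\<close> are thereby
  determined, so these conditions determine \<open>p\<close> on \<open>(0,\<infinity>) \<times> [0,L] \<times> [0,L]\<close>.\<close>

definition neumann_heat_kernel :: "real \<Rightarrow> (real \<Rightarrow> real \<Rightarrow> real \<Rightarrow> real) \<Rightarrow> bool" where
  "neumann_heat_kernel L p \<longleftrightarrow>
     (\<forall>x\<in>{0..L}. \<exists>p\<^sub>t p\<^sub>y p\<^sub>y\<^sub>y.
        (\<forall>t>0. \<forall>y\<in>{0..L}.
           ((\<lambda>s. p s x y) has_real_derivative p\<^sub>t t y) (at t) \<and>
           ((\<lambda>z. p t x z) has_real_derivative p\<^sub>y t y) (at y within {0..L}) \<and>
           ((\<lambda>z. p\<^sub>y t z) has_real_derivative p\<^sub>y\<^sub>y t y) (at y within {0..L})) \<and>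
        continuous_on ({0<..} \<times> {0..L}) (\<lambda>(t, y). p t x y) \<and>
        continuous_on ({0<..} \<times> {0..L}) (\<lambda>(t, y). p\<^sub>t t y) \<and>
        continuous_on ({0<..} \<times> {0..L}) (\<lambda>(t, y). p\<^sub>y\<^sub>y t y) \<and>
        (\<forall>t>0. \<forall>y\<in>{0<..<L}. p\<^sub>t t y = 1 / 2 * p\<^sub>y\<^sub>y t y) \<and>
        (\<forall>t>0. p\<^sub>y t 0 = 0 \<and> p\<^sub>y t L = 0) \<and>
        (\<forall>\<phi>. continuous_on {0..L} \<phi> \<longrightarrow>
           ((\<lambda>t. LINT y:{0..L}|lborel. p t x y * \<phi> y) \<longlongrightarrow> \<phi> x) (at_right 0)))"

definition l_sigma :: "(real \<Rightarrow> real) \<Rightarrow> ereal" where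
  "l_sigma \<sigma> = (INF x\<in>-{0}. ereal \<bar>\<sigma> x / x\<bar>)"

definition L_sigma :: "(real \<Rightarrow> real) \<Rightarrow> ereal" where
  "L_sigma \<sigma> = (SUP x\<in>-{0}. ereal \<bar>\<sigma> x / x\<bar>)"

definition admissible_sigma :: "(real \<Rightarrow> real) \<Rightarrow> bool" where
  "admissible_sigma \<sigma> \<longleftrightarrow>
     (\<exists>C. C-lipschitz_on UNIV \<sigma>) \<and> \<sigma> 0 = 0 \<and>
     0 < l_sigma \<sigma> \<and> l_sigma \<sigma> \<le> L_sigma \<sigma> \<and> L_sigma \<sigma> < \<infinity>"

text \<open>Only the values of \<open>u0\<close> on \<open>[0,L]\<close> matter; the compact support condition is automatic.\<close>

definition admissible_initial :: "real \<Rightarrow> (real \<Rightarrow> real) \<Rightarrow> bool" where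
  "admissible_initial L u0 \<longleftrightarrow>
     u0 \<in> borel_measurable (restrict_space borel {0..L}) \<and>
     (\<forall>x\<in>{0..L}. 0 \<le> u0 x) \<and>
     bounded (u0 ` {0..L}) \<and>
     (\<exists>K. compact K \<and> K \<subseteq> {0..L} \<and> (\<forall>x\<in>{0..L} - K. u0 x = 0)) \<and>
     \<not> (AE x in lborel. x \<in> {0..L} \<longrightarrow> u0 x = 0)"

definition mild_solution ::
    "'w measure \<Rightarrow> real \<Rightarrow> ((real \<times> real) set \<Rightarrow> 'w \<Rightarrow> real) \<Rightarrow> (real \<Rightarrow> real \<Rightarrow> real \<Rightarrow> real) \<Rightarrow>
     (real \<Rightarrow> real) \<Rightarrow> (real \<Rightarrow> real) \<Rightarrow> real \<Rightarrow> (real \<Rightarrow> real \<Rightarrow> 'w \<Rightarrow> real) \<Rightarrow> bool" where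
  "mild_solution M L W p \<sigma> u0 lam u \<longleftrightarrow>
     predictable M (noise_filtration M L W) {0..L} u \<and>
     (\<forall>x\<in>{0..L}. AE \<omega> in M. u 0 x \<omega> = u0 x) \<and>
     (\<forall>T>0. \<forall>k\<ge>2.
        (SUP x\<in>{0..L}. SUP t\<in>{0..T}. \<integral>\<^sup>+\<omega>. ennreal (\<bar>u t x \<omega>\<bar> powr k) \<partial>M) < \<infinity>) \<and>
     (\<forall>t>0. \<forall>x\<in>{0..L}. \<exists>J.
        has_walsh_integral M L W
          (\<lambda>s y \<omega>. indicator {0<..<t} s * p (t - s) x y * \<sigma> (u s y \<omega>)) J \<and>
        (AE \<omega> in M. u t x \<omega> = (LINT y:{0..L}|lborel. u0 y * p t x y) + lam * J \<omega>))"

definition energy :: "'w measure \<Rightarrow> real \<Rightarrow> (real \<Rightarrow> real \<Rightarrow> 'w \<Rightarrow> real) \<Rightarrow> real \<Rightarrow> real" where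
  "energy M L u t =
     sqrt (prob_space.expectation M (\<lambda>\<omega>. LINT x:{0..L}|lborel. (u t x \<omega>)\<^sup>2))"

definition loglog :: "real \<Rightarrow> ereal" where
  "loglog r = (if r \<le> 1 then -\<infinity> else ereal (ln (ln r)))"

text \<open>The argument \<open>E\<close> is the energy at a fixed time as a function of the noise level.\<close>

definition upper_excitation_index :: "(real \<Rightarrow> real) \<Rightarrow> ereal" where
  "upper_excitation_index E = Limsup at_top (\<lambda>lam. loglog (E lam) / ereal (ln lam))"

definition lower_excitation_index :: "(real \<Rightarrow> real) \<Rightarrow> ereal" where
  "lower_excitation_index E = Liminf at_top (\<lambda>lam. loglog (E lam) / ereal (ln lam))"

end

theory Submission
  imports Defs "HOL-Real_Asymp.Real_Asymp"
begin

text \<open>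
  By the Walsh isometry, the second moment \<open>m\<^sub>t(x) = E |u\<^sub>t(x)|\<^sup>2\<close> satisfies
  \<open>m\<^sub>t(x) = (P\<^sub>tu\<^sub>0)(x)\<^sup>2 + \<lambda>\<^sup>2 \<integral>\<integral> p\<^sub>t\<^sub>-\<^sub>s(x,y)\<^sup>2 E \<sigma>(u\<^sub>s(y))\<^sup>2 dy ds\<close>. Integrating in \<open>x\<close> and using
  \<open>l |z| \<le> |\<sigma>(z)| \<le> \<Lambda> |z|\<close> yields renewal inequalities for \<open>g(t) = \<integral> m\<^sub>t(x) dx\<close> whose kernel
  \<open>\<integral> p\<^sub>r(x,y)\<^sup>2 dx\<close> is of order \<open>r\<^sup>-\<^sup>1\<^sup>/\<^sup>2\<close> for small \<open>r\<close>, uniformly in \<open>y\<close>. On time scale \<open>\<lambda>\<^sup>-\<^sup>4\<close> the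
  noise term therefore gains a constant factor: \<open>g\<close> doubles in every interval of length
  \<open>const \<cdot> \<lambda>\<^sup>-\<^sup>4\<close>, and \<open>e\<^sup>-\<^sup>\<beta>\<^sup>t g(t)\<close> stays bounded for \<open>\<beta> = const \<cdot> \<lambda>\<^sup>4\<close>. Hence the energy lies between two
  functions of the form \<open>a exp(c \<lambda>\<^sup>4)\<close>.

  The kernel estimates come from the cosine expansion of \<open>p\<close>: the heat equation determines its cosine
  coefficients, and the cosines are complete by the Weierstrass theorem.
\<close>

section \<open>Independence of past and future noise\<close>

text \<open>The definition of the noise lists only Gaussian linear combinations and covariances, so
  the additivity of \<open>W\<close> and the independence of future increments from the filtration
  have to be derived, from second moments and from characteristic functions. The kernel likewise is
  given by a boundary value problem for each pole, with no estimate and no regularity in the pole;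
  its cosine series supplies both bounds and joint measurability. The power 4 comes from the square
  root singularity: over lags up to delta the noise term contributes a factor of order lam^2
  delta^(1/2), which is of order one for delta = lam^(-4), and the Laplace transform at beta turns
  the same singularity into beta^(-1/2). For the upper bound the transform is enough and is summed
  mode by mode, without a pointwise bound of order r^(-1/2). Second moments live in
  \<open>ennreal\<close>, so that Tonelli applies freely; finiteness comes from the moment condition
  on mild solutions and is what permits absorbing half of a supremum into the left-hand
  side.\<close>

lemma (in prob_space) integrable_mult_iexp [intro]:
  fixes V :: "'a \<Rightarrow> complex"
  assumes "integrable M V" and [measurable]: "X \<in> borel_measurable M"
  shows "integrable M (\<lambda>\<omega>. V \<omega> * iexp (X \<omega>))"
  by (rule Bochner_Integration.integrable_bound[OF assms(1)])
     (use assms(1) in \<open>auto simp: norm_mult\<close>)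

text \<open>The case \<open>c = 0\<close> of the hypothesis gives the positive and negative parts of
  \<open>V\<close> equal mass m. If m = 0 then \<open>V\<close> vanishes almost surely. Otherwise
  the densities P/m and N/m define two probability measures under which \<open>X\<close> has the
  same characteristic function, hence by Levy's theorem the same law.\<close>

lemma (in prob_space) fourier_null_real:
  fixes V X :: "'a \<Rightarrow> real"
  assumes V: "integrable M V" and X [measurable]: "X \<in> borel_measurable M"
    and null: "\<And>c. (CLINT \<omega>|M. complex_of_real (V \<omega>) * iexp (c * X \<omega>)) = 0"
    and B [measurable]: "B \<in> sets borel"
  shows "expectation (\<lambda>\<omega>. V \<omega> * indicator B (X \<omega>)) = 0"
proof -
  define P where "P \<omega> = max 0 (V \<omega>)" for \<omega>
  define N where "N \<omega> = max 0 (- V \<omega>)" for \<omega>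
  have VPN: "V \<omega> = P \<omega> - N \<omega>" for \<omega> by (auto simp: P_def N_def)
  have [measurable]: "V \<in> borel_measurable M" using V by simp
  have P: "integrable M P" and N: "integrable M N"
    unfolding P_def[abs_def] N_def[abs_def]
    by (rule Bochner_Integration.integrable_bound[OF V]; auto)+
  have P0: "0 \<le> P \<omega>" and N0: "0 \<le> N \<omega>" for \<omega> by (auto simp: P_def N_def)
  define m where "m = expectation P"
  have "(CLINT \<omega>|M. complex_of_real (V \<omega>)) = 0" using null[of 0] by simp
  then have "expectation V = 0" by (simp add: integral_complex_of_real)
  then have mN: "expectation N = m"
    using Bochner_Integration.integral_diff[OF P N] by (simp add: VPN[symmetric] m_def)
  have m0: "0 \<le> m" by (simp add: m_def P0)
  show ?thesis
  proof (cases "m = 0")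
    case True
    have "AE \<omega> in M. P \<omega> = 0" "AE \<omega> in M. N \<omega> = 0"
      using True mN P N P0 N0 integral_nonneg_eq_0_iff_AE[of M P] integral_nonneg_eq_0_iff_AE[of M N]
      by (auto simp: m_def)
    then have "AE \<omega> in M. V \<omega> * indicator B (X \<omega>) = 0"
      by eventually_elim (simp add: VPN)
    then show ?thesis by (intro integral_eq_zero_AE)
  next
    case False
    then have m: "0 < m" using m0 by simp
    define D where "D F = density M (\<lambda>\<omega>. ennreal (F \<omega> / m))" for F
    have Dprob: "prob_space (D F)" if [measurable]: "integrable M F" and "\<And>\<omega>. 0 \<le> F \<omega>" "expectation F = m" for F
    proof
      have "emeasure (D F) (space (D F)) = (\<integral>\<^sup>+\<omega>. ennreal (F \<omega> / m) \<partial>M)"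
        using that by (auto simp: D_def emeasure_density intro!: nn_integral_cong)
      also have "\<dots> = ennreal (expectation (\<lambda>\<omega>. F \<omega> / m))"
        using that m by (intro nn_integral_eq_integral) auto
      also have "\<dots> = 1" using that m by simp
      finally show "emeasure (D F) (space (D F)) = 1" .
    qed
    have DI: "integral\<^sup>L (D F) f = (CLINT \<omega>|M. complex_of_real (F \<omega>) * f \<omega>) / complex_of_real m"
      if "integrable M F" "\<And>\<omega>. 0 \<le> F \<omega>" and [measurable]: "f \<in> borel_measurable M" for f :: "'a \<Rightarrow> complex" and F
    proof -
      have [measurable]: "F \<in> borel_measurable M" using that by simp
      have "integral\<^sup>L (D F) f = (CLINT \<omega>|M. (F \<omega> / m) *\<^sub>R f \<omega>)"
        unfolding D_def using that m by (subst integral_density) auto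
      also have "\<dots> = (CLINT \<omega>|M. (complex_of_real (F \<omega>) * f \<omega>) / complex_of_real m)"
        by (intro Bochner_Integration.integral_cong) (auto simp: scaleR_conv_of_real)
      finally show ?thesis by simp
    qed
    have [measurable]: "X \<in> borel_measurable (D F)" for F by (simp add: D_def)
    have rd: "real_distribution (distr (D F) borel X)" if "integrable M F" "\<And>\<omega>. 0 \<le> F \<omega>" "expectation F = m" for F
    proof -
      interpret D: prob_space "D F" by (rule Dprob) (use that in auto)
      show ?thesis by (rule D.real_distribution_distr) simp
    qed
    have "char (distr (D P) borel X) = char (distr (D N) borel X)"
    proof
      fix c
      have "0 = (CLINT \<omega>|M. complex_of_real (P \<omega>) * iexp (c * X \<omega>) - complex_of_real (N \<omega>) * iexp (c * X \<omega>))"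
        using null[of c] by (simp add: VPN algebra_simps)
      also have "\<dots> = (CLINT \<omega>|M. complex_of_real (P \<omega>) * iexp (c * X \<omega>)) - (CLINT \<omega>|M. complex_of_real (N \<omega>) * iexp (c * X \<omega>))"
        by (intro Bochner_Integration.integral_diff integrable_mult_iexp integrable_of_real P N) auto
      finally show "char (distr (D P) borel X) c = char (distr (D N) borel X) c"
        unfolding char_def by (subst (1 2) integral_distr) (auto simp: DI P N P0 N0)
    qed
    then have eq: "distr (D P) borel X = distr (D N) borel X"
      by (intro Levy_uniqueness rd) (auto simp: P N P0 N0 mN m_def)
    have E: "measure (distr (D F) borel X) B = expectation (\<lambda>\<omega>. F \<omega> * indicator B (X \<omega>)) / m"
      if F: "integrable M F" "\<And>\<omega>. 0 \<le> F \<omega>" for F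
    proof -
      have [measurable]: "F \<in> borel_measurable M" using that by simp
      have "emeasure (distr (D F) borel X) B = (\<integral>\<^sup>+\<omega>. ennreal (F \<omega> / m) * indicator (X -` B \<inter> space M) \<omega> \<partial>M)"
        by (simp add: emeasure_distr D_def emeasure_density)
      also have "\<dots> = (\<integral>\<^sup>+\<omega>. ennreal (F \<omega> * indicator B (X \<omega>) / m) \<partial>M)"
        by (intro nn_integral_cong) (auto split: split_indicator)
      also have "\<dots> = ennreal (expectation (\<lambda>\<omega>. F \<omega> * indicator B (X \<omega>) / m))"
      proof (intro nn_integral_eq_integral)
        show "integrable M (\<lambda>\<omega>. F \<omega> * indicator B (X \<omega>) / m)"
          by (intro integrable_divide Bochner_Integration.integrable_bound[OF F(1)])
             (auto split: split_indicator)
      qed (use F m in auto)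
      finally show ?thesis using F m by (simp add: measure_def)
    qed
    have IB: "integrable M (\<lambda>\<omega>. F \<omega> * indicator B (X \<omega>))" if F: "integrable M F" for F :: "'a \<Rightarrow> real"
      using F by (intro Bochner_Integration.integrable_bound[OF F]) (auto split: split_indicator)
    have "expectation (\<lambda>\<omega>. P \<omega> * indicator B (X \<omega>)) = expectation (\<lambda>\<omega>. N \<omega> * indicator B (X \<omega>))"
      using E[OF P P0] E[OF N N0] eq m by simp
    then show ?thesis
      using IB[OF P] IB[OF N] by (simp add: VPN left_diff_distrib)
  qed
qed

text \<open>Because the hypothesis holds for c and for -c, conjugation shows that
  \<open>cnj V\<close> satisfies it as well; hence so do the real and the imaginary part, and the
  real case applies to each.\<close>

lemma (in prob_space) fourier_null:
  fixes V :: "'a \<Rightarrow> complex" and X :: "'a \<Rightarrow> real"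
  assumes V: "integrable M V" and X [measurable]: "X \<in> borel_measurable M"
    and null: "\<And>c. (CLINT \<omega>|M. V \<omega> * iexp (c * X \<omega>)) = 0"
    and B: "B \<in> sets borel"
  shows "(CLINT \<omega>|M. V \<omega> * indicator B (X \<omega>)) = 0"
proof -
  have cV: "integrable M (\<lambda>\<omega>. cnj (V \<omega>))" using V by simp
  have null': "(CLINT \<omega>|M. cnj (V \<omega>) * iexp (c * X \<omega>)) = 0" for c
  proof -
    have "(CLINT \<omega>|M. cnj (V \<omega>) * iexp (c * X \<omega>)) = (CLINT \<omega>|M. cnj (V \<omega> * iexp ((-c) * X \<omega>)))"
      by (intro Bochner_Integration.integral_cong) (auto simp: exp_cnj)
    also have "\<dots> = cnj (CLINT \<omega>|M. V \<omega> * iexp ((-c) * X \<omega>))"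
      by (rule Bochner_Integration.integral_cnj)
    finally show ?thesis using null[of "-c"] by simp
  qed
  have iV: "integrable M (\<lambda>\<omega>. V \<omega> * iexp (c * X \<omega>))" "integrable M (\<lambda>\<omega>. cnj (V \<omega>) * iexp (c * X \<omega>))" for c
    by (rule integrable_mult_iexp; use V cV in simp)+
  have re: "(CLINT \<omega>|M. complex_of_real (Re (V \<omega>)) * iexp (c * X \<omega>)) = 0" for c
  proof -
    have "(CLINT \<omega>|M. complex_of_real (Re (V \<omega>)) * iexp (c * X \<omega>)) =
       (CLINT \<omega>|M. (V \<omega> * iexp (c * X \<omega>) + cnj (V \<omega>) * iexp (c * X \<omega>)) / 2)"
      by (intro Bochner_Integration.integral_cong) (auto simp: complex_eq_iff algebra_simps)
    then show ?thesis using iV[of c] null[of c] null'[of c] by simp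
  qed
  have im: "(CLINT \<omega>|M. complex_of_real (Im (V \<omega>)) * iexp (c * X \<omega>)) = 0" for c
  proof -
    have "(CLINT \<omega>|M. complex_of_real (Im (V \<omega>)) * iexp (c * X \<omega>)) =
       (CLINT \<omega>|M. (V \<omega> * iexp (c * X \<omega>) - cnj (V \<omega>) * iexp (c * X \<omega>)) / (2 * \<i>))"
      by (intro Bochner_Integration.integral_cong) (auto simp: complex_eq_iff field_simps Re_divide Im_divide power2_eq_square)
    then show ?thesis using iV[of c] null[of c] null'[of c] by simp
  qed
  have IB: "integrable M (\<lambda>\<omega>. V \<omega> * indicator B (X \<omega>))"
    by (rule Bochner_Integration.integrable_bound[OF V]) (use V B in \<open>auto split: split_indicator\<close>)
  have "Re (CLINT \<omega>|M. V \<omega> * indicator B (X \<omega>)) = expectation (\<lambda>\<omega>. Re (V \<omega>) * indicator B (X \<omega>))"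
    by (subst integral_Re[OF IB, symmetric]) (auto intro!: Bochner_Integration.integral_cong split: split_indicator)
  moreover have "Im (CLINT \<omega>|M. V \<omega> * indicator B (X \<omega>)) = expectation (\<lambda>\<omega>. Im (V \<omega>) * indicator B (X \<omega>))"
    by (subst integral_Im[OF IB, symmetric]) (auto intro!: Bochner_Integration.integral_cong split: split_indicator)
  ultimately show ?thesis
    using fourier_null_real[OF _ X re B] fourier_null_real[OF _ X im B] V
    by (simp add: complex_eq_iff)
qed

text \<open>Exchanging exponentials for indicators one variable at a time needs only the one-dimensional
  uniqueness theorem.\<close>

lemma (in prob_space) fourier_null_family:
  fixes X :: "'i \<Rightarrow> 'a \<Rightarrow> real"
  assumes "finite S" and X: "\<And>i. i \<in> S \<Longrightarrow> X i \<in> borel_measurable M"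
    and B: "\<And>i. i \<in> S \<Longrightarrow> B i \<in> sets borel"
    and "integrable M V"
    and "\<And>c. (CLINT \<omega>|M. V \<omega> * iexp (\<Sum>i\<in>S. c i * X i \<omega>)) = 0"
  shows "(CLINT \<omega>|M. V \<omega> * (\<Prod>i\<in>S. indicator (B i) (X i \<omega>))) = 0"
  using assms
proof (induction S arbitrary: V rule: finite_induct)
  case empty
  then show ?case by simp
next
  case (insert j S)
  note [measurable] = insert.prems(1,2)
  let ?P = "\<lambda>\<omega>. \<Prod>i\<in>S. indicator (B i) (X i \<omega>) :: complex"
  have [measurable]: "X j \<in> borel_measurable M" "V \<in> borel_measurable M" and Bj: "B j \<in> sets borel"
    using insert.prems by auto
  have [measurable]: "?P \<in> borel_measurable M"
    by (intro borel_measurable_prod borel_measurable_indicator') (use insert.prems in auto)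
  have P1: "norm (?P \<omega>) \<le> 1" for \<omega>
    by (subst prod_norm[symmetric], intro prod_le_1) (auto split: split_indicator)
  have VP: "integrable M (\<lambda>\<omega>. V \<omega> * ?P \<omega>)"
    by (rule Bochner_Integration.integrable_bound[OF insert.prems(3)])
       (use P1 in \<open>auto simp: norm_mult mult_left_le\<close>)
  \<comment> \<open>The exponential in \<open>X j\<close> is absorbed into the integrand before the
    induction hypothesis is applied; this is why \<open>V\<close> has to stay arbitrary in the
    induction.\<close>
  have "(CLINT \<omega>|M. (V \<omega> * ?P \<omega>) * iexp (c * X j \<omega>)) = 0" for c
  proof -
    have "(CLINT \<omega>|M. (V \<omega> * iexp (c * X j \<omega>)) * ?P \<omega>) = 0"
    proof (rule insert.IH)
      show "integrable M (\<lambda>\<omega>. V \<omega> * iexp (c * X j \<omega>))"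
        by (intro integrable_mult_iexp insert.prems) auto
      fix d
      have "(\<Sum>i\<in>S. (d(j := c)) i * X i \<omega>) = (\<Sum>i\<in>S. d i * X i \<omega>)" for \<omega>
        using insert.hyps by (intro sum.cong) auto
      then show "(CLINT \<omega>|M. V \<omega> * iexp (c * X j \<omega>) * iexp (\<Sum>i\<in>S. d i * X i \<omega>)) = 0"
        using insert.prems(4)[of "d(j := c)"] insert.hyps by (simp add: exp_add algebra_simps)
    qed (use insert.prems in auto)
    then show ?thesis by (simp add: ac_simps)
  qed
  from fourier_null[OF VP _ this Bj] show ?case
    using insert.hyps by (simp add: ac_simps)
qed


section \<open>Moments and characteristic function of a centred Gaussian variable\<close>

lemma (in prob_space) centred_gaussian_moments:
  assumes "centred_gaussian M X"
  shows "integrable M (\<lambda>\<omega>. (X \<omega>)\<^sup>2)" "integrable M X" "expectation X = 0"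
    and "(CLINT \<omega>|M. iexp (X \<omega>)) = complex_of_real (exp (- expectation (\<lambda>\<omega>. (X \<omega>)\<^sup>2) / 2))"
proof -
  have [measurable]: "X \<in> borel_measurable M" using assms by (simp add: centred_gaussian_def)
  have "integrable M (\<lambda>\<omega>. (X \<omega>)\<^sup>2) \<and> integrable M X \<and> expectation X = 0 \<and>
    (CLINT \<omega>|M. iexp (X \<omega>)) = complex_of_real (exp (- expectation (\<lambda>\<omega>. (X \<omega>)\<^sup>2) / 2))"
  proof (cases "AE \<omega> in M. X \<omega> = 0")
    case True
    have "integrable M X"
      by (rule integrable_cong_AE_imp[of M "\<lambda>_. 0"]) (use True in auto)
    moreover have "integrable M (\<lambda>\<omega>. (X \<omega>)\<^sup>2)"
      by (rule integrable_cong_AE_imp[of M "\<lambda>_. 0"]) (use True in auto)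
    moreover have "expectation X = 0"
      by (rule integral_eq_zero_AE) (use True in auto)
    moreover have "expectation (\<lambda>\<omega>. (X \<omega>)\<^sup>2) = 0"
      by (rule integral_eq_zero_AE) (use True in auto)
    moreover have "(CLINT \<omega>|M. iexp (X \<omega>)) = (CLINT \<omega>|M. 1)"
      by (rule integral_cong_AE) (use True in auto)
    ultimately show ?thesis by (simp add: prob_space)
  next
    case False
    then obtain s where s: "0 < s" and D: "distributed M lborel X (normal_density 0 s)"
      using assms by (auto simp: centred_gaussian_def)
    \<comment> \<open>The known characteristic function is that of the standard normal law, so
      \<open>X\<close> is rescaled and the function is evaluated at \<open>s\<close>.\<close>
    have Xs: "distributed M lborel (\<lambda>\<omega>. X \<omega> / s) std_normal_density"
      using normal_standard_normal_convert[OF s] D by (simp)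
    have sq: "integrable M (\<lambda>\<omega>. (X \<omega>)\<^sup>2)"
      using distributed_integrable[OF D, of "\<lambda>x. x\<^sup>2"] integrable_normal_moment[OF s, of 0 2]
      by (simp)
    have i: "integrable M X"
      using distributed_integrable[OF D, of "\<lambda>x. x"] integrable_normal_moment[OF s, of 0 1]
      by (simp)
    have e: "expectation X = 0" by (rule normal_distributed_expectation[OF s D])
    have v: "expectation (\<lambda>\<omega>. (X \<omega>)\<^sup>2) = s\<^sup>2"
      using normal_distributed_variance[OF s D] e by simp
    have "(CLINT \<omega>|M. iexp (X \<omega>)) = (CLINT \<omega>|M. iexp (s * (X \<omega> / s)))"
      using s by (intro Bochner_Integration.integral_cong) auto
    also have "\<dots> = char (distr M borel (\<lambda>\<omega>. X \<omega> / s)) s"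
      unfolding char_def by (subst integral_distr) auto
    also have "distr M borel (\<lambda>\<omega>. X \<omega> / s) = distr M lborel (\<lambda>\<omega>. X \<omega> / s)"
      by (rule distr_cong) auto
    also have "\<dots> = density lborel std_normal_density"
      using Xs by (simp add: distributed_def)
    also have "char \<dots> s = complex_of_real (exp (- (s\<^sup>2) / 2))"
      by (simp add: char_std_normal_distribution)
    finally show ?thesis using sq i e v by simp
  qed
  then show "integrable M (\<lambda>\<omega>. (X \<omega>)\<^sup>2)" "integrable M X" "expectation X = 0"
    and "(CLINT \<omega>|M. iexp (X \<omega>)) = complex_of_real (exp (- expectation (\<lambda>\<omega>. (X \<omega>)\<^sup>2) / 2))"
    by auto
qed

lemma integrable_mult_square:
  fixes f g :: "'a \<Rightarrow> real"
  assumes "integrable M (\<lambda>x. (f x)\<^sup>2)" "integrable M (\<lambda>x. (g x)\<^sup>2)"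
    and [measurable]: "f \<in> borel_measurable M" "g \<in> borel_measurable M"
  shows "integrable M (\<lambda>x. f x * g x)"
proof (rule Bochner_Integration.integrable_bound)
  show "integrable M (\<lambda>x. (f x)\<^sup>2 + (g x)\<^sup>2)" using assms by simp
  have "\<bar>f x * g x\<bar> \<le> (f x)\<^sup>2 + (g x)\<^sup>2" for x
  proof -
    have "2 * \<bar>f x * g x\<bar> \<le> (f x)\<^sup>2 + (g x)\<^sup>2"
      using sum_squares_bound[of "\<bar>f x\<bar>" "\<bar>g x\<bar>"] by (simp add: abs_mult)
    moreover have "0 \<le> (f x)\<^sup>2 + (g x)\<^sup>2" by simp
    ultimately show ?thesis by linarith
  qed
  then show "AE x in M. norm (f x * g x) \<le> norm ((f x)\<^sup>2 + (g x)\<^sup>2)" by simp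
qed simp

section \<open>White noise, its filtration, and independence of the future from the past\<close>

locale white_noise_space = prob_space M for M :: "'w measure" +
  fixes L :: real and W :: "(real \<times> real) set \<Rightarrow> 'w \<Rightarrow> real"
  assumes noise: "white_noise M L W"
begin

abbreviation "\<F> \<equiv> noise_filtration M L W"

lemma noise_comb: "finite \<A> \<Longrightarrow> \<A> \<subseteq> noise_sets L \<Longrightarrow> centred_gaussian M (\<lambda>\<omega>. \<Sum>A\<in>\<A>. c A * W A \<omega>)"
  using noise by (simp add: white_noise_def)

lemma noise_cov: "A \<in> noise_sets L \<Longrightarrow> B \<in> noise_sets L \<Longrightarrow>
    expectation (\<lambda>\<omega>. W A \<omega> * W B \<omega>) = measure lborel (A \<inter> B)"
  using noise by (simp add: white_noise_def)

lemma noise_gaussian: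
  assumes "A \<in> noise_sets L" shows "centred_gaussian M (W A)"
  using noise_comb[of "{A}" "\<lambda>_. 1"] assms by simp

lemma noise_measurable [measurable (raw)]: "A \<in> noise_sets L \<Longrightarrow> W A \<in> borel_measurable M"
  using noise_gaussian by (simp add: centred_gaussian_def)

lemma noise_sq_integrable: "A \<in> noise_sets L \<Longrightarrow> integrable M (\<lambda>\<omega>. (W A \<omega>)\<^sup>2)"
  using centred_gaussian_moments(1)[OF noise_gaussian] .

lemma noise_mult_integrable:
  "A \<in> noise_sets L \<Longrightarrow> B \<in> noise_sets L \<Longrightarrow> integrable M (\<lambda>\<omega>. W A \<omega> * W B \<omega>)"
  by (intro integrable_mult_square noise_sq_integrable noise_measurable)

lemma space_filtration [simp]: "space (\<F> t) = space M"
  unfolding noise_filtration_def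
  by (rule space_measure_of) (auto dest: sets.sets_into_space)

lemma sets_filtration:
  "sets (\<F> t) = sigma_sets (space M)
       ({W A -` B \<inter> space M | A B. A \<in> noise_sets L \<and> A \<subseteq> {0<..t} \<times> UNIV \<and> B \<in> sets borel}
        \<union> null_sets M)"
  unfolding noise_filtration_def
  by (rule sets_measure_of) (auto dest: sets.sets_into_space)

lemma filtration_le: "sets (\<F> t) \<subseteq> sets M"
  unfolding sets_filtration
  by (rule sets.sigma_sets_subset) (auto intro!: measurable_sets[OF noise_measurable])

lemma filtration_mono: "s \<le> t \<Longrightarrow> sets (\<F> s) \<subseteq> sets (\<F> t)"
  unfolding sets_filtration by (rule sigma_sets_mono') fastforce

lemma measurable_filtration: "X \<in> borel_measurable (\<F> t) \<Longrightarrow> X \<in> borel_measurable M"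
  using filtration_le[of t] by (intro measurableI) (auto dest: measurable_sets measurable_space)

lemma measurable_filtration_mono:
  "s \<le> t \<Longrightarrow> X \<in> borel_measurable (\<F> s) \<Longrightarrow> X \<in> borel_measurable (\<F> t)"
  using filtration_mono[of s t] by (intro measurableI) (auto dest: measurable_sets measurable_space)

lemma noise_adapted:
  assumes "A \<in> noise_sets L" "A \<subseteq> {0<..t} \<times> UNIV"
  shows "W A \<in> borel_measurable (\<F> t)"
proof (rule measurableI)
  fix B :: "real set" assume "B \<in> sets borel"
  then show "W A -` B \<inter> space (\<F> t) \<in> sets (\<F> t)"
    unfolding sets_filtration using assms by (intro sigma_sets.Basic) auto
qed simp

text \<open>Sets after time t are disjoint from sets up to time t, so all cross covariances vanish.
  The sum of the two combinations is again centred Gaussian, its variance is the sum of the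
  variances, and its characteristic function therefore factors.\<close>

lemma iexp_future_past:
  assumes \<A>: "finite \<A>" "\<A> \<subseteq> noise_sets L" "\<And>A. A \<in> \<A> \<Longrightarrow> A \<subseteq> {t<..} \<times> UNIV"
    and \<B>: "finite \<B>" "\<B> \<subseteq> noise_sets L" "\<And>B. B \<in> \<B> \<Longrightarrow> B \<subseteq> {0<..t} \<times> UNIV"
  shows "(CLINT \<omega>|M. iexp (\<Sum>A\<in>\<A>. d A * W A \<omega>) * iexp (\<Sum>B\<in>\<B>. c B * W B \<omega>)) =
    (CLINT \<omega>|M. iexp (\<Sum>A\<in>\<A>. d A * W A \<omega>)) * (CLINT \<omega>|M. iexp (\<Sum>B\<in>\<B>. c B * W B \<omega>))"
proof -
  define X where "X \<omega> = (\<Sum>A\<in>\<A>. d A * W A \<omega>)" for \<omega>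
  define Y where "Y \<omega> = (\<Sum>B\<in>\<B>. c B * W B \<omega>)" for \<omega>
  \<comment> \<open>A set may belong to both families (only the empty set can), so the coefficients
    are added over the union of the families instead of being defined by cases.\<close>
  define e where "e A = (if A \<in> \<A> then d A else 0) + (if A \<in> \<B> then c A else 0)" for A
  have XY: "(\<Sum>A\<in>\<A> \<union> \<B>. e A * W A \<omega>) = X \<omega> + Y \<omega>" for \<omega>
  proof -
    have "(\<Sum>A\<in>\<A> \<union> \<B>. e A * W A \<omega>) =
      (\<Sum>A\<in>\<A> \<union> \<B>. if A \<in> \<A> then d A * W A \<omega> else 0) + (\<Sum>A\<in>\<A> \<union> \<B>. if A \<in> \<B> then c A * W A \<omega> else 0)"
      unfolding sum.distrib[symmetric] by (intro sum.cong) (auto simp: e_def algebra_simps)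
    also have "(\<Sum>A\<in>\<A> \<union> \<B>. if A \<in> \<A> then d A * W A \<omega> else 0) = X \<omega>"
      unfolding X_def using \<A>(1) \<B>(1) by (intro sum.mono_neutral_cong_right) auto
    also have "(\<Sum>A\<in>\<A> \<union> \<B>. if A \<in> \<B> then c A * W A \<omega> else 0) = Y \<omega>"
      unfolding Y_def using \<A>(1) \<B>(1) by (intro sum.mono_neutral_cong_right) auto
    finally show ?thesis .
  qed
  have gX: "centred_gaussian M X" and gY: "centred_gaussian M Y"
    unfolding X_def[abs_def] Y_def[abs_def] using \<A> \<B> by (auto intro!: noise_comb)
  have gXY: "centred_gaussian M (\<lambda>\<omega>. X \<omega> + Y \<omega>)"
    using noise_comb[of "\<A> \<union> \<B>" e] \<A> \<B> by (simp add: XY)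
  have [measurable]: "X \<in> borel_measurable M" "Y \<in> borel_measurable M"
    using gX gY by (auto simp: centred_gaussian_def)
  note mX = centred_gaussian_moments[OF gX] and mY = centred_gaussian_moments[OF gY]
    and mXY = centred_gaussian_moments[OF gXY]
  have "expectation (\<lambda>\<omega>. X \<omega> * Y \<omega>) = expectation (\<lambda>\<omega>. \<Sum>A\<in>\<A>. \<Sum>B\<in>\<B>. (d A * c B) * (W A \<omega> * W B \<omega>))"
    unfolding X_def Y_def sum_product by (intro Bochner_Integration.integral_cong) (auto simp: ac_simps)
  also have "\<dots> = (\<Sum>A\<in>\<A>. \<Sum>B\<in>\<B>. (d A * c B) * expectation (\<lambda>\<omega>. W A \<omega> * W B \<omega>))"
    using \<A> \<B>
    by (simp add: Bochner_Integration.integral_sum noise_mult_integrable subset_eq)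
  also have "\<dots> = 0"
  proof (intro sum.neutral ballI)
    fix A B assume "A \<in> \<A>" "B \<in> \<B>"
    then have "A \<inter> B \<subseteq> ({t<..} \<times> UNIV) \<inter> ({0<..t} \<times> UNIV)" using \<A>(3) \<B>(3) by blast
    then have "A \<inter> B = {}" by fastforce
    then show "d A * c B * expectation (\<lambda>\<omega>. W A \<omega> * W B \<omega>) = 0"
      using \<open>A \<in> \<A>\<close> \<open>B \<in> \<B>\<close> \<A>(2) \<B>(2) by (subst noise_cov) auto
  qed
  finally have cov0: "expectation (\<lambda>\<omega>. X \<omega> * Y \<omega>) = 0" .
  have iXY: "integrable M (\<lambda>\<omega>. X \<omega> * Y \<omega>)"
    using mX(1) mY(1) by (intro integrable_mult_square) auto
  have "expectation (\<lambda>\<omega>. (X \<omega> + Y \<omega>)\<^sup>2) = expectation (\<lambda>\<omega>. (X \<omega>)\<^sup>2 + (Y \<omega>)\<^sup>2 + 2 * (X \<omega> * Y \<omega>))"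
    by (intro Bochner_Integration.integral_cong) (auto simp: power2_eq_square algebra_simps)
  also have "\<dots> = expectation (\<lambda>\<omega>. (X \<omega>)\<^sup>2) + expectation (\<lambda>\<omega>. (Y \<omega>)\<^sup>2)"
    using mX(1) mY(1) iXY cov0 by simp
  finally have var: "expectation (\<lambda>\<omega>. (X \<omega> + Y \<omega>)\<^sup>2) = expectation (\<lambda>\<omega>. (X \<omega>)\<^sup>2) + expectation (\<lambda>\<omega>. (Y \<omega>)\<^sup>2)" .
  have "(CLINT \<omega>|M. iexp (X \<omega>) * iexp (Y \<omega>)) = (CLINT \<omega>|M. iexp (X \<omega> + Y \<omega>))"
    by (simp add: exp_add algebra_simps)
  also have "\<dots> = (CLINT \<omega>|M. iexp (X \<omega>)) * (CLINT \<omega>|M. iexp (Y \<omega>))"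
    unfolding mXY(4) mX(4) mY(4) var by (simp add: exp_add[symmetric] field_simps flip: of_real_mult)
  finally show ?thesis unfolding X_def Y_def .
qed

text \<open>The exponential of the future is kept fixed. The factorisation gives orthogonality to
  every exponential of finitely many past values; \<open>fourier_null_family\<close> turns these
  into cylinder events, and a pi-system argument extends the result to all of
  \<open>\<F> t\<close>.\<close>

lemma future_orthogonal_past:
  assumes \<A>: "finite \<A>" "\<A> \<subseteq> noise_sets L" "\<And>A. A \<in> \<A> \<Longrightarrow> A \<subseteq> {t<..} \<times> UNIV"
    and G: "G \<in> sets (\<F> t)"
  shows "(CLINT \<omega>|M. (iexp (\<Sum>A\<in>\<A>. d A * W A \<omega>) - (CLINT \<omega>|M. iexp (\<Sum>A\<in>\<A>. d A * W A \<omega>))) * indicator G \<omega>) = 0"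
proof -
  define X where "X \<omega> = (\<Sum>A\<in>\<A>. d A * W A \<omega>)" for \<omega>
  define \<phi> where "\<phi> = (CLINT \<omega>|M. iexp (X \<omega>))"
  have [measurable]: "X \<in> borel_measurable M"
    unfolding X_def[abs_def] using \<A>(2) by (intro borel_measurable_sum) auto
  define V where "V \<omega> = iexp (X \<omega>) - \<phi>" for \<omega>
  have iX: "integrable M (\<lambda>\<omega>. iexp (X \<omega>))"
    using integrable_mult_iexp[of "\<lambda>_. 1" X] by simp
  have V: "integrable M V" unfolding V_def[abs_def] using iX by simp
  then have [measurable]: "V \<in> borel_measurable M" by simp
  \<comment> \<open>Cylinder events of the past. The empty family yields the whole space, and this
    is what settles complements in the induction below.\<close>
  define \<G> where "\<G> = {(\<Inter>A\<in>\<B>. W A -` B A) \<inter> space M | \<B> B. finite \<B> \<and> \<B> \<subseteq> noise_sets L \<and>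
      (\<forall>A\<in>\<B>. A \<subseteq> {0<..t} \<times> UNIV) \<and> (\<forall>A\<in>\<B>. B A \<in> sets borel)}"
  have \<G>: "\<G> \<subseteq> sets M"
  proof
    fix S assume "S \<in> \<G>"
    then obtain \<B> B where S: "S = (\<Inter>A\<in>\<B>. W A -` B A) \<inter> space M" "finite \<B>" "\<B> \<subseteq> noise_sets L" "\<forall>A\<in>\<B>. B A \<in> sets borel"
      by (auto simp: \<G>_def)
    have "S = {\<omega> \<in> space M. \<forall>A\<in>\<B>. W A \<omega> \<in> B A}" unfolding S(1) by auto
    also have "\<dots> \<in> sets M"
      using S by (intro sets.sets_Collect_finite_All) (auto intro!: measurable_sets_Collect[OF noise_measurable] simp: subset_eq)
    finally show "S \<in> sets M" .
  qed
  have sub: "{W A -` B \<inter> space M | A B. A \<in> noise_sets L \<and> A \<subseteq> {0<..t} \<times> UNIV \<and> B \<in> sets borel} \<subseteq> \<G>"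
  proof safe
    fix A and B :: "real set" assume "A \<in> noise_sets L" "A \<subseteq> {0<..t} \<times> UNIV" "B \<in> sets borel"
    then show "W A -` B \<inter> space M \<in> \<G>" unfolding \<G>_def
      by (intro CollectI exI[of _ "{A}"] exI[of _ "\<lambda>_. B"]) auto
  qed
  \<comment> \<open>The filtration is augmented, so the generator has to contain the null sets too;
    intersecting one of them with any event gives a null set again.\<close>
  have Int: "Int_stable (\<G> \<union> null_sets M)"
  proof (rule Int_stableI)
    fix S T assume "S \<in> \<G> \<union> null_sets M" "T \<in> \<G> \<union> null_sets M"
    then consider "S \<in> \<G>" "T \<in> \<G>" | "S \<in> null_sets M" "T \<in> sets M" | "S \<in> sets M" "T \<in> null_sets M"
      using \<G> by auto
    then show "S \<inter> T \<in> \<G> \<union> null_sets M"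
    proof cases
      case 1
      from 1(1) obtain \<B> B where S: "S = (\<Inter>A\<in>\<B>. W A -` B A) \<inter> space M" "finite \<B>" "\<B> \<subseteq> noise_sets L" "\<forall>A\<in>\<B>. A \<subseteq> {0<..t} \<times> UNIV" "\<forall>A\<in>\<B>. B A \<in> sets borel"
        unfolding \<G>_def by blast
      from 1(2) obtain \<C> C where T: "T = (\<Inter>A\<in>\<C>. W A -` C A) \<inter> space M" "finite \<C>" "\<C> \<subseteq> noise_sets L" "\<forall>A\<in>\<C>. A \<subseteq> {0<..t} \<times> UNIV" "\<forall>A\<in>\<C>. C A \<in> sets borel"
        unfolding \<G>_def by blast
      \<comment> \<open>The two cylinders constrain different families of sets; a set missing from
        one of them is given the trivial constraint \<open>UNIV\<close>.\<close>
      let ?D = "\<lambda>A. (if A \<in> \<B> then B A else UNIV) \<inter> (if A \<in> \<C> then C A else UNIV)"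
      have "S \<inter> T = (\<Inter>A\<in>\<B> \<union> \<C>. W A -` ?D A) \<inter> space M"
        unfolding S(1) T(1) by (auto split: if_splits)
      moreover have "finite (\<B> \<union> \<C>)" "\<B> \<union> \<C> \<subseteq> noise_sets L" "\<forall>A\<in>\<B> \<union> \<C>. A \<subseteq> {0<..t} \<times> UNIV"
        "\<forall>A\<in>\<B> \<union> \<C>. ?D A \<in> sets borel"
        using S T by auto
      ultimately have "S \<inter> T \<in> \<G>" unfolding \<G>_def
        by (intro CollectI exI[of _ "\<B> \<union> \<C>"] exI[of _ ?D] conjI) assumption+
      then show ?thesis by simp
    qed (auto intro: null_set_Int1 null_set_Int2)
  qed
  have "sets (\<F> t) = sigma_sets (space M) (\<G> \<union> null_sets M)"
  proof
    show "sets (\<F> t) \<subseteq> sigma_sets (space M) (\<G> \<union> null_sets M)"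
      unfolding sets_filtration using sub by (intro sigma_sets_mono') auto
    have "\<G> \<subseteq> sets (\<F> t)"
    proof
      fix S assume "S \<in> \<G>"
      then obtain \<B> B where S: "S = (\<Inter>A\<in>\<B>. W A -` B A) \<inter> space M" "finite \<B>" "\<B> \<subseteq> noise_sets L" "\<forall>A\<in>\<B>. A \<subseteq> {0<..t} \<times> UNIV" "\<forall>A\<in>\<B>. B A \<in> sets borel"
        unfolding \<G>_def by blast
      have "S = {\<omega> \<in> space (\<F> t). \<forall>A\<in>\<B>. W A \<omega> \<in> B A}" unfolding S(1) by auto
      also have "\<dots> \<in> sets (\<F> t)"
        using S by (intro sets.sets_Collect_finite_All measurable_sets_Collect[OF noise_adapted]) auto
      finally show "S \<in> sets (\<F> t)" .
    qed
    moreover have "null_sets M \<subseteq> sets (\<F> t)" unfolding sets_filtration by auto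
    ultimately have "sigma_sets (space (\<F> t)) (\<G> \<union> null_sets M) \<subseteq> sets (\<F> t)"
      by (intro sets.sigma_sets_subset) auto
    then show "sigma_sets (space M) (\<G> \<union> null_sets M) \<subseteq> sets (\<F> t)" by simp
  qed
  with G have G': "G \<in> sigma_sets (space M) (\<G> \<union> null_sets M)" by simp
  have sM: "sigma_sets (space M) (\<G> \<union> null_sets M) \<subseteq> sets M"
    using \<G> by (intro sets.sigma_sets_subset) auto
  have cl: "\<G> \<union> null_sets M \<subseteq> Pow (space M)"
    using \<G> sets.sets_into_space by auto
  have base: "(CLINT \<omega>|M. V \<omega> * indicator S \<omega>) = 0" if "S \<in> \<G>" for S
  proof -
    from that obtain \<B> B where S: "S = (\<Inter>A\<in>\<B>. W A -` B A) \<inter> space M" "finite \<B>" "\<B> \<subseteq> noise_sets L" "\<forall>A\<in>\<B>. A \<subseteq> {0<..t} \<times> UNIV" "\<forall>A\<in>\<B>. B A \<in> sets borel"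
      unfolding \<G>_def by blast
    have z: "(CLINT \<omega>|M. V \<omega> * (\<Prod>A\<in>\<B>. indicator (B A) (W A \<omega>))) = 0"
    proof (rule fourier_null_family[OF S(2)])
      fix c
      have [measurable]: "(\<lambda>\<omega>. \<Sum>i\<in>\<B>. c i * W i \<omega>) \<in> borel_measurable M"
        using S(3) by (intro borel_measurable_sum) auto
      have i1: "integrable M (\<lambda>\<omega>. iexp (X \<omega>) * iexp (\<Sum>i\<in>\<B>. c i * W i \<omega>))"
        by (intro integrable_mult_iexp iX) auto
      have i2: "integrable M (\<lambda>\<omega>. \<phi> * iexp (\<Sum>i\<in>\<B>. c i * W i \<omega>))"
        by (intro integrable_mult_iexp) auto
      have "(CLINT \<omega>|M. V \<omega> * iexp (\<Sum>i\<in>\<B>. c i * W i \<omega>)) =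
        (CLINT \<omega>|M. iexp (X \<omega>) * iexp (\<Sum>i\<in>\<B>. c i * W i \<omega>) - \<phi> * iexp (\<Sum>i\<in>\<B>. c i * W i \<omega>))"
        by (simp add: V_def left_diff_distrib)
      also have "\<dots> = (CLINT \<omega>|M. iexp (X \<omega>) * iexp (\<Sum>i\<in>\<B>. c i * W i \<omega>)) - (CLINT \<omega>|M. \<phi> * iexp (\<Sum>i\<in>\<B>. c i * W i \<omega>))"
        by (rule Bochner_Integration.integral_diff[OF i1 i2])
      also have "\<dots> = 0"
        unfolding X_def \<phi>_def using \<A> S by (subst iexp_future_past) (auto simp: X_def)
      finally show "(CLINT \<omega>|M. V \<omega> * iexp (\<Sum>i\<in>\<B>. c i * W i \<omega>)) = 0" .
    qed (use S V in auto)
    have "(\<Prod>A\<in>\<B>. indicator (B A) (W A \<omega>)) = (indicator S \<omega> :: complex)" if "\<omega> \<in> space M" for \<omega>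
      unfolding S(1) using that \<open>finite \<B>\<close> by (auto simp: indicator_def prod_zero_iff)
    then have "(CLINT \<omega>|M. V \<omega> * indicator S \<omega>) = (CLINT \<omega>|M. V \<omega> * (\<Prod>A\<in>\<B>. indicator (B A) (W A \<omega>)))"
      by (intro Bochner_Integration.integral_cong) auto
    then show ?thesis using z by simp
  qed
  have iV: "integrable M (\<lambda>\<omega>. V \<omega> * indicator S \<omega>)" if "S \<in> sets M" for S
    using integrable_real_mult_indicator[OF that] V that
    by (intro Bochner_Integration.integrable_bound[OF V]) (auto split: split_indicator)
  have "(CLINT \<omega>|M. V \<omega> * indicator G \<omega>) = 0"
    using Int cl G'
  proof (induction rule: sigma_sets_induct_disjoint)
    case (basic S)
    then show ?case
    proof
      assume "S \<in> null_sets M"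
      then have "AE \<omega> in M. \<omega> \<notin> S" by (rule AE_not_in)
      then show ?thesis by (intro integral_eq_zero_AE) (auto elim!: eventually_mono)
    qed (rule base)
  next
    case (compl S)
    have "S \<in> sets M" using compl(1) sM by auto
    have "space M \<in> \<G>" unfolding \<G>_def by (intro CollectI exI[of _ "{}"]) auto
    from base[OF this] have "(CLINT \<omega>|M. V \<omega>) = 0"
      by (subst (asm) Bochner_Integration.integral_cong[of _ _ _ V]) auto
    moreover have "(CLINT \<omega>|M. V \<omega> * indicator (space M - S) \<omega>) = (CLINT \<omega>|M. V \<omega> - V \<omega> * indicator S \<omega>)"
      by (intro Bochner_Integration.integral_cong) (auto split: split_indicator)
    ultimately show ?case using iV[OF \<open>S \<in> sets M\<close>] V compl(2) by simp
  next
    case (union S)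
    have S: "S i \<in> sets M" for i using union(2) sM by auto
    have sc: "indicator T \<omega> *\<^sub>R V \<omega> = V \<omega> * indicator T \<omega>" for T \<omega>
      by (auto split: split_indicator)
    have "(LINT \<omega>:(\<Union>i. S i)|M. V \<omega>) = (\<Sum>i. (LINT \<omega>:S i|M. V \<omega>))"
    proof (rule lebesgue_integral_countable_add)
      show "S i \<inter> S j = {}" if "i \<noteq> j" for i j using union(1) that by (auto simp: disjoint_family_on_def)
      show "set_integrable M (\<Union> (range S)) V"
        unfolding set_integrable_def using iV[of "\<Union> (range S)"] S
        by (simp add: sc)
    qed (use S in auto)
    then show ?case
      using union(3) unfolding set_lebesgue_integral_def
      by (simp add: sc)
  qed simp
  then show ?thesis by (simp add: V_def \<phi>_def X_def)
qed

text \<open>Now the roles are exchanged: for a fixed past event G the function 1_G - P(G) is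
  orthogonal to all exponentials of the future variable, so a second application of
  \<open>fourier_null\<close> replaces these exponentials by indicators. That is the product rule
  for events.\<close>

lemma indep_future:
  assumes \<A>: "finite \<A>" "\<A> \<subseteq> noise_sets L" "\<And>A. A \<in> \<A> \<Longrightarrow> A \<subseteq> {t<..} \<times> UNIV"
    and X: "X \<in> borel_measurable (\<F> t)"
  shows "indep_var borel X borel (\<lambda>\<omega>. \<Sum>A\<in>\<A>. d A * W A \<omega>)"
proof -
  define N where "N \<omega> = (\<Sum>A\<in>\<A>. d A * W A \<omega>)" for \<omega>
  have [measurable]: "N \<in> borel_measurable M"
    unfolding N_def[abs_def] using \<A>(2) by (intro borel_measurable_sum) auto
  have XM: "X \<in> borel_measurable M" using X by (rule measurable_filtration)
  have ind: "prob (G \<inter> (N -` B \<inter> space M)) = prob G * prob (N -` B \<inter> space M)"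
    if G: "G \<in> sets (\<F> t)" and B [measurable]: "B \<in> sets borel" for G B
  proof -
    have [measurable]: "G \<in> sets M" using G filtration_le by auto
    define V where "V \<omega> = indicator G \<omega> - complex_of_real (prob G)" for \<omega>
    have iG: "integrable M (indicator G :: _ \<Rightarrow> complex)"
      by (rule integrable_const_bound[where B = 1]) (auto split: split_indicator)
    have pG: "(CLINT \<omega>|M. indicator G \<omega>) = complex_of_real (prob G)"
      using integral_complex_of_real[of M "indicator G"] \<open>G \<in> sets M\<close> sets.sets_into_space[of G M]
      by (simp add: of_real_indicator Int_absorb2)
    have V: "integrable M V" unfolding V_def[abs_def] using iG by simp
    have "(CLINT \<omega>|M. V \<omega> * iexp (c * N \<omega>)) = 0" for c
    proof -
      let ?e = "\<lambda>\<omega>. iexp (\<Sum>A\<in>\<A>. (c * d A) * W A \<omega>)"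
      have e: "iexp (c * N \<omega>) = ?e \<omega>" for \<omega> by (simp add: N_def sum_distrib_left ac_simps)
      have [measurable]: "(\<lambda>\<omega>. (\<Sum>A\<in>\<A>. (c * d A) * W A \<omega>)) \<in> borel_measurable M"
        using \<A>(2) by (intro borel_measurable_sum) auto
      have i1: "integrable M ?e"
        using integrable_mult_iexp[of "\<lambda>_. 1" "\<lambda>\<omega>. (\<Sum>A\<in>\<A>. (c * d A) * W A \<omega>)"] by simp
      have i2: "integrable M (\<lambda>\<omega>. indicator G \<omega> * ?e \<omega>)" by (intro integrable_mult_iexp iG) auto
      have "0 = (CLINT \<omega>|M. (?e \<omega> - (CLINT \<omega>|M. ?e \<omega>)) * indicator G \<omega>)"
        using future_orthogonal_past[OF \<A> G, of "\<lambda>A. c * d A"] by simp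
      also have "\<dots> = (CLINT \<omega>|M. indicator G \<omega> * ?e \<omega> - (CLINT \<omega>|M. ?e \<omega>) * indicator G \<omega>)"
        by (simp add: algebra_simps)
      also have "\<dots> = (CLINT \<omega>|M. indicator G \<omega> * ?e \<omega>) - (CLINT \<omega>|M. (CLINT \<omega>|M. ?e \<omega>) * indicator G \<omega>)"
        using i2 iG by (intro Bochner_Integration.integral_diff) auto
      also have "\<dots> = (CLINT \<omega>|M. indicator G \<omega> * ?e \<omega>) - (CLINT \<omega>|M. complex_of_real (prob G) * ?e \<omega>)"
        by (simp add: pG)
      also have "\<dots> = (CLINT \<omega>|M. V \<omega> * ?e \<omega>)"
        unfolding V_def using i1 i2 by (subst Bochner_Integration.integral_diff[symmetric]) (auto simp: algebra_simps)
      finally show ?thesis by (simp only: e)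
    qed
    from fourier_null[OF V _ this B] have "(CLINT \<omega>|M. V \<omega> * indicator B (N \<omega>)) = 0" by simp
    moreover have "(CLINT \<omega>|M. V \<omega> * indicator B (N \<omega>)) =
       (CLINT \<omega>|M. complex_of_real (indicator (G \<inter> (N -` B \<inter> space M)) \<omega> - prob G * indicator (N -` B \<inter> space M) \<omega>))"
      by (intro Bochner_Integration.integral_cong) (auto simp: V_def split: split_indicator)
    ultimately have "expectation (\<lambda>\<omega>. indicator (G \<inter> (N -` B \<inter> space M)) \<omega> - prob G * indicator (N -` B \<inter> space M) \<omega>) = 0"
      by (simp only: integral_complex_of_real of_real_eq_0_iff)
    moreover have "expectation (\<lambda>\<omega>. indicator (G \<inter> (N -` B \<inter> space M)) \<omega> - prob G * indicator (N -` B \<inter> space M) \<omega>) =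
        prob (G \<inter> (N -` B \<inter> space M)) - prob G * prob (N -` B \<inter> space M)"
    proof -
      have iI: "integrable M (indicat_real S)" if "S \<in> events" for S
        by (rule integrable_const_bound[where B = 1]) (use that in \<open>auto split: split_indicator\<close>)
      have e: "G \<inter> (N -` B \<inter> space M) \<in> events" "N -` B \<inter> space M \<in> events" by auto
      have eI: "expectation (indicat_real S) = prob S" if "S \<in> events" for S
        using that sets.sets_into_space[OF that] by (simp add: Int_absorb2)
      show ?thesis using iI[OF e(1)] iI[OF e(2)] eI[OF e(1)] eI[OF e(2)]
        by (simp only: Bochner_Integration.integral_diff integrable_mult_right integral_mult_right_zero)
    qed
    ultimately show ?thesis by simp
  qed
  have "indep_set (sigma_sets (space M) {X -` A \<inter> space M |A. A \<in> sets borel})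
     (sigma_sets (space M) {N -` A \<inter> space M |A. A \<in> sets borel})"
  proof (rule indep_setI)
    have "sigma_sets (space (\<F> t)) {X -` A \<inter> space M |A. A \<in> sets borel} \<subseteq> sets (\<F> t)"
      by (rule sets.sigma_sets_subset) (use measurable_sets[OF X] in auto)
    then have 1: "sigma_sets (space M) {X -` A \<inter> space M |A. A \<in> sets borel} \<subseteq> sets (\<F> t)" by simp
    then show "sigma_sets (space M) {X -` A \<inter> space M |A. A \<in> sets borel} \<subseteq> events"
      using filtration_le by auto
    show "sigma_sets (space M) {N -` A \<inter> space M |A. A \<in> sets borel} \<subseteq> events"
      by (rule sets.sigma_sets_subset) auto
    \<comment> \<open>Preimages of Borel sets already form a \<sigma>-algebra, so the product rule
      established for single preimages covers every event generated by \<open>N\<close>.\<close>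
    have 2: "sigma_sets (space M) {N -` A \<inter> space M |A. A \<in> sets borel} = {N -` A \<inter> space M |A. A \<in> sets borel}"
      using sigma_sets_vimage_commute[of N "space M" UNIV "sets borel"] sets.sigma_sets_eq[of "borel :: real measure"] by simp
    fix a b assume "a \<in> sigma_sets (space M) {X -` A \<inter> space M |A. A \<in> sets borel}"
      "b \<in> sigma_sets (space M) {N -` A \<inter> space M |A. A \<in> sets borel}"
    then show "prob (a \<inter> b) = prob a * prob b" using ind 1 2 by auto
  qed
  then have "indep_var borel X borel N" unfolding indep_var_eq using XM by simp
  then show ?thesis by (simp add: N_def[abs_def])
qed

lemma future_mean:
  assumes A: "A \<in> noise_sets L" "A \<subseteq> {t<..} \<times> UNIV"
    and X: "X \<in> borel_measurable (\<F> t)" "integrable M X"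
  shows "expectation (\<lambda>\<omega>. X \<omega> * W A \<omega>) = 0" "integrable M (\<lambda>\<omega>. X \<omega> * W A \<omega>)"
proof -
  have "indep_var borel X borel (W A)"
    using indep_future[of "{A}" t X "\<lambda>_. 1"] A X by simp
  then show "expectation (\<lambda>\<omega>. X \<omega> * W A \<omega>) = 0" "integrable M (\<lambda>\<omega>. X \<omega> * W A \<omega>)"
    using X(2) centred_gaussian_moments(2,3)[OF noise_gaussian[OF A(1)]]
    by (simp_all add: indep_var_lebesgue_integral indep_var_integrable)
qed

text \<open>Independence is available for one linear combination of the noise at a time, so the
  product of two noise values is reached by polarisation, from the squares of W(A) + W(B), W(A) and
  W(B).\<close>

lemma future_covariance:
  assumes A: "A \<in> noise_sets L" "A \<subseteq> {t<..} \<times> UNIV"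
    and B: "B \<in> noise_sets L" "B \<subseteq> {t<..} \<times> UNIV"
    and X: "X \<in> borel_measurable (\<F> t)" "integrable M X"
  shows "expectation (\<lambda>\<omega>. X \<omega> * (W A \<omega> * W B \<omega>)) = expectation X * measure lborel (A \<inter> B)"
    and "integrable M (\<lambda>\<omega>. X \<omega> * (W A \<omega> * W B \<omega>))"
proof -
  have sq: "integrable M (\<lambda>\<omega>. X \<omega> * (\<Sum>A\<in>\<A>. d A * W A \<omega>)\<^sup>2) \<and>
      expectation (\<lambda>\<omega>. X \<omega> * (\<Sum>A\<in>\<A>. d A * W A \<omega>)\<^sup>2) = expectation X * expectation (\<lambda>\<omega>. (\<Sum>A\<in>\<A>. d A * W A \<omega>)\<^sup>2)"
    if "\<A> \<subseteq> {A, B}" for \<A> d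
  proof -
    have fin: "finite \<A>" "\<A> \<subseteq> noise_sets L" "\<And>S. S \<in> \<A> \<Longrightarrow> S \<subseteq> {t<..} \<times> UNIV"
      using that A B finite_subset[OF that] by auto
    let ?N = "\<lambda>\<omega>. \<Sum>A\<in>\<A>. d A * W A \<omega>"
    have "indep_var borel ((\<lambda>x. x) \<circ> X) borel ((\<lambda>x. x\<^sup>2) \<circ> ?N)"
      by (rule indep_var_compose[OF indep_future[OF fin X(1)]]) auto
    then have "indep_var borel X borel (\<lambda>\<omega>. (?N \<omega>)\<^sup>2)" by (simp add: o_def)
    then show ?thesis
      using indep_var_lebesgue_integral indep_var_integrable X(2)
        centred_gaussian_moments(1)[OF noise_comb[OF fin(1,2)]] by blast
  qed
  \<comment> \<open>If A = B the sum over \<open>{A, B}\<close> has a single term; its coefficient 2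
    keeps the identity \<open>AB\<close> correct.\<close>
  define d where "d S = (if S = A then 1 else 0) + (if S = B then 1 else (0::real))" for S
  have AB: "(\<Sum>S\<in>{A, B}. d S * W S \<omega>) = W A \<omega> + W B \<omega>" for \<omega>
    by (cases "A = B") (auto simp: d_def)
  note s1 = sq[of "{A, B}" d, unfolded AB, simplified]
    and s2 = sq[of "{A}" "\<lambda>_. 1", simplified] and s3 = sq[of "{B}" "\<lambda>_. 1", simplified]
  have pol: "X \<omega> * (W A \<omega> * W B \<omega>) = (X \<omega> * (W A \<omega> + W B \<omega>)\<^sup>2 - X \<omega> * (W A \<omega>)\<^sup>2 - X \<omega> * (W B \<omega>)\<^sup>2) / 2" for \<omega>
    by (simp add: power2_eq_square algebra_simps)
  show "integrable M (\<lambda>\<omega>. X \<omega> * (W A \<omega> * W B \<omega>))"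
    unfolding pol using s1 s2 s3 by simp
  have "(W A \<omega> + W B \<omega>)\<^sup>2 = (W A \<omega>)\<^sup>2 + (W B \<omega>)\<^sup>2 + 2 * (W A \<omega> * W B \<omega>)" for \<omega>
    by (simp add: power2_eq_square algebra_simps)
  then have "expectation (\<lambda>\<omega>. (W A \<omega> + W B \<omega>)\<^sup>2) =
    expectation (\<lambda>\<omega>. (W A \<omega>)\<^sup>2) + expectation (\<lambda>\<omega>. (W B \<omega>)\<^sup>2) + 2 * measure lborel (A \<inter> B)"
    using A B by (simp add: noise_sq_integrable noise_mult_integrable noise_cov)
  then show "expectation (\<lambda>\<omega>. X \<omega> * (W A \<omega> * W B \<omega>)) = expectation X * measure lborel (A \<inter> B)"
    unfolding pol using s1 s2 s3 by (simp add: algebra_simps)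
qed

end

section \<open>The Walsh isometry\<close>

lemma integrable_double_sum:
  fixes f :: "'i \<Rightarrow> 'j \<Rightarrow> 'a \<Rightarrow> real"
  assumes "\<And>i j. i \<in> I \<Longrightarrow> j \<in> J \<Longrightarrow> integrable N (f i j)"
  shows "integrable N (\<lambda>x. \<Sum>i\<in>I. \<Sum>j\<in>J. f i j x)"
  using assms by (intro Bochner_Integration.integrable_sum)

lemma integral_double_sum:
  fixes f :: "'i \<Rightarrow> 'j \<Rightarrow> 'a \<Rightarrow> real"
  assumes "\<And>i j. i \<in> I \<Longrightarrow> j \<in> J \<Longrightarrow> integrable N (f i j)"
  shows "(LINT x|N. (\<Sum>i\<in>I. \<Sum>j\<in>J. f i j x)) = (\<Sum>i\<in>I. \<Sum>j\<in>J. LINT x|N. f i j x)"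
  using assms by (simp add: Bochner_Integration.integral_sum Bochner_Integration.integrable_sum)

text \<open>A weighted form of (a + b)^2 <= 2 a^2 + 2 b^2, from completing a square. It holds with
  infinite values, so it replaces Minkowski's inequality where integrability is not yet known, and
  the factor of the main term tends to 1 as c decreases to 0.\<close>

lemma nn_integral_power2_add_le:
  fixes f g :: "'a \<Rightarrow> real"
  assumes "0 < c" and [measurable]: "f \<in> borel_measurable M" "g \<in> borel_measurable M"
  shows "(\<integral>\<^sup>+x. ennreal ((f x)\<^sup>2) \<partial>M) \<le>
    ennreal (1 + c) * (\<integral>\<^sup>+x. ennreal ((g x)\<^sup>2) \<partial>M) + ennreal (1 + 1 / c) * (\<integral>\<^sup>+x. ennreal ((f x - g x)\<^sup>2) \<partial>M)"
proof -
  have "(f x)\<^sup>2 \<le> (1 + c) * (g x)\<^sup>2 + (1 + 1 / c) * (f x - g x)\<^sup>2" for x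
  proof -
    have "0 \<le> (c * g x - (f x - g x))\<^sup>2 / c" using assms by simp
    also have "\<dots> = (1 + c) * (g x)\<^sup>2 + (1 + 1 / c) * (f x - g x)\<^sup>2 - (f x)\<^sup>2"
      using assms by (simp add: power2_eq_square field_simps)
    finally show ?thesis by simp
  qed
  then have "(\<integral>\<^sup>+x. ennreal ((f x)\<^sup>2) \<partial>M) \<le> (\<integral>\<^sup>+x. ennreal (1 + c) * ennreal ((g x)\<^sup>2) + ennreal (1 + 1 / c) * ennreal ((f x - g x)\<^sup>2) \<partial>M)"
    using assms by (intro nn_integral_mono) (simp flip: ennreal_mult ennreal_plus)
  also have "\<dots> = ennreal (1 + c) * (\<integral>\<^sup>+x. ennreal ((g x)\<^sup>2) \<partial>M) + ennreal (1 + 1 / c) * (\<integral>\<^sup>+x. ennreal ((f x - g x)\<^sup>2) \<partial>M)"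
    by (simp add: nn_integral_add nn_integral_cmult)
  finally show ?thesis .
qed

text \<open>The two limits live on different measure spaces so that the lemma can be used in both
  directions between the strip and the probability space. For fixed c the sequence is sent to its
  limit, which leaves the factor (1 + c)^2; then c is sent to 0.\<close>

lemma nn_integral_power2_limit_le:
  fixes f :: "'a \<Rightarrow> real" and J :: "'b \<Rightarrow> real"
  assumes [measurable]: "f \<in> borel_measurable M" "\<And>n. fn n \<in> borel_measurable M"
    "J \<in> borel_measurable N" "\<And>n. Jn n \<in> borel_measurable N"
    and le: "\<And>n::nat. (\<integral>\<^sup>+x. ennreal ((fn n x)\<^sup>2) \<partial>M) \<le> (\<integral>\<^sup>+x. ennreal ((Jn n x)\<^sup>2) \<partial>N)"
    and f: "(\<lambda>n. \<integral>\<^sup>+x. ennreal ((f x - fn n x)\<^sup>2) \<partial>M) \<longlonglongrightarrow> 0"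
    and J: "(\<lambda>n. \<integral>\<^sup>+x. ennreal ((J x - Jn n x)\<^sup>2) \<partial>N) \<longlonglongrightarrow> 0"
  shows "(\<integral>\<^sup>+x. ennreal ((f x)\<^sup>2) \<partial>M) \<le> (\<integral>\<^sup>+x. ennreal ((J x)\<^sup>2) \<partial>N)"
proof (cases "\<integral>\<^sup>+x. ennreal ((J x)\<^sup>2) \<partial>N")
  case top
  then show ?thesis by simp
next
  case (real a)
  let ?F = "\<integral>\<^sup>+x. ennreal ((f x)\<^sup>2) \<partial>M"
  have bound: "?F \<le> ennreal ((1 + c) * (1 + c) * a)" if c: "0 < c" for c
  proof -
    let ?e = "\<lambda>n. \<integral>\<^sup>+x. ennreal ((f x - fn n x)\<^sup>2) \<partial>M" and ?j = "\<lambda>n. \<integral>\<^sup>+x. ennreal ((J x - Jn n x)\<^sup>2) \<partial>N"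
    have step: "?F \<le> ennreal (1 + c) * (ennreal (1 + c) * ennreal a + ennreal (1 + 1 / c) * ?j n) + ennreal (1 + 1 / c) * ?e n" for n
    proof -
      have sw: "(\<integral>\<^sup>+x. ennreal ((Jn n x - J x)\<^sup>2) \<partial>N) = ?j n" by (simp add: power2_commute)
      have "?F \<le> ennreal (1 + c) * (\<integral>\<^sup>+x. ennreal ((fn n x)\<^sup>2) \<partial>M) + ennreal (1 + 1 / c) * ?e n"
        by (rule nn_integral_power2_add_le[OF c]) auto
      also have "\<dots> \<le> ennreal (1 + c) * (ennreal (1 + c) * (\<integral>\<^sup>+x. ennreal ((J x)\<^sup>2) \<partial>N) + ennreal (1 + 1 / c) * ?j n) + ennreal (1 + 1 / c) * ?e n"
        unfolding sw[symmetric]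
        by (intro add_mono mult_left_mono order.refl order_trans[OF le] nn_integral_power2_add_le[OF c]) auto
      finally show ?thesis unfolding real .
    qed
    have "(\<lambda>n. ennreal (1 + c) * (ennreal (1 + c) * ennreal a + ennreal (1 + 1 / c) * ?j n) + ennreal (1 + 1 / c) * ?e n)
       \<longlonglongrightarrow> ennreal (1 + c) * (ennreal (1 + c) * ennreal a + ennreal (1 + 1 / c) * 0) + ennreal (1 + 1 / c) * 0"
      by (intro tendsto_add tendsto_const ennreal_tendsto_cmult f J) auto
    then have "?F \<le> ennreal (1 + c) * (ennreal (1 + c) * ennreal a + ennreal (1 + 1 / c) * 0) + ennreal (1 + 1 / c) * 0"
      by (rule LIMSEQ_le_const) (use step in auto)
    also have "\<dots> = ennreal ((1 + c) * (1 + c) * a)"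
      using c real(1) by (simp add: ennreal_mult mult.assoc)
    finally show ?thesis .
  qed
  \<comment> \<open>One value of c already shows that the left-hand side is finite, so the limit in
    c can be taken in the reals.\<close>
  from bound[of 1] obtain \<phi> where \<phi>: "?F = ennreal \<phi>" "0 \<le> \<phi>"
    using le_less_trans[OF bound[of 1] ennreal_less_top] by (cases ?F) auto
  have "\<phi> \<le> (1 + c) * (1 + c) * a" if "0 < c" for c
    using bound[OF that] \<phi> real that by (simp add: ennreal_le_iff)
  then have "eventually (\<lambda>c. \<phi> \<le> (1 + c) * (1 + c) * a) (at_right 0)"
    by (auto simp: eventually_at_right_field intro: exI[of _ 1])
  moreover have "((\<lambda>c. (1 + c) * (1 + c) * a) \<longlongrightarrow> (1 + 0) * (1 + 0) * a) (at_right 0)"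
    by (intro tendsto_intros)
  ultimately have "\<phi> \<le> (1 + 0) * (1 + 0) * a"
    by (intro tendsto_lowerbound) auto
  then show ?thesis using \<phi> real by (simp add: ennreal_leI)
qed

section \<open>Integrands as functions on the product of time, space and probability space\<close>

abbreviation strip_measure :: "'w measure \<Rightarrow> (real \<times> real \<times> 'w) measure" where
  "strip_measure M \<equiv> lborel \<Otimes>\<^sub>M (lborel \<Otimes>\<^sub>M M)"

text \<open>Predictability constrains an integrand only on the strip. Extension by zero discards its
  arbitrary values elsewhere and gives a function that can be measurable on the whole
  product.\<close>

definition strip_extend :: "real \<Rightarrow> (real \<Rightarrow> real \<Rightarrow> 'w \<Rightarrow> real) \<Rightarrow> real \<times> real \<times> 'w \<Rightarrow> real" where
  "strip_extend L f = (\<lambda>(s, y, \<omega>). indicator {0<..} s * indicator {0<..<L} y * f s y \<omega>)"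

context white_noise_space
begin

text \<open>The estimates use predictability in the form of joint measurability in time, space and
  chance, which is what Tonelli needs. It is checked on the generating rectangles, whose event
  factors lie in \<open>M\<close> because the filtration does.\<close>

lemma predictable_measurable:
  assumes f: "predictable M \<F> D f" and D: "D \<in> sets borel"
  shows "(\<lambda>(s, y, \<omega>). indicator {0<..} s * indicator D y * f s y \<omega>)
    \<in> borel_measurable (strip_measure M)"
proof -
  let ?\<Omega> = "{0<..} \<times> D \<times> space M :: (real \<times> real \<times> 'w) set"
  let ?G = "{{a<..b} \<times> A \<times> G | a b A G.
          0 \<le> a \<and> a < b \<and> A \<in> sets borel \<and> A \<subseteq> D \<and> G \<in> sets (\<F> a)}"
  have GP: "?G \<subseteq> Pow ?\<Omega>"
  proof safe
    fix a b A G s y \<omega> assume "G \<in> sets (\<F> a)" "\<omega> \<in> G"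
    then show "\<omega> \<in> space M" using sets.sets_into_space[of G "\<F> a"] by auto
  qed auto
  have \<Omega>: "?\<Omega> \<in> sets (strip_measure M)" using D by auto
  have G: "?G \<subseteq> sets (restrict_space (strip_measure M) ?\<Omega>)"
  proof safe
    fix a b A G assume *: "0 \<le> a" "a < b" "A \<in> sets borel" "A \<subseteq> D" "G \<in> sets (\<F> a)"
    then have "G \<in> sets M" using filtration_le by auto
    then have "{a<..b} \<times> A \<times> G \<in> sets (strip_measure M)" using * by auto
    moreover have "{a<..b} \<times> A \<times> G \<subseteq> ?\<Omega>"
      using * sets.sets_into_space[OF \<open>G \<in> sets M\<close>] by auto
    ultimately show "{a<..b} \<times> A \<times> G \<in> sets (restrict_space (strip_measure M) ?\<Omega>)"
      using \<Omega> by (subst sets_restrict_space_iff) auto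
  qed
  have sub: "sets (predictable_algebra M \<F> D) \<subseteq> sets (restrict_space (strip_measure M) ?\<Omega>)"
  proof -
    have "sigma_sets (space (restrict_space (strip_measure M) ?\<Omega>)) ?G \<subseteq> sets (restrict_space (strip_measure M) ?\<Omega>)"
      by (rule sets.sigma_sets_subset[OF G])
    moreover have sp: "space (restrict_space (strip_measure M) ?\<Omega>) = ?\<Omega>"
      by (auto simp: space_restrict_space space_pair_measure)
    ultimately show ?thesis unfolding predictable_algebra_def sets_measure_of[OF GP] by simp
  qed
  have sp: "space (predictable_algebra M \<F> D) = space (restrict_space (strip_measure M) ?\<Omega>)"
    unfolding predictable_algebra_def space_measure_of[OF GP]
    by (auto simp: space_restrict_space space_pair_measure)
  have fm: "(\<lambda>(s, y, \<omega>). f s y \<omega>) \<in> borel_measurable (predictable_algebra M \<F> D)"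
    using f by (simp add: predictable_def)
  have "(\<lambda>(s, y, \<omega>). f s y \<omega>) \<in> borel_measurable (restrict_space (strip_measure M) ?\<Omega>)"
  proof (rule measurableI)
    fix B :: "real set" assume "B \<in> sets borel"
    from measurable_sets[OF fm this]
    show "(\<lambda>(s, y, \<omega>). f s y \<omega>) -` B \<inter> space (restrict_space (strip_measure M) ?\<Omega>) \<in> sets (restrict_space (strip_measure M) ?\<Omega>)"
      unfolding sp by (rule subsetD[OF sub])
  qed simp
  then have "(\<lambda>x. indicator ?\<Omega> x *\<^sub>R (case x of (s, y, \<omega>) \<Rightarrow> f s y \<omega>)) \<in> borel_measurable (strip_measure M)"
    using \<Omega> by (subst (asm) borel_measurable_restrict_space_iff) auto
  also have "?this \<longleftrightarrow> ?thesis"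
    by (intro measurable_cong) (auto simp: space_pair_measure indicator_def)
  finally show ?thesis .
qed

lemma strip_extend_predictable:
  "predictable M \<F> {0<..<L} f \<Longrightarrow> strip_extend L f \<in> borel_measurable (strip_measure M)"
  unfolding strip_extend_def by (rule predictable_measurable) auto

lemma walsh_norm_sq_eq:
  assumes [measurable]: "strip_extend L f \<in> borel_measurable (strip_measure M)"
  shows "walsh_norm_sq M L f = (\<integral>\<^sup>+z. ennreal ((strip_extend L f z)\<^sup>2) \<partial>strip_measure M)"
proof -
  interpret lM: sigma_finite_measure "lborel \<Otimes>\<^sub>M M :: (real \<times> 'w) measure"
    by (intro sigma_finite_pair_measure sigma_finite_lborel) unfold_locales
  have "(\<integral>\<^sup>+z. ennreal ((strip_extend L f z)\<^sup>2) \<partial>strip_measure M) =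
    (\<integral>\<^sup>+s. \<integral>\<^sup>+y. \<integral>\<^sup>+\<omega>. ennreal ((strip_extend L f (s, y, \<omega>))\<^sup>2) \<partial>M \<partial>lborel \<partial>lborel)"
    by (subst lM.nn_integral_fst[symmetric], simp, subst nn_integral_fst[symmetric]) auto
  also have "\<dots> = walsh_norm_sq M L f"
    unfolding walsh_norm_sq_def strip_extend_def
    by (auto intro!: nn_integral_cong split: split_indicator)
  finally show ?thesis ..
qed

section \<open>Elementary integrals and their covariances\<close>

lemma time_space_rectangle:
  assumes "0 \<le> a" "A \<in> sets borel" "A \<subseteq> {0<..<L}"
  shows "{a<..b} \<times> A \<in> noise_sets L"
proof -
  have "emeasure lborel ({a<..b} \<times> A) = emeasure lborel {a<..b} * emeasure lborel A"
    using assms by (subst lborel_prod[symmetric], subst lborel.emeasure_pair_measure_Times) auto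
  moreover have "emeasure lborel A \<le> emeasure lborel {0<..<L}"
    using assms by (intro emeasure_mono) auto
  then have "emeasure lborel A < \<infinity>" by (rule le_less_trans) (use emeasure_bounded_finite[of "{0<..<L}"] in simp)
  ultimately show ?thesis
    unfolding noise_sets_def using assms
    by (cases "a \<le> b") (auto simp: ennreal_mult_less_top intro!: borel_Times)
qed

lemma measure_rectangle:
  assumes "A \<in> sets borel" "B \<in> sets borel"
  shows "measure lborel (A \<times> B :: (real \<times> real) set) = measure lborel A * measure lborel B"
  using assms unfolding measure_def
  by (subst lborel_prod[symmetric], subst lborel.emeasure_pair_measure_Times) (auto simp: enn2real_mult)

text \<open>Additivity is a consequence of the covariance: expanding the square, the defect has
  second moment |A u B| + |A| + |B| - 2 |A| - 2 |B| = 0 for disjoint A and B, the cross term between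
  A and B being zero.\<close>

lemma noise_additive:
  assumes A: "A \<in> noise_sets L" and B: "B \<in> noise_sets L" and disj: "A \<inter> B = {}"
  shows "AE \<omega> in M. W (A \<union> B) \<omega> = W A \<omega> + W B \<omega>"
proof -
  have Af: "emeasure lborel A < \<infinity>" "A \<in> sets lborel" and Bf: "emeasure lborel B < \<infinity>" "B \<in> sets lborel"
    using A B by (auto simp: noise_sets_def)
  have AB: "A \<union> B \<in> noise_sets L"
    using A B emeasure_subadditive[of A lborel B] by (auto simp: noise_sets_def le_less_trans ennreal_add_less_top)
  have m: "measure lborel (A \<union> B) = measure lborel A + measure lborel B"
    using Af Bf disj by (intro measure_Union) auto
  let ?D = "\<lambda>\<omega>. W (A \<union> B) \<omega> - W A \<omega> - W B \<omega>"
  have ex: "(?D \<omega>)\<^sup>2 = W (A \<union> B) \<omega> * W (A \<union> B) \<omega> + W A \<omega> * W A \<omega> + W B \<omega> * W B \<omega>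
      - 2 * (W (A \<union> B) \<omega> * W A \<omega>) - 2 * (W (A \<union> B) \<omega> * W B \<omega>) + 2 * (W A \<omega> * W B \<omega>)" for \<omega>
    by (simp add: power2_eq_square algebra_simps)
  have i: "integrable M (\<lambda>\<omega>. (?D \<omega>)\<^sup>2)"
    unfolding ex by (intro Bochner_Integration.integrable_add Bochner_Integration.integrable_diff integrable_mult_right noise_mult_integrable A B AB)
  have "(A \<union> B) \<inter> A = A" "(A \<union> B) \<inter> B = B" by auto
  then have "expectation (\<lambda>\<omega>. (?D \<omega>)\<^sup>2) = 0"
    unfolding ex using A B AB m disj by (simp add: noise_mult_integrable noise_cov)
  then have "AE \<omega> in M. (?D \<omega>)\<^sup>2 = 0"
    using integral_nonneg_eq_0_iff_AE[OF i] by simp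
  then show ?thesis by eventually_elim simp
qed

lemma bounded_measurable_integrable:
  assumes "X \<in> borel_measurable M" "bounded (X ` space M)" shows "integrable M (X :: _ \<Rightarrow> real)"
proof -
  obtain C where "\<And>x. x \<in> space M \<Longrightarrow> norm (X x) \<le> C"
    using assms(2) by (auto simp: bounded_iff)
  then show ?thesis using assms(1) by (intro integrable_const_bound[where B = C]) auto
qed

text \<open>Splitting \<open>(a,b]\<close> at \<open>c\<close>: the part before \<open>c\<close> is \<open>\<F> c\<close>-measurable, hence orthogonal to the second
  increment; on the part after \<open>c\<close> both increments are independent of \<open>\<F> c\<close>.\<close>

lemma elementary_inner_ordered:
  assumes 1: "(X, a, b, A) \<in> elementary_integrands M L W" and 2: "(Y, c, d, B) \<in> elementary_integrands M L W"
    and "a \<le> c"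
  shows "integrable M (\<lambda>\<omega>. (X \<omega> * W ({a<..b} \<times> A) \<omega>) * (Y \<omega> * W ({c<..d} \<times> B) \<omega>))" (is ?i)
    and "expectation (\<lambda>\<omega>. (X \<omega> * W ({a<..b} \<times> A) \<omega>) * (Y \<omega> * W ({c<..d} \<times> B) \<omega>)) =
      expectation (\<lambda>\<omega>. X \<omega> * Y \<omega>) * (measure lborel ({a<..b} \<inter> {c<..d}) * measure lborel (A \<inter> B))" (is ?e)
proof -
  have a: "0 \<le> a" "a < b" "A \<in> sets borel" "A \<subseteq> {0<..<L}" "X \<in> borel_measurable (\<F> a)" "bounded (X ` space M)"
    and c: "0 \<le> c" "c < d" "B \<in> sets borel" "B \<subseteq> {0<..<L}" "Y \<in> borel_measurable (\<F> c)" "bounded (Y ` space M)"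
    using 1 2 by (auto simp: elementary_integrands_def)
  \<comment> \<open>With \<open>min b c\<close> the case b <= c needs no separate treatment: then
    \<open>R1\<close> is the whole rectangle and \<open>R2\<close> is empty.\<close>
  define R1 where "R1 = {a<..min b c} \<times> A"
  define R2 where "R2 = {c<..b} \<times> A"
  define S where "S = {c<..d} \<times> B"
  have R1: "R1 \<in> noise_sets L" "R1 \<subseteq> {0<..c} \<times> UNIV"
    and R2: "R2 \<in> noise_sets L" "R2 \<subseteq> {c<..} \<times> UNIV"
    and S: "S \<in> noise_sets L" "S \<subseteq> {c<..} \<times> UNIV"
    unfolding R1_def R2_def S_def using a c by (auto intro!: time_space_rectangle)
  have "R1 \<inter> R2 = {}" by (auto simp: R1_def R2_def)
  then have "AE \<omega> in M. W (R1 \<union> R2) \<omega> = W R1 \<omega> + W R2 \<omega>" by (rule noise_additive[OF R1(1) R2(1)])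
  moreover have "R1 \<union> R2 = {a<..b} \<times> A" using \<open>a \<le> c\<close> by (auto simp: R1_def R2_def)
  ultimately have split: "AE \<omega> in M. W ({a<..b} \<times> A) \<omega> = W R1 \<omega> + W R2 \<omega>" by simp
  have R: "{a<..b} \<times> A \<in> noise_sets L" using a by (intro time_space_rectangle) auto
  have XF: "X \<in> borel_measurable (\<F> c)" using a \<open>a \<le> c\<close> by (intro measurable_filtration_mono[of a c])
  then have XYF: "(\<lambda>\<omega>. X \<omega> * Y \<omega>) \<in> borel_measurable (\<F> c)" using c by simp
  have XM[measurable]: "X \<in> borel_measurable M" "Y \<in> borel_measurable M"
    using XF c by (auto intro: measurable_filtration)
  obtain CX where CX: "\<And>x. x \<in> space M \<Longrightarrow> norm (X x) \<le> CX"
    using a(6) by (auto simp: bounded_iff)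
  obtain CY where CY: "\<And>x. x \<in> space M \<Longrightarrow> norm (Y x) \<le> CY"
    using c(6) by (auto simp: bounded_iff)
  have CXY: "norm (X x * Y x) \<le> CX * CY" if "x \<in> space M" for x
    unfolding norm_mult using CX[OF that] CY[OF that] order_trans[OF norm_ge_zero CX[OF that]]
    by (intro mult_mono) auto
  have XY: "integrable M (\<lambda>\<omega>. X \<omega> * Y \<omega>)"
    using CXY by (intro integrable_const_bound[where B = "CX * CY"]) auto
  have "(\<lambda>\<omega>. (X \<omega> * Y \<omega>) * W R1 \<omega>) \<in> borel_measurable (\<F> c)"
    using XYF noise_adapted[OF R1] by simp
  moreover have "integrable M (\<lambda>\<omega>. (X \<omega> * Y \<omega>) * W R1 \<omega>)"
  proof (rule Bochner_Integration.integrable_bound)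
    show "integrable M (\<lambda>\<omega>. (CX * CY) * W R1 \<omega>)"
      using centred_gaussian_moments(2)[OF noise_gaussian[OF R1(1)]] by simp
    show "AE \<omega> in M. norm (X \<omega> * Y \<omega> * W R1 \<omega>) \<le> norm (CX * CY * W R1 \<omega>)"
    proof (rule AE_I2)
      fix \<omega> assume "\<omega> \<in> space M"
      from CXY[OF this] have "\<bar>X \<omega> * Y \<omega>\<bar> \<le> \<bar>CX * CY\<bar>" by simp
      from mult_right_mono[OF this, of "\<bar>W R1 \<omega>\<bar>"]
      show "norm (X \<omega> * Y \<omega> * W R1 \<omega>) \<le> norm (CX * CY * W R1 \<omega>)" by (simp add: abs_mult)
    qed
  qed (use R1 in measurable)
  ultimately have t1: "expectation (\<lambda>\<omega>. ((X \<omega> * Y \<omega>) * W R1 \<omega>) * W S \<omega>) = 0"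
    "integrable M (\<lambda>\<omega>. ((X \<omega> * Y \<omega>) * W R1 \<omega>) * W S \<omega>)"
    using future_mean[OF S] by auto
  have "R2 \<inter> S = ({a<..b} \<inter> {c<..d}) \<times> (A \<inter> B)"
    using \<open>a \<le> c\<close> by (auto simp: R2_def S_def)
  then have "measure lborel (R2 \<inter> S) = measure lborel ({a<..b} \<inter> {c<..d}) * measure lborel (A \<inter> B)"
    using a c by (simp add: measure_rectangle)
  with future_covariance[OF R2 S XYF XY]
  have t2: "expectation (\<lambda>\<omega>. (X \<omega> * Y \<omega>) * (W R2 \<omega> * W S \<omega>)) =
      expectation (\<lambda>\<omega>. X \<omega> * Y \<omega>) * (measure lborel ({a<..b} \<inter> {c<..d}) * measure lborel (A \<inter> B))"
    "integrable M (\<lambda>\<omega>. (X \<omega> * Y \<omega>) * (W R2 \<omega> * W S \<omega>))" by auto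
  have eq: "AE \<omega> in M. ((X \<omega> * Y \<omega>) * W R1 \<omega>) * W S \<omega> + (X \<omega> * Y \<omega>) * (W R2 \<omega> * W S \<omega>) =
      (X \<omega> * W ({a<..b} \<times> A) \<omega>) * (Y \<omega> * W ({c<..d} \<times> B) \<omega>)"
    using split by eventually_elim (simp add: algebra_simps S_def)
  have meas: "(\<lambda>\<omega>. (X \<omega> * W ({a<..b} \<times> A) \<omega>) * (Y \<omega> * W ({c<..d} \<times> B) \<omega>)) \<in> borel_measurable M"
    using noise_measurable[OF R] noise_measurable[OF S(1)] by (simp add: S_def)
  have isum: "integrable M (\<lambda>\<omega>. ((X \<omega> * Y \<omega>) * W R1 \<omega>) * W S \<omega> + (X \<omega> * Y \<omega>) * (W R2 \<omega> * W S \<omega>))"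
    using t1(2) t2(2) by (rule Bochner_Integration.integrable_add)
  show ?i by (rule integrable_cong_AE_imp[OF isum meas]) (use eq in \<open>auto elim!: eventually_mono\<close>)
  have "expectation (\<lambda>\<omega>. (X \<omega> * W ({a<..b} \<times> A) \<omega>) * (Y \<omega> * W ({c<..d} \<times> B) \<omega>)) =
    expectation (\<lambda>\<omega>. ((X \<omega> * Y \<omega>) * W R1 \<omega>) * W S \<omega> + (X \<omega> * Y \<omega>) * (W R2 \<omega> * W S \<omega>))"
    by (rule integral_cong_AE[OF meas borel_measurable_integrable[OF isum]]) (use eq in \<open>auto elim!: eventually_mono\<close>)
  also have "\<dots> = expectation (\<lambda>\<omega>. X \<omega> * Y \<omega>) * (measure lborel ({a<..b} \<inter> {c<..d}) * measure lborel (A \<inter> B))"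
    using Bochner_Integration.integral_add[OF t1(2) t2(2)] t1(1) t2(1) by simp
  finally show ?e .
qed

lemma elementary_inner:
  assumes 1: "(X, a, b, A) \<in> elementary_integrands M L W" and 2: "(Y, c, d, B) \<in> elementary_integrands M L W"
  shows "integrable M (\<lambda>\<omega>. (X \<omega> * W ({a<..b} \<times> A) \<omega>) * (Y \<omega> * W ({c<..d} \<times> B) \<omega>))" (is ?i)
    and "expectation (\<lambda>\<omega>. (X \<omega> * W ({a<..b} \<times> A) \<omega>) * (Y \<omega> * W ({c<..d} \<times> B) \<omega>)) =
      expectation (\<lambda>\<omega>. X \<omega> * Y \<omega>) * (measure lborel ({a<..b} \<inter> {c<..d}) * measure lborel (A \<inter> B))" (is ?e)
proof -
  have "?i \<and> ?e"
  proof (cases "a \<le> c")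
    case True
    then show ?thesis using elementary_inner_ordered[OF 1 2] by simp
  next
    case False
    then show ?thesis using elementary_inner_ordered[OF 2 1] by (simp add: ac_simps Int_ac)
  qed
  then show ?i ?e by auto
qed


text \<open>The summands may overlap in time and space. No refinement into disjoint pieces is made:
  both sides are expanded into double sums over pairs of summands, and these agree term by term by
  \<open>elementary_inner\<close>.\<close>

lemma simple_isometry:
  assumes es: "set es \<subseteq> elementary_integrands M L W"
  shows "(\<integral>\<^sup>+\<omega>. ennreal ((simple_walsh_integral W es \<omega>)\<^sup>2) \<partial>M) = walsh_norm_sq M L (simple_integrand es)"
    and "integrable M (\<lambda>\<omega>. (simple_walsh_integral W es \<omega>)\<^sup>2)"
    and "integrable M (simple_walsh_integral W es)"
    and "expectation (simple_walsh_integral W es) = 0"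
    and "strip_extend L (simple_integrand es) \<in> borel_measurable (strip_measure M)"
proof -
  define n where "n = length es"
  define X where "X i = fst (es ! i)" for i
  define a where "a i = fst (snd (es ! i))" for i
  define b where "b i = fst (snd (snd (es ! i)))" for i
  define A where "A i = snd (snd (snd (es ! i)))" for i
  have esi: "es ! i = (X i, a i, b i, A i)" for i
    by (simp add: X_def a_def b_def A_def)
  have el: "(X i, a i, b i, A i) \<in> elementary_integrands M L W" if "i < n" for i
    using es that esi[of i] nth_mem[of i es] by (auto simp: n_def)
  have el': "0 \<le> a i" "a i < b i" "A i \<in> sets borel" "A i \<subseteq> {0<..<L}" "X i \<in> borel_measurable (\<F> (a i))"
    "bounded (X i ` space M)" "X i \<in> borel_measurable M" if "i < n" for i
  proof -
    from el[OF that] have *: "0 \<le> a i \<and> a i < b i \<and> A i \<in> sets borel \<and> A i \<subseteq> {0<..<L} \<and>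
        X i \<in> borel_measurable (\<F> (a i)) \<and> bounded (X i ` space M)"
      unfolding elementary_integrands_def mem_Collect_eq split_conv .
    then show "0 \<le> a i" "a i < b i" "A i \<in> sets borel" "A i \<subseteq> {0<..<L}" "X i \<in> borel_measurable (\<F> (a i))"
      "bounded (X i ` space M)" by blast+
    from * show "X i \<in> borel_measurable M" using measurable_filtration by blast
  qed
  have iX: "integrable M (X i)" if "i < n" for i
    using el'[OF that] by (intro bounded_measurable_integrable) auto
  have iXX: "integrable M (\<lambda>\<omega>. X i \<omega> * X j \<omega>)" if ij: "i < n" "j < n" for i j
  proof -
    obtain Ci where Ci: "\<And>x. x \<in> space M \<Longrightarrow> norm (X i x) \<le> Ci" using el'(6)[OF ij(1)] by (auto simp: bounded_iff)
    show ?thesis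
    proof (rule Bochner_Integration.integrable_bound)
      show "integrable M (\<lambda>\<omega>. Ci * X j \<omega>)" using iX[OF ij(2)] by simp
      show "AE x in M. norm (X i x * X j x) \<le> norm (Ci * X j x)"
      proof (rule AE_I2)
        fix x assume "x \<in> space M"
        from Ci[OF this] show "norm (X i x * X j x) \<le> norm (Ci * X j x)"
          unfolding norm_mult by (intro mult_right_mono) auto
      qed
    qed (use el'(7) ij in auto)
  qed
  define I where "I = simple_walsh_integral W es"
  define V where "V i \<omega> = X i \<omega> * W ({a i<..b i} \<times> A i) \<omega>" for i \<omega>
  define T where "T i = {a i<..b i}" for i
  define E where "E i j = expectation (\<lambda>\<omega>. X i \<omega> * X j \<omega>)" for i j
  have I: "I = (\<lambda>\<omega>. \<Sum>i<n. V i \<omega>)"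
    by (auto simp: I_def simple_walsh_integral_def sum_list_sum_nth esi n_def V_def atLeast0LessThan fun_eq_iff)
  have S: "simple_integrand es s y \<omega> = (\<Sum>i<n. X i \<omega> * (indicator (T i) s * indicator (A i) y))" for s y \<omega>
    by (auto simp: simple_integrand_def sum_list_sum_nth esi n_def T_def atLeast0LessThan ac_simps)
  have VV: "integrable M (\<lambda>\<omega>. V i \<omega> * V j \<omega>)"
    "expectation (\<lambda>\<omega>. V i \<omega> * V j \<omega>) = E i j * (measure lborel (T i \<inter> T j) * measure lborel (A i \<inter> A j))"
    if "i < n" "j < n" for i j
    using elementary_inner[OF el[OF that(1)] el[OF that(2)]] by (simp_all add: V_def T_def E_def)
  have V0: "integrable M (V i) \<and> expectation (V i) = 0" if "i < n" for i
    using future_mean[OF time_space_rectangle, of "a i" "A i" "b i" "a i" "X i"] el'[OF that] iX[OF that]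
    by (auto simp: V_def[abs_def] Times_subset_cancel2 subset_iff)
  have sq: "(I \<omega>)\<^sup>2 = (\<Sum>i<n. \<Sum>j<n. V i \<omega> * V j \<omega>)" for \<omega>
    by (simp add: I power2_eq_square sum_product)
  show i2: "integrable M (\<lambda>\<omega>. (simple_walsh_integral W es \<omega>)\<^sup>2)"
    unfolding I_def[symmetric] sq by (intro integrable_double_sum VV) auto
  show "integrable M (simple_walsh_integral W es)" "expectation (simple_walsh_integral W es) = 0"
    unfolding I_def[symmetric] I using V0 by auto
  define c where "c i s y = (indicator (T i) s * indicator (A i) y :: real)" for i s y
  have strip: "strip_extend L (simple_integrand es) = (\<lambda>(s, y, \<omega>). \<Sum>i<n. X i \<omega> * c i s y)"
  proof (intro ext, safe)
    fix s y \<omega>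
    have "indicator {0<..} s * indicator {0<..<L} y * (X i \<omega> * c i s y) = X i \<omega> * c i s y" if "i < n" for i
      using el'[OF that] by (auto simp: c_def T_def split: split_indicator)
    then show "strip_extend L (simple_integrand es) (s, y, \<omega>) = (\<Sum>i<n. X i \<omega> * c i s y)"
      unfolding strip_extend_def split_conv S c_def sum_distrib_left by (intro sum.cong) auto
  qed
  show "strip_extend L (simple_integrand es) \<in> borel_measurable (strip_measure M)"
    unfolding strip
  proof (subst case_prod_beta', subst case_prod_beta', intro borel_measurable_sum)
    fix i assume "i \<in> {..<n}"
    then have [measurable]: "X i \<in> borel_measurable M" "A i \<in> sets borel" "T i \<in> sets borel" using el'[of i] by (auto simp: T_def)
    show "(\<lambda>x. X i (snd (snd x)) * c i (fst x) (fst (snd x))) \<in> borel_measurable (strip_measure M)"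
      unfolding c_def by measurable
  qed
  \<comment> \<open>Single terms of the double sums can be negative, so each of the three
    integrations is carried out in the reals. Only the totals \<open>h\<close> and \<open>g\<close>
    are known to be nonnegative, as integrals of nonnegative functions, and only they are converted
    to \<open>ennreal\<close>.\<close>
  define h where "h s y = (\<Sum>i<n. \<Sum>j<n. E i j * (indicator (T i \<inter> T j) s * indicator (A i \<inter> A j) y))" for s y
  have h: "(\<integral>\<^sup>+\<omega>. ennreal ((\<Sum>i<n. X i \<omega> * c i s y)\<^sup>2) \<partial>M) = ennreal (h s y)" and h0: "0 \<le> h s y" for s y
  proof -
    have e: "(\<Sum>i<n. X i \<omega> * c i s y)\<^sup>2 = (\<Sum>i<n. \<Sum>j<n. (X i \<omega> * X j \<omega>) * (c i s y * c j s y))" for \<omega>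
      by (simp add: power2_eq_square sum_product ac_simps)
    have i: "integrable M (\<lambda>\<omega>. (\<Sum>i<n. X i \<omega> * c i s y)\<^sup>2)"
      unfolding e by (intro integrable_double_sum integrable_mult_left iXX) auto
    have "expectation (\<lambda>\<omega>. (\<Sum>i<n. X i \<omega> * c i s y)\<^sup>2) = (\<Sum>i<n. \<Sum>j<n. E i j * (c i s y * c j s y))"
    proof -
      have "expectation (\<lambda>\<omega>. (\<Sum>i<n. X i \<omega> * c i s y)\<^sup>2) = (\<Sum>i<n. \<Sum>j<n. expectation (\<lambda>\<omega>. (X i \<omega> * X j \<omega>) * (c i s y * c j s y)))"
        unfolding e by (rule integral_double_sum) (intro integrable_mult_left iXX, simp_all)
      also have "\<dots> = (\<Sum>i<n. \<Sum>j<n. E i j * (c i s y * c j s y))"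
        unfolding E_def by (intro sum.cong refl integral_mult_left) (use iXX in auto)
      finally show ?thesis .
    qed
    also have "\<dots> = h s y"
      unfolding h_def c_def by (intro sum.cong) (auto split: split_indicator)
    finally have eh: "expectation (\<lambda>\<omega>. (\<Sum>i<n. X i \<omega> * c i s y)\<^sup>2) = h s y" .
    have "0 \<le> expectation (\<lambda>\<omega>. (\<Sum>i<n. X i \<omega> * c i s y)\<^sup>2)" by (intro Bochner_Integration.integral_nonneg) auto
    then show "0 \<le> h s y" unfolding eh .
    show "(\<integral>\<^sup>+\<omega>. ennreal ((\<Sum>i<n. X i \<omega> * c i s y)\<^sup>2) \<partial>M) = ennreal (h s y)"
      unfolding eh[symmetric] by (rule nn_integral_eq_integral[OF i]) auto
  qed
  have finT: "emeasure lborel (T i \<inter> T j) < \<infinity>" for i j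
    unfolding T_def by (intro emeasure_bounded_finite bounded_Int) auto
  have finA: "emeasure lborel (A i \<inter> A j) < \<infinity>" if "i < n" for i j
    using bounded_subset[of "{0<..<L}" "A i \<inter> A j"] el'(4)[OF that] by (intro emeasure_bounded_finite) auto
  have Tm: "T i \<in> sets borel" for i by (simp add: T_def)
  define g where "g s = (\<Sum>i<n. \<Sum>j<n. E i j * measure lborel (A i \<inter> A j) * indicator (T i \<inter> T j) s)" for s
  have h1: "(\<integral>\<^sup>+y. ennreal (h s y) \<partial>lborel) = ennreal (g s)" and g0: "0 \<le> g s" for s
  proof -
    have iA: "integrable lborel (indicat_real (A i \<inter> A j))" if "i < n" "j < n" for i j
      using finA[OF that(1)] el'(3) that by (intro integrable_real_indicator) auto
    have i: "integrable lborel (h s)"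
      unfolding h_def[abs_def] by (intro integrable_double_sum integrable_mult_right iA) auto
    have e: "(LBINT y. h s y) = g s"
    proof -
      have "(LBINT y. h s y) = (\<Sum>i<n. \<Sum>j<n. LBINT y. E i j * (indicator (T i \<inter> T j) s * indicator (A i \<inter> A j) y))"
        unfolding h_def by (rule integral_double_sum) (intro integrable_mult_right iA, simp_all)
      also have "\<dots> = g s"
        unfolding g_def using el'(3) by (intro sum.cong refl) simp
      finally show ?thesis .
    qed
    have "0 \<le> (LBINT y. h s y)" using h0 by (intro Bochner_Integration.integral_nonneg) auto
    then show "0 \<le> g s" unfolding e .
    show "(\<integral>\<^sup>+y. ennreal (h s y) \<partial>lborel) = ennreal (g s)"
      unfolding e[symmetric] by (rule nn_integral_eq_integral[OF i]) (use h0 in auto)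
  qed
  have h2: "(\<integral>\<^sup>+s. ennreal (g s) \<partial>lborel) =
    ennreal (\<Sum>i<n. \<Sum>j<n. E i j * (measure lborel (T i \<inter> T j) * measure lborel (A i \<inter> A j)))"
  proof -
    have iT: "integrable lborel (indicat_real (T i \<inter> T j))" for i j
      using finT Tm by (intro integrable_real_indicator) auto
    have i: "integrable lborel g"
      unfolding g_def[abs_def] by (intro integrable_double_sum integrable_mult_right iT)
    have e: "(LBINT s. g s) = (\<Sum>i<n. \<Sum>j<n. E i j * (measure lborel (T i \<inter> T j) * measure lborel (A i \<inter> A j)))"
    proof -
      have "(LBINT s. g s) = (\<Sum>i<n. \<Sum>j<n. LBINT s. E i j * measure lborel (A i \<inter> A j) * indicator (T i \<inter> T j) s)"
        unfolding g_def by (rule integral_double_sum) (intro integrable_mult_right iT)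
      also have "\<dots> = (\<Sum>i<n. \<Sum>j<n. E i j * (measure lborel (T i \<inter> T j) * measure lborel (A i \<inter> A j)))"
        using Tm by (intro sum.cong refl) simp
      finally show ?thesis .
    qed
    show ?thesis
      unfolding e[symmetric] by (rule nn_integral_eq_integral[OF i]) (use g0 in auto)
  qed
  have "walsh_norm_sq M L (simple_integrand es) =
     (\<integral>\<^sup>+s. \<integral>\<^sup>+y. \<integral>\<^sup>+\<omega>. ennreal ((strip_extend L (simple_integrand es) (s, y, \<omega>))\<^sup>2) \<partial>M \<partial>lborel \<partial>lborel)"
    unfolding walsh_norm_sq_def strip_extend_def
    by (auto intro!: nn_integral_cong split: split_indicator)
  also have "\<dots> = ennreal (\<Sum>i<n. \<Sum>j<n. E i j * (measure lborel (T i \<inter> T j) * measure lborel (A i \<inter> A j)))"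
    by (simp add: strip h h1 h2)
  also have "\<dots> = ennreal (expectation (\<lambda>\<omega>. (I \<omega>)\<^sup>2))"
  proof -
    have "expectation (\<lambda>\<omega>. (I \<omega>)\<^sup>2) = (\<Sum>i<n. \<Sum>j<n. expectation (\<lambda>\<omega>. V i \<omega> * V j \<omega>))"
      unfolding sq by (rule integral_double_sum) (intro VV(1), simp_all)
    then show ?thesis using VV(2) by simp
  qed
  also have "\<dots> = (\<integral>\<^sup>+\<omega>. ennreal ((I \<omega>)\<^sup>2) \<partial>M)"
    using i2 by (intro nn_integral_eq_integral[symmetric]) (auto simp: I_def)
  finally show "(\<integral>\<^sup>+\<omega>. ennreal ((simple_walsh_integral W es \<omega>)\<^sup>2) \<partial>M) = walsh_norm_sq M L (simple_integrand es)"
    by (simp add: I_def)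
qed

lemma strip_extend_diff:
  "strip_extend L (\<lambda>s y \<omega>. f s y \<omega> - g s y \<omega>) z = strip_extend L f z - strip_extend L g z"
  by (cases z) (simp add: strip_extend_def algebra_simps)

text \<open>Along the approximating sequence the norms on both sides are equal, so the limit lemma,
  applied once in each direction, gives two inequalities between the limits.\<close>

lemma walsh_isometry:
  assumes "has_walsh_integral M L W f J"
  shows "(\<integral>\<^sup>+\<omega>. ennreal ((J \<omega>)\<^sup>2) \<partial>M) = walsh_norm_sq M L f"
    and "integrable M (\<lambda>\<omega>. (J \<omega>)\<^sup>2)" and "integrable M J" and "expectation J = 0"
proof -
  obtain es where es: "\<And>n. set (es n) \<subseteq> elementary_integrands M L W"
    and f: "predictable M \<F> {0<..<L} f" and fin: "walsh_norm_sq M L f < \<infinity>" and J[measurable]: "J \<in> borel_measurable M"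
    and 1: "(\<lambda>n. walsh_norm_sq M L (\<lambda>s y \<omega>. f s y \<omega> - simple_integrand (es n) s y \<omega>)) \<longlonglongrightarrow> 0"
    and 2: "(\<lambda>n. \<integral>\<^sup>+\<omega>. ennreal ((J \<omega> - simple_walsh_integral W (es n) \<omega>)\<^sup>2) \<partial>M) \<longlonglongrightarrow> 0"
    using assms unfolding has_walsh_integral_def by blast
  define Jn where "Jn n = simple_walsh_integral W (es n)" for n
  define fn where "fn n = simple_integrand (es n)" for n
  note iso = simple_isometry[OF es, folded Jn_def fn_def]
  have [measurable]: "strip_extend L f \<in> borel_measurable (strip_measure M)" by (rule strip_extend_predictable[OF f])
  have [measurable]: "strip_extend L (fn n) \<in> borel_measurable (strip_measure M)" for n by (rule iso(5))
  have [measurable]: "Jn n \<in> borel_measurable M" for n using iso(3)[of n] by simp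
  have eq: "(\<integral>\<^sup>+z. ennreal ((strip_extend L (fn n) z)\<^sup>2) \<partial>strip_measure M) = (\<integral>\<^sup>+\<omega>. ennreal ((Jn n \<omega>)\<^sup>2) \<partial>M)" for n
    by (simp add: iso(1) walsh_norm_sq_eq)
  have "walsh_norm_sq M L (\<lambda>s y \<omega>. f s y \<omega> - fn n s y \<omega>) =
      (\<integral>\<^sup>+z. ennreal ((strip_extend L f z - strip_extend L (fn n) z)\<^sup>2) \<partial>strip_measure M)" for n
    by (subst walsh_norm_sq_eq) (simp_all add: strip_extend_diff[abs_def])
  then have one: "(\<lambda>n. \<integral>\<^sup>+z. ennreal ((strip_extend L f z - strip_extend L (fn n) z)\<^sup>2) \<partial>strip_measure M) \<longlonglongrightarrow> 0"
    using 1 by (simp add: fn_def)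
  have two: "(\<lambda>n. \<integral>\<^sup>+\<omega>. ennreal ((J \<omega> - Jn n \<omega>)\<^sup>2) \<partial>M) \<longlonglongrightarrow> 0" using 2 by (simp add: Jn_def)
  have "(\<integral>\<^sup>+z. ennreal ((strip_extend L f z)\<^sup>2) \<partial>strip_measure M) \<le> (\<integral>\<^sup>+\<omega>. ennreal ((J \<omega>)\<^sup>2) \<partial>M)"
    by (rule nn_integral_power2_limit_le[of _ "strip_measure M" "\<lambda>n. strip_extend L (fn n)" _ _ Jn]) (use eq one two in auto)
  moreover have "(\<integral>\<^sup>+\<omega>. ennreal ((J \<omega>)\<^sup>2) \<partial>M) \<le> (\<integral>\<^sup>+z. ennreal ((strip_extend L f z)\<^sup>2) \<partial>strip_measure M)"
    by (rule nn_integral_power2_limit_le[of _ M Jn _ "strip_measure M" "\<lambda>n. strip_extend L (fn n)"]) (use eq one two in auto)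
  ultimately show main: "(\<integral>\<^sup>+\<omega>. ennreal ((J \<omega>)\<^sup>2) \<partial>M) = walsh_norm_sq M L f"
    by (simp add: walsh_norm_sq_eq)
  show J2: "integrable M (\<lambda>\<omega>. (J \<omega>)\<^sup>2)"
    by (rule integrableI_nonneg) (use main fin in auto)
  show J1: "integrable M J" by (rule square_integrable_imp_integrable[OF J J2])
  \<comment> \<open>\<open>Jn n\<close> is centred, so the error J - Jn has the mean of J. The
    square of a mean is at most the second moment, and the second moment of the error tends to
    0.\<close>
  have bound: "ennreal ((expectation J)\<^sup>2) \<le> (\<integral>\<^sup>+\<omega>. ennreal ((J \<omega> - Jn n \<omega>)\<^sup>2) \<partial>M)" for n
  proof -
    let ?D = "\<lambda>\<omega>. J \<omega> - Jn n \<omega>"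
    have "integrable M (\<lambda>\<omega>. J \<omega> * Jn n \<omega>)"
      using J2 iso(2) by (intro integrable_mult_square) auto
    moreover have "(?D \<omega>)\<^sup>2 = (J \<omega>)\<^sup>2 + (Jn n \<omega>)\<^sup>2 - 2 * (J \<omega> * Jn n \<omega>)" for \<omega>
      by (simp add: power2_eq_square algebra_simps)
    ultimately have D2: "integrable M (\<lambda>\<omega>. (?D \<omega>)\<^sup>2)" using J2 iso(2) by simp
    have D1: "integrable M ?D" using J1 iso(3) by simp
    have "expectation ?D = expectation J" using J1 iso(3,4) by simp
    moreover have "(expectation ?D)\<^sup>2 \<le> expectation (\<lambda>\<omega>. (?D \<omega>)\<^sup>2)"
      using variance_eq[OF D1 D2] variance_positive[of ?D] by linarith
    ultimately have "(expectation J)\<^sup>2 \<le> expectation (\<lambda>\<omega>. (?D \<omega>)\<^sup>2)" by simp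
    then have "ennreal ((expectation J)\<^sup>2) \<le> ennreal (expectation (\<lambda>\<omega>. (?D \<omega>)\<^sup>2))" by (rule ennreal_leI)
    also have "\<dots> = (\<integral>\<^sup>+\<omega>. ennreal ((?D \<omega>)\<^sup>2) \<partial>M)"
      by (rule nn_integral_eq_integral[OF D2, symmetric]) auto
    finally show ?thesis .
  qed
  have "ennreal ((expectation J)\<^sup>2) \<le> 0"
    by (rule LIMSEQ_le_const[OF two]) (use bound in auto)
  then show "expectation J = 0" by simp
qed

end

section \<open>The Neumann heat kernel\<close>

definition cos_mode :: "real \<Rightarrow> nat \<Rightarrow> real \<Rightarrow> real" where
  "cos_mode L n y = cos (real n * pi * y / L)"

text \<open>The reciprocal of the squared L2 norm of the mode on [0,L], which normalises the
  expansion.\<close>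

definition mode_weight :: "real \<Rightarrow> nat \<Rightarrow> real" where
  "mode_weight L n = (if n = 0 then 1 / L else 2 / L)"

text \<open>The eigenvalue of minus one half of the Neumann Laplacian that belongs to the n-th
  cosine.\<close>

definition mode_rate :: "real \<Rightarrow> nat \<Rightarrow> real" where
  "mode_rate L n = (real n * pi / L)\<^sup>2 / 2"

text \<open>The eigenfunction expansion of the Neumann kernel. This explicit form is symmetric in x
  and y, and jointly measurable in all three real variables, including times t <= 0 where the sum
  has no meaning as a kernel.\<close>

definition cos_kernel :: "real \<Rightarrow> real \<Rightarrow> real \<Rightarrow> real \<Rightarrow> real" where
  "cos_kernel L t x y = (\<Sum>n. mode_weight L n * exp (- mode_rate L n * t) * cos_mode L n x * cos_mode L n y)"

text \<open>A majorant, uniform in y, for the squared L2 norm of the kernel, obtained by replacing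
  each squared cosine by 1. It takes values in \<open>ennreal\<close>: the sum is infinite for r <=
  0, and integrating it term by term then needs no convergence argument.\<close>

definition mode_decay :: "real \<Rightarrow> real \<Rightarrow> ennreal" where
  "mode_decay L r = (\<Sum>n. ennreal (mode_weight L n * exp (- 2 * mode_rate L n * r)))"

lemma borel_measurable_mode_decay [measurable]: "mode_decay L \<in> borel_measurable borel"
  unfolding mode_decay_def[abs_def] by measurable

lemma abs_cos_mode_le_1 [simp]: "\<bar>cos_mode L n y\<bar> \<le> 1"
  by (simp add: cos_mode_def)

lemma cos_mode_0 [simp]: "cos_mode L 0 y = 1"
  by (simp add: cos_mode_def)

lemma mode_rate_nonneg [simp]: "0 \<le> mode_rate L n"
  by (simp add: mode_rate_def)

lemma continuous_on_cos_mode [continuous_intros]: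
  fixes f :: "'a::t2_space \<Rightarrow> real"
  shows "continuous_on S f \<Longrightarrow> continuous_on S (\<lambda>z. cos_mode L n (f z))"
  unfolding cos_mode_def divide_inverse by (intro continuous_intros)

lemma borel_measurable_cos_mode [measurable (raw)]:
  "f \<in> borel_measurable M \<Longrightarrow> (\<lambda>z. cos_mode L n (f z)) \<in> borel_measurable M"
  using measurable_compose[OF _ borel_measurable_continuous_onI[OF continuous_on_cos_mode[OF continuous_on_id]]]
  by blast

lemma borel_measurable_cos_kernel [measurable (raw)]:
  assumes [measurable]: "f \<in> borel_measurable M" "g \<in> borel_measurable M" "h \<in> borel_measurable M"
  shows "(\<lambda>z. cos_kernel L (f z) (g z) (h z)) \<in> borel_measurable M"
  unfolding cos_kernel_def by measurable

lemma cos_kernel_commute: "cos_kernel L t x y = cos_kernel L t y x"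
  by (simp add: cos_kernel_def ac_simps)

locale interval =
  fixes L :: real
  assumes L: "0 < L"
begin

lemma mode_weight_pos [simp]: "0 < mode_weight L n" and mode_weight_nonneg [simp]: "0 \<le> mode_weight L n"
  using L by (auto simp: mode_weight_def)

lemma mode_weight_neq_0 [simp]: "mode_weight L n \<noteq> 0"
  by (metis mode_weight_pos less_irrefl)

lemma mode_weight_le: "mode_weight L n \<le> 2 / L"
  using L by (auto simp: mode_weight_def field_simps)

lemma set_integrable_continuous: "continuous_on {0..L} f \<Longrightarrow> set_integrable lborel {0..L} (f :: real \<Rightarrow> real)"
  by (rule borel_integrable_atLeastAtMost')

lemma integral_FTC:
  fixes f F :: "real \<Rightarrow> real"
  assumes "\<And>y. y \<in> {0..L} \<Longrightarrow> (F has_real_derivative f y) (at y within {0..L})" "continuous_on {0..L} f"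
  shows "(LBINT y:{0..L}. f y) = F L - F 0"
  unfolding set_lebesgue_integral_def
  using assms L by (intro integral_FTC_atLeastAtMost) (auto simp: has_real_derivative_iff_has_vector_derivative[symmetric])

lemma cos_mode_mult: "cos_mode L n y * cos_mode L m y = (cos ((real n - real m) * pi / L * y) + cos ((real n + real m) * pi / L * y)) / 2"
proof -
  have "real n * pi * y / L - real m * pi * y / L = (real n - real m) * pi / L * y"
    "real n * pi * y / L + real m * pi * y / L = (real n + real m) * pi / L * y"
    by (simp_all add: algebra_simps add_divide_distrib diff_divide_distrib)
  then show ?thesis unfolding cos_mode_def cos_times_cos by simp
qed

lemma integral_cos_int:
  assumes "k \<in> \<int>"
  shows "(LBINT y:{0..L}. cos (k * pi / L * y)) = (if k = 0 then L else 0)"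
proof (cases "k = 0")
  case True
  have "(LBINT y:{0..L}. (1::real)) = L - 0"
    by (rule integral_FTC[of "\<lambda>y. y"]) (auto intro!: derivative_eq_intros)
  then show ?thesis using True by simp
next
  case False
  have "(LBINT y:{0..L}. cos (k * pi / L * y)) = sin (k * pi / L * L) / (k * pi / L) - sin (k * pi / L * 0) / (k * pi / L)"
    using False L by (intro integral_FTC) (auto intro!: derivative_eq_intros continuous_intros simp: field_simps)
  moreover have "sin (k * pi) = 0" using assms by (metis sin_integer_2pi Ints_cases mult.commute sin_int_times_real sin_npi_int)
  ultimately show ?thesis using False L by simp
qed

lemma cos_mode_orthogonal:
  "(LBINT y:{0..L}. cos_mode L n y * cos_mode L m y) = (if n = m then 1 / mode_weight L n else 0)"
proof -
  have i: "set_integrable lborel {0..L} (\<lambda>y. cos (k * pi / L * y))" for k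
    by (rule set_integrable_continuous) (intro continuous_intros)
  have "(LBINT y:{0..L}. cos_mode L n y * cos_mode L m y) =
     ((LBINT y:{0..L}. cos ((real n - real m) * pi / L * y)) + (LBINT y:{0..L}. cos ((real n + real m) * pi / L * y))) / 2"
    unfolding cos_mode_mult by (subst set_integral_add(2)[OF i i, symmetric]) simp
  also have "\<dots> = (if n = m then 1 / mode_weight L n else 0)"
    by (subst (1 2) integral_cos_int) (use L in \<open>auto simp: mode_weight_def\<close>)
  finally show ?thesis .
qed

text \<open>The rates grow like n^2 and n^2 >= n, so a geometric series dominates.\<close>

lemma summable_mode_exp:
  assumes "0 < t" shows "summable (\<lambda>n. exp (- mode_rate L n * t))"
proof (rule summable_comparison_test)
  let ?r = "exp (- mode_rate L 1 * t)"
  have "mode_rate L 1 > 0" using L by (simp add: mode_rate_def)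
  then show "summable (\<lambda>n. ?r ^ n)" using assms by (intro summable_geometric) simp
  have "norm (exp (- mode_rate L n * t)) \<le> ?r ^ n" for n
  proof -
    have "real n * 1 \<le> real n * real n" by (cases n) (auto intro!: mult_left_mono)
    then have "real n * (pi / L)\<^sup>2 \<le> (real n * real n) * (pi / L)\<^sup>2" by (intro mult_right_mono) auto
    then have "real n * mode_rate L 1 \<le> mode_rate L n"
      by (simp add: mode_rate_def power2_eq_square field_simps)
    then have "real n * mode_rate L 1 * t \<le> mode_rate L n * t" using assms by (intro mult_right_mono) auto
    then show ?thesis by (simp add: exp_of_nat_mult[symmetric] ac_simps)
  qed
  then show "\<exists>N. \<forall>n\<ge>N. norm (exp (- mode_rate L n * t)) \<le> ?r ^ n" by blast
qed

lemma cos_kernel_term_le: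
  "norm (mode_weight L n * exp (- mode_rate L n * t) * cos_mode L n x * cos_mode L n y) \<le> 2 / L * exp (- mode_rate L n * t)"
proof -
  have "\<bar>cos_mode L n x\<bar> * \<bar>cos_mode L n y\<bar> \<le> 1 * 1" by (intro mult_mono) auto
  moreover have w: "mode_weight L n * exp (- mode_rate L n * t) \<le> 2 / L * exp (- mode_rate L n * t)"
    by (intro mult_right_mono mode_weight_le) simp
  ultimately have "(mode_weight L n * exp (- mode_rate L n * t)) * (\<bar>cos_mode L n x\<bar> * \<bar>cos_mode L n y\<bar>) \<le> (2 / L * exp (- mode_rate L n * t)) * (1 * 1)"
    by (intro mult_mono[OF w]) (use L in auto)
  then show ?thesis by (simp add: abs_mult ac_simps)
qed

lemma summable_cos_kernel_bound: "0 < t \<Longrightarrow> summable (\<lambda>n. 2 / L * exp (- mode_rate L n * t))"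
  by (intro summable_mult summable_mode_exp)

lemma summable_cos_kernel:
  assumes "0 < t"
  shows "summable (\<lambda>n. norm (mode_weight L n * exp (- mode_rate L n * t) * cos_mode L n x * cos_mode L n y))"
  by (rule summable_comparison_test[OF _ summable_cos_kernel_bound[OF assms]])
     (use cos_kernel_term_le in \<open>auto intro!: exI[of _ 0]\<close>)

lemma cos_kernel_bounded:
  assumes "0 < t" shows "\<bar>cos_kernel L t x y\<bar> \<le> (\<Sum>n. 2 / L * exp (- mode_rate L n * t))"
proof -
  have "norm (cos_kernel L t x y) \<le> (\<Sum>n. norm (mode_weight L n * exp (- mode_rate L n * t) * cos_mode L n x * cos_mode L n y))"
    unfolding cos_kernel_def by (rule summable_norm[OF summable_cos_kernel[OF assms]])
  also have "\<dots> \<le> (\<Sum>n. 2 / L * exp (- mode_rate L n * t))"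
    by (intro suminf_le cos_kernel_term_le summable_cos_kernel summable_cos_kernel_bound assms)
  finally show ?thesis by simp
qed

lemma continuous_on_cos_kernel:
  assumes "0 < t" shows "continuous_on S (\<lambda>y. cos_kernel L t x y)"
  unfolding cos_kernel_def
proof (rule uniform_limit_theorem)
  show "uniform_limit S (\<lambda>N y. \<Sum>n<N. mode_weight L n * exp (- mode_rate L n * t) * cos_mode L n x * cos_mode L n y)
     (\<lambda>y. \<Sum>n. mode_weight L n * exp (- mode_rate L n * t) * cos_mode L n x * cos_mode L n y) sequentially"
    by (rule Weierstrass_m_test[OF cos_kernel_term_le summable_cos_kernel_bound[OF assms]])
  show "\<forall>\<^sub>F N in sequentially. continuous_on S (\<lambda>y. \<Sum>n<N. mode_weight L n * exp (- mode_rate L n * t) * cos_mode L n x * cos_mode L n y)"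
    by (intro always_eventually allI continuous_intros)
qed simp

text \<open>Termwise integration is legitimate because the terms of the series are bounded by a
  summable sequence that does not involve y. Taking a mode for h yields the cosine coefficients of
  the kernel, and taking the kernel itself yields its L2 norm.\<close>

lemma integral_cos_kernel:
  assumes t: "0 < t" and h: "set_integrable lborel {0..L} h"
  shows "(LBINT y:{0..L}. cos_kernel L t x y * h y) =
     (\<Sum>n. mode_weight L n * exp (- mode_rate L n * t) * cos_mode L n x * (LBINT y:{0..L}. cos_mode L n y * h y))" (is "_ = (\<Sum>n. ?c n * _)")
    and "set_integrable lborel {0..L} (\<lambda>y. cos_kernel L t x y * h y)"
    and "set_integrable lborel {0..L} (\<lambda>y. cos_mode L n y * h y)"
proof -
  let ?H = "\<lambda>y. indicator {0..L} y *\<^sub>R h y"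
  have H: "integrable lborel ?H" using h by (simp add: set_integrable_def)
  have cH: "integrable lborel (\<lambda>y. cos_mode L n y * ?H y)" for n
    by (rule Bochner_Integration.integrable_bound[OF H])
       (use H in \<open>auto simp: abs_mult mult_left_le_one_le intro!: AE_I2\<close>)
  then show "set_integrable lborel {0..L} (\<lambda>y. cos_mode L n y * h y)"
    by (simp add: set_integrable_def ac_simps)
  let ?f = "\<lambda>n y. ?c n * (cos_mode L n y * ?H y)"
  have i: "integrable lborel (?f n)" for n using cH by simp
  have bd: "norm (?f n y) \<le> (2 / L * exp (- mode_rate L n * t)) * norm (?H y)" for n y
  proof -
    have "norm (?f n y) = norm (?c n * cos_mode L n y) * norm (?H y)" by (simp add: abs_mult ac_simps)
    also have "\<dots> \<le> (2 / L * exp (- mode_rate L n * t)) * norm (?H y)"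
      by (intro mult_right_mono cos_kernel_term_le) auto
    finally show ?thesis .
  qed
  have s1: "summable (\<lambda>n. norm (?f n y))" for y
    by (rule summable_norm_comparison_test[OF exI[of _ 0] summable_mult2[OF summable_cos_kernel_bound[OF t], of "norm (?H y)"]])
       (intro allI impI bd)
  have s2: "summable (\<lambda>n. LBINT y. norm (?f n y))"
  proof (rule summable_comparison_test)
    have "norm (LBINT y. norm (?f n y)) \<le> (2 / L * exp (- mode_rate L n * t)) * (LBINT y. norm (?H y))" for n
    proof -
      have "norm (LBINT y. norm (?f n y)) = (LBINT y. norm (?f n y))" by simp
      also have "\<dots> \<le> (LBINT y. (2 / L * exp (- mode_rate L n * t)) * norm (?H y))"
        by (intro integral_mono bd integrable_norm i integrable_mult_right H)
      finally show ?thesis by simp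
    qed
    then show "\<exists>N. \<forall>n\<ge>N. norm (LBINT y. norm (?f n y)) \<le> (2 / L * exp (- mode_rate L n * t)) * (LBINT y. norm (?H y))"
      by blast
    show "summable (\<lambda>n. (2 / L * exp (- mode_rate L n * t)) * (LBINT y. norm (?H y)))"
      by (intro summable_mult2 summable_cos_kernel_bound t)
  qed
  have sum: "(\<Sum>n. ?f n y) = indicator {0..L} y *\<^sub>R (cos_kernel L t x y * h y)" for y
  proof -
    have "(\<Sum>n. ?c n * cos_mode L n y) * ?H y = (\<Sum>n. ?c n * cos_mode L n y * ?H y)"
      by (rule suminf_mult2) (rule summable_norm_cancel, rule summable_cos_kernel[OF t])
    then show ?thesis by (simp add: cos_kernel_def ac_simps)
  qed
  have fint: "(LBINT y. ?f n y) = ?c n * (LBINT y:{0..L}. cos_mode L n y * h y)" for n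
  proof -
    have "cos_mode L n y * ?H y = indicator {0..L} y *\<^sub>R (cos_mode L n y * h y)" for y by simp
    then show ?thesis unfolding set_lebesgue_integral_def by (simp only: integral_mult_right_zero)
  qed
  have "integrable lborel (\<lambda>y. \<Sum>n. ?f n y)"
    by (rule integrable_suminf[OF i _ s2]) (use s1 in auto)
  then show "set_integrable lborel {0..L} (\<lambda>y. cos_kernel L t x y * h y)"
    unfolding sum set_integrable_def .
  have "(LBINT y. (\<Sum>n. ?f n y)) = (\<Sum>n. LBINT y. ?f n y)"
    by (rule integral_suminf[OF i _ s2]) (use s1 in auto)
  then show "(LBINT y:{0..L}. cos_kernel L t x y * h y) = (\<Sum>n. ?c n * (LBINT y:{0..L}. cos_mode L n y * h y))"
    unfolding sum fint by (simp add: set_lebesgue_integral_def)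
qed

section \<open>Parseval's identity and bounds for the squared kernel\<close>

lemma cos_kernel_coefficient:
  assumes "0 < t"
  shows "(LBINT y:{0..L}. cos_kernel L t x y * cos_mode L m y) = exp (- mode_rate L m * t) * cos_mode L m x"
proof -
  have "set_integrable lborel {0..L} (cos_mode L m)" by (rule set_integrable_continuous) (intro continuous_intros)
  from integral_cos_kernel(1)[OF assms this]
  have "(LBINT y:{0..L}. cos_kernel L t x y * cos_mode L m y) =
    (\<Sum>n. if n = m then exp (- mode_rate L m * t) * cos_mode L m x else 0)"
    by (simp add: cos_mode_orthogonal if_distrib[of "\<lambda>x. _ * x"] cong: if_cong)
  then show ?thesis using sums_single[of m "\<lambda>n. exp (- mode_rate L m * t) * cos_mode L m x"]
    by (simp add: sums_iff)
qed

text \<open>Parseval's identity: by symmetry the kernel is expanded in x, and its n-th coefficient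
  is again an exponential times the mode at y. The two exponentials multiply, whence the factor 2 in
  the exponent.\<close>

lemma cos_kernel_square_integral:
  assumes t: "0 < t"
  shows "(LBINT x:{0..L}. (cos_kernel L t x y)\<^sup>2) = (\<Sum>n. mode_weight L n * exp (- 2 * mode_rate L n * t) * (cos_mode L n y)\<^sup>2)"
    and "set_integrable lborel {0..L} (\<lambda>x. (cos_kernel L t x y)\<^sup>2)"
proof -
  have h: "set_integrable lborel {0..L} (\<lambda>x. cos_kernel L t y x)"
    by (rule set_integrable_continuous) (rule continuous_on_cos_kernel[OF t])
  show "set_integrable lborel {0..L} (\<lambda>x. (cos_kernel L t x y)\<^sup>2)"
    using integral_cos_kernel(2)[OF t h, of y] by (simp add: power2_eq_square cos_kernel_commute[of L t _ y])
  have "(LBINT x:{0..L}. (cos_kernel L t x y)\<^sup>2) = (LBINT x:{0..L}. cos_kernel L t y x * cos_kernel L t y x)"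
    by (simp add: power2_eq_square cos_kernel_commute[of L t _ y])
  also have "\<dots> = (\<Sum>n. mode_weight L n * exp (- mode_rate L n * t) * cos_mode L n y * (exp (- mode_rate L n * t) * cos_mode L n y))"
    by (subst integral_cos_kernel(1)[OF t h]) (simp add: cos_kernel_coefficient[OF t] mult.commute[of "cos_mode L _ _" "cos_kernel L t _ _"])
  also have "\<dots> = (\<Sum>n. mode_weight L n * exp (- 2 * mode_rate L n * t) * (cos_mode L n y)\<^sup>2)"
    by (intro suminf_cong) (simp add: power2_eq_square mult_exp_exp ac_simps)
  finally show "(LBINT x:{0..L}. (cos_kernel L t x y)\<^sup>2) = (\<Sum>n. mode_weight L n * exp (- 2 * mode_rate L n * t) * (cos_mode L n y)\<^sup>2)" .
qed

text \<open>A single mode may vanish at y, but cos a and cos 2a are never both small: with z = (cos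
  a)^2, the sum of their squares is z + (2z - 1)^2 = (2z - 3/4)^2 + 7/16. Pairing n with 2n for n up
  to N uses each mode up to 2N at most twice, and this halves 7/16 to 7/32. The bound is uniform in
  y, up to the boundary.\<close>

lemma cos_mode_square_sum_ge: "(7 / 32) * real N \<le> (\<Sum>n\<in>{1..2 * N}. (cos_mode L n y)\<^sup>2)"
proof -
  define \<theta> where "\<theta> = pi * y / L"
  have c: "cos_mode L n y = cos (real n * \<theta>)" for n by (simp add: cos_mode_def \<theta>_def mult.assoc)
  have "7 / 16 \<le> (cos a)\<^sup>2 + (cos (2 * a))\<^sup>2" for a :: real
  proof -
    have "(cos a)\<^sup>2 + (cos (2 * a))\<^sup>2 - 7 / 16 = (2 * (cos a)\<^sup>2 - 3 / 4)\<^sup>2"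
      unfolding cos_double_cos by (simp add: power2_eq_square algebra_simps)
    then show ?thesis by (metis diff_ge_0_iff_ge zero_le_power2)
  qed
  then have "(\<Sum>n\<in>{1..N}. 7 / 16) \<le> (\<Sum>n\<in>{1..N}. (cos (real n * \<theta>))\<^sup>2 + (cos (2 * (real n * \<theta>)))\<^sup>2)"
    by (intro sum_mono)
  then have "7 / 16 * real N \<le> (\<Sum>n\<in>{1..N}. (cos_mode L n y)\<^sup>2) + (\<Sum>n\<in>{1..N}. (cos_mode L (2 * n) y)\<^sup>2)"
    by (simp add: sum.distrib c ac_simps)
  also have "(\<Sum>n\<in>{1..N}. (cos_mode L n y)\<^sup>2) \<le> (\<Sum>n\<in>{1..2 * N}. (cos_mode L n y)\<^sup>2)"
    by (intro sum_mono2) auto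
  also have "(\<Sum>n\<in>{1..N}. (cos_mode L (2 * n) y)\<^sup>2) = (\<Sum>n\<in>(\<lambda>n. 2 * n) ` {1..N}. (cos_mode L n y)\<^sup>2)"
    by (subst sum.reindex) (auto simp: inj_on_def)
  also have "\<dots> \<le> (\<Sum>n\<in>{1..2 * N}. (cos_mode L n y)\<^sup>2)"
    by (intro sum_mono2) auto
  finally show ?thesis by simp
qed

text \<open>Under the condition on N every mode up to 2N still carries an exponential factor of at
  least 1/e. Weight 2/L, factor 1/e and the bound 7/32 N multiply to the constant. Choosing N of
  order t^(-1/2) exhibits the singularity of the squared norm.\<close>

lemma cos_kernel_square_ge:
  assumes t: "0 < t" and N: "4 * (real N)\<^sup>2 * pi\<^sup>2 * t \<le> L\<^sup>2"
  shows "7 / (16 * exp 1 * L) * real N \<le> (LBINT x:{0..L}. (cos_kernel L t x y)\<^sup>2)"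
proof -
  let ?f = "\<lambda>n. mode_weight L n * exp (- 2 * mode_rate L n * t) * (cos_mode L n y)\<^sup>2"
  have "(2 / L * exp (- 1)) * (7 / 32 * real N) \<le> (2 / L * exp (- 1)) * (\<Sum>n\<in>{1..2 * N}. (cos_mode L n y)\<^sup>2)"
    using L by (intro mult_left_mono cos_mode_square_sum_ge) auto
  also have "\<dots> = (\<Sum>n\<in>{1..2 * N}. 2 / L * exp (- 1) * (cos_mode L n y)\<^sup>2)" by (rule sum_distrib_left)
  also have "\<dots> \<le> (\<Sum>n\<in>{1..2 * N}. ?f n)"
  proof (intro sum_mono mult_right_mono mult_mono)
    fix n assume n: "n \<in> {1..2 * N}"
    show "2 / L \<le> mode_weight L n" using n by (simp add: mode_weight_def)
    have "(real n)\<^sup>2 \<le> (2 * real N)\<^sup>2" using n by (intro power_mono) auto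
    then have "(real n)\<^sup>2 * (pi\<^sup>2 * t) \<le> (2 * real N)\<^sup>2 * (pi\<^sup>2 * t)" using t by (intro mult_right_mono) auto
    also have "\<dots> \<le> L\<^sup>2" using N by (simp add: power2_eq_square ac_simps)
    finally have "2 * mode_rate L n * t \<le> 1" using L by (simp add: mode_rate_def field_simps)
    then show "exp (- 1) \<le> exp (- 2 * mode_rate L n * t)" by simp
  qed (use L in auto)
  also have "\<dots> \<le> (\<Sum>n. ?f n)"
  proof (rule sum_le_suminf)
    have s: "summable (\<lambda>n. norm (mode_weight L n * exp (- mode_rate L n * (2 * t)) * cos_mode L n y * cos_mode L n y))"
      using t by (intro summable_cos_kernel) auto
    show "summable ?f" using summable_norm_cancel[OF s] by (simp add: power2_eq_square ac_simps)
  qed (use L in auto)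
  finally show ?thesis
    by (simp add: cos_kernel_square_integral(1)[OF t] exp_minus field_simps)
qed

lemma cos_kernel_square_le:
  assumes t: "0 < t"
  shows "ennreal (LBINT x:{0..L}. (cos_kernel L t x y)\<^sup>2) \<le> mode_decay L t"
proof -
  let ?f = "\<lambda>n. mode_weight L n * exp (- 2 * mode_rate L n * t) * (cos_mode L n y)\<^sup>2"
  have s: "summable (\<lambda>n. norm (mode_weight L n * exp (- mode_rate L n * (2 * t)) * cos_mode L n y * cos_mode L n y))"
    using t by (intro summable_cos_kernel) auto
  have "summable ?f" using summable_norm_cancel[OF s] by (simp add: power2_eq_square ac_simps)
  then have "ennreal (\<Sum>n. ?f n) = (\<Sum>n. ennreal (?f n))" by (intro suminf_ennreal2[symmetric]) auto
  also have "\<dots> \<le> mode_decay L t"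
    unfolding mode_decay_def by (intro suminf_le ennreal_leI mult_left_le) (auto simp: abs_square_le_1)
  finally show ?thesis by (simp add: cos_kernel_square_integral(1)[OF t])
qed

section \<open>Laplace transform of the uniform kernel bound\<close>

lemma nn_integral_exp_decay:
  assumes "0 < a"
  shows "(\<integral>\<^sup>+r. ennreal (exp (- a * r)) * indicator {0<..} r \<partial>lborel) = ennreal (1 / a)"
proof -
  have "(\<integral>\<^sup>+r. ennreal (exp (- a * r)) * indicator {0..} r \<partial>lborel) = 0 - (- exp (- a * 0) / a)"
  proof (rule nn_integral_FTC_atLeast)
    show "((\<lambda>r. - exp (- a * r) / a) \<longlongrightarrow> 0) at_top"
      using assms by real_asymp
  qed (use assms in \<open>auto intro!: derivative_eq_intros\<close>)
  moreover have "(\<integral>\<^sup>+r. ennreal (exp (- a * r)) * indicator {0<..} r \<partial>lborel) = (\<integral>\<^sup>+r. ennreal (exp (- a * r)) * indicator {0..} r \<partial>lborel)"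
    by (intro nn_integral_cong_AE) (use AE_lborel_singleton[of "0::real"] in \<open>eventually_elim, auto split: split_indicator\<close>)
  ultimately show ?thesis by simp
qed

text \<open>The sum of 1/(a^2 + b^2 n^2), with a^2 equal to \<beta>, is of order 1/a. This is shown
  by comparison with a telescoping sum. The term n = 0 is 1/(L a^2), at most 1/(L a) because a >=
  1.\<close>

lemma mode_resolvent_sum_le:
  assumes \<beta>: "1 \<le> \<beta>"
  shows "(\<Sum>n. ennreal (mode_weight L n / (\<beta> + 2 * mode_rate L n))) \<le> ennreal ((1 / L + 4 / pi) / sqrt \<beta>)"
proof -
  define a where "a = sqrt \<beta>"
  define b where "b = pi / L"
  have a: "1 \<le> a" "\<beta> = a\<^sup>2" using \<beta> by (auto simp: a_def)
  have b: "0 < b" using L by (simp add: b_def)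
  have rate: "2 * mode_rate L n = (b * real n)\<^sup>2" for n by (simp add: mode_rate_def b_def ac_simps)
  \<comment> \<open>The telescoped remainder is kept in the claim, since the induction does not go
    through with the final bound alone.\<close>
  have partial: "(\<Sum>n<Suc N. mode_weight L n / (\<beta> + 2 * mode_rate L n)) \<le> 1 / (L * a\<^sup>2) + 4 / (L * b) * (1 / a - 1 / (a + b * real N))" for N
  proof (induction N)
    case 0
    then show ?case by (simp add: rate a mode_weight_def)
  next
    case (Suc N)
    define c where "c = a + b * real N"
    have c: "1 \<le> c" using a b by (simp add: c_def add_increasing2)
    have cb: "a + b * real (Suc N) = c + b" by (simp add: c_def algebra_simps)
    \<comment> \<open>Here c + b = a + b (N + 1), whose square is at most twice the sum of the
      squares. So the new term is at most a multiple of 1/(c (c + b)), which telescopes by partial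
      fractions.\<close>
    have "c * (c + b) \<le> (c + b) * (c + b)" using c b by (intro mult_right_mono) auto
    also have "\<dots> \<le> 2 * (a\<^sup>2 + (b * real (Suc N))\<^sup>2)"
      unfolding cb[symmetric] using sum_squares_bound[of a "b * real (Suc N)"]
      by (simp add: power2_eq_square algebra_simps)
    finally have le: "c * (c + b) \<le> 2 * (a\<^sup>2 + (b * real (Suc N))\<^sup>2)" .
    have p: "0 < a\<^sup>2 + (b * real (Suc N))\<^sup>2" using a by (intro add_pos_nonneg) auto
    have "mode_weight L (Suc N) / (\<beta> + 2 * mode_rate L (Suc N)) = 2 / L * (1 / (a\<^sup>2 + (b * real (Suc N))\<^sup>2))"
      unfolding rate by (simp add: mode_weight_def a)
    also have "\<dots> \<le> 2 / L * (2 / (c * (c + b)))"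
    proof (rule mult_left_mono)
      show "1 / (a\<^sup>2 + (b * real (Suc N))\<^sup>2) \<le> 2 / (c * (c + b))"
      proof -
        have "1 / P \<le> 2 / Q" if "Q \<le> 2 * P" "0 < P" "0 < Q" for P Q :: real
          using that by (simp add: field_simps)
        then show ?thesis using le p c b by simp
      qed
    qed (use L in simp)
    also have "2 / L * (2 / (c * (c + b))) = 4 / (L * b) * (1 / c - 1 / (c + b))"
      using c b L by (simp add: field_simps)
    finally have "mode_weight L (Suc N) / (\<beta> + 2 * mode_rate L (Suc N)) \<le> 4 / (L * b) * (1 / c - 1 / (c + b))" .
    moreover have "k * (1 / a - 1 / c) + k * (1 / c - 1 / (c + b)) = k * (1 / a - 1 / (c + b))" for k :: real
      by (simp add: right_diff_distrib)
    ultimately show ?case using Suc.IH unfolding sum.lessThan_Suc[of _ "Suc N"] cb c_def[symmetric]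
      by (smt (verit, best))
  qed
  have le: "(\<Sum>n<N. mode_weight L n / (\<beta> + 2 * mode_rate L n)) \<le> (1 / L + 4 / pi) / a" for N
  proof -
    have nn: "0 \<le> mode_weight L n / (\<beta> + 2 * mode_rate L n)" for n using \<beta> by auto
    have "(\<Sum>n<N. mode_weight L n / (\<beta> + 2 * mode_rate L n)) \<le> (\<Sum>n<Suc N. mode_weight L n / (\<beta> + 2 * mode_rate L n))"
      using nn by (intro sum_mono2) auto
    also have "\<dots> \<le> 1 / (L * a\<^sup>2) + 4 / (L * b) * (1 / a - 1 / (a + b * real N))" by (rule partial)
    also have "\<dots> \<le> 1 / (L * a) + 4 / pi * (1 / a)"
    proof (rule add_mono)
      have "a \<le> a\<^sup>2" using a by (simp add: power2_eq_square)
      then show "1 / (L * a\<^sup>2) \<le> 1 / (L * a)" using a L by (intro divide_left_mono mult_left_mono mult_pos_pos) auto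
      have "L * b = pi" using L by (simp add: b_def)
      moreover have "0 \<le> 1 / (a + b * real N)" using a b by simp
      ultimately show "4 / (L * b) * (1 / a - 1 / (a + b * real N)) \<le> 4 / pi * (1 / a)"
        by (simp only:) (rule mult_left_mono, auto)
    qed
    also have "\<dots> = (1 / L + 4 / pi) / a" by (simp add: add_divide_distrib)
    finally show ?thesis .
  qed
  show ?thesis
    unfolding suminf_eq_SUP
  proof (rule SUP_least)
    fix N
    have "(\<Sum>n<N. ennreal (mode_weight L n / (\<beta> + 2 * mode_rate L n))) = ennreal (\<Sum>n<N. mode_weight L n / (\<beta> + 2 * mode_rate L n))"
      using \<beta> by (intro sum_ennreal) auto
    then show "(\<Sum>n<N. ennreal (mode_weight L n / (\<beta> + 2 * mode_rate L n))) \<le> ennreal ((1 / L + 4 / pi) / sqrt \<beta>)"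
      using le[of N] by (simp add: a_def ennreal_leI)
  qed
qed

text \<open>Each mode contributes its weight divided by \<beta> plus twice its rate. The decay in
  \<beta> of the resulting sum encodes a singularity of order r^(-1/2), and the convolution
  inequality for the energy uses the kernel in this form.\<close>

lemma mode_laplace_le:
  assumes \<beta>: "1 \<le> \<beta>"
  shows "(\<integral>\<^sup>+r. ennreal (exp (- \<beta> * r)) * mode_decay L r * indicator {0<..} r \<partial>lborel)
    \<le> ennreal ((1 / L + 4 / pi) / sqrt \<beta>)"
proof -
  let ?w = "\<lambda>n. ennreal (mode_weight L n)"
  define d where "d n r = ennreal (exp (- (\<beta> + 2 * mode_rate L n) * r)) * indicator {0<..} r" for n and r :: real
  have [measurable]: "d n \<in> borel_measurable borel" for n unfolding d_def by measurable
  have term_eq: "ennreal (exp (- \<beta> * r)) * ennreal (mode_weight L n * exp (- 2 * mode_rate L n * r)) * indicator {0<..} r = ?w n * d n r" for n r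
  proof -
    have "exp (- \<beta> * r) * (mode_weight L n * exp (- 2 * mode_rate L n * r)) =
        mode_weight L n * (exp (- \<beta> * r) * exp (- 2 * mode_rate L n * r))" by (rule mult.left_commute)
    also have "exp (- \<beta> * r) * exp (- 2 * mode_rate L n * r) = exp (- (\<beta> + 2 * mode_rate L n) * r)"
      unfolding mult_exp_exp by (simp add: algebra_simps)
    finally show ?thesis
      by (simp only: d_def mult.assoc ennreal_mult'[OF exp_ge_zero, symmetric] ennreal_mult'[OF mode_weight_nonneg, symmetric] flip: mult.assoc)
  qed
  have d: "(\<integral>\<^sup>+r. d n r \<partial>lborel) = ennreal (1 / (\<beta> + 2 * mode_rate L n))" for n
    unfolding d_def by (rule nn_integral_exp_decay) (use \<beta> mode_rate_nonneg[of L n] in linarith)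
  have "(\<integral>\<^sup>+r. ennreal (exp (- \<beta> * r)) * mode_decay L r * indicator {0<..} r \<partial>lborel) = (\<integral>\<^sup>+r. (\<Sum>n. ?w n * d n r) \<partial>lborel)"
    unfolding mode_decay_def by (simp flip: term_eq)
  also have "\<dots> = (\<Sum>n. \<integral>\<^sup>+r. ?w n * d n r \<partial>lborel)"
    by (intro nn_integral_suminf) simp
  also have "\<dots> = (\<Sum>n. ennreal (mode_weight L n / (\<beta> + 2 * mode_rate L n)))"
    by (simp add: nn_integral_cmult d ennreal_mult'[symmetric])
  also have "\<dots> \<le> ennreal ((1 / L + 4 / pi) / sqrt \<beta>)" by (rule mode_resolvent_sum_le[OF \<beta>])
  finally show ?thesis .
qed

section \<open>Completeness of the cosines and identification of the kernel\<close>

text \<open>Multiplying mode n >= 1 by the first cosine gives the average of modes n - 1 and n + 1,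
  and for n = 0 it gives mode 1. So the span of the modes is closed under this multiplication, and a
  function orthogonal to all modes stays orthogonal after it.\<close>

lemma cos_power_orthogonal:
  assumes h: "continuous_on {0..L} h"
    and z: "\<And>n. (LBINT y:{0..L}. h y * cos_mode L n y) = 0"
  shows "(LBINT y:{0..L}. h y * cos (pi * y / L) ^ i * cos_mode L n y) = 0"
proof (induction i arbitrary: n)
  case 0
  then show ?case using z by simp
next
  case (Suc i)
  have int: "set_integrable lborel {0..L} (\<lambda>y. h y * cos (pi * y / L) ^ i * cos_mode L n y)" for n
    using L by (intro set_integrable_continuous continuous_intros h) auto
  show ?case
  proof (cases n)
    case 0
    then have "h y * cos (pi * y / L) ^ Suc i * cos_mode L n y = h y * cos (pi * y / L) ^ i * cos_mode L 1 y" for y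
      by (simp add: cos_mode_def)
    then show ?thesis by (simp only: Suc.IH)
  next
    case (Suc m)
    have e: "h y * cos (pi * y / L) ^ Suc i * cos_mode L n y =
      (h y * cos (pi * y / L) ^ i * cos_mode L m y + h y * cos (pi * y / L) ^ i * cos_mode L (Suc n) y) / 2" for y
    proof -
      have "cos (pi * y / L) * cos_mode L n y = (cos_mode L m y + cos_mode L (Suc n) y) / 2"
        using cos_times_cos[of "pi * y / L" "real n * pi * y / L"]
          cos_minus[of "real m * pi * y / L"] Suc
        by (simp add: cos_mode_def algebra_simps add_divide_distrib)
      moreover have "h y * cos (pi * y / L) ^ Suc i * cos_mode L n y = (h y * cos (pi * y / L) ^ i) * (cos (pi * y / L) * cos_mode L n y)"
        by simp
      ultimately show ?thesis by (simp only: distrib_left times_divide_eq_right)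
    qed
    show ?thesis unfolding e
      using Suc.IH[of m] Suc.IH[of "Suc n"] set_integral_add(2)[OF int int] by simp
  qed
qed

text \<open>The substitution x = cos(pi y / L) maps [0,L] onto [-1,1] and turns h into a continuous
  g. For a polynomial p within e of g, orthogonality to powers of the cosine lets p be subtracted,
  so the integral of h^2 equals that of h (h - p), which is at most e times the integral of
  |h|.\<close>

lemma cos_mode_complete:
  assumes h: "continuous_on {0..L} h"
    and z: "\<And>n. (LBINT y:{0..L}. h y * cos_mode L n y) = 0"
    and y: "y \<in> {0..L}"
  shows "h y = 0"
proof -
  define g where "g x = h (L / pi * arccos x)" for x
  have range: "L / pi * arccos x \<in> {0..L}" if "x \<in> {-1..1}" for x
    using that L arccos_lbound[of x] arccos_ubound[of x] by (auto simp: field_simps)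
  have g: "continuous_on {-1..1} g"
    unfolding g_def
    by (rule continuous_on_compose2[OF h]) (use range in \<open>auto intro!: continuous_intros continuous_on_arccos'\<close>)
  have hg: "h y = g (cos (pi * y / L))" if "y \<in> {0..L}" for y
    using that L by (simp add: g_def arccos_cos field_simps)
  define B where "B = (LBINT y:{0..L}. \<bar>h y\<bar>)"
  have ih: "set_integrable lborel {0..L} (\<lambda>y. \<bar>h y\<bar>)"
    by (intro set_integrable_continuous continuous_intros h)
  have i2: "set_integrable lborel {0..L} (\<lambda>y. (h y)\<^sup>2)"
    by (intro set_integrable_continuous continuous_intros h)
  have "(LBINT y:{0..L}. (h y)\<^sup>2) \<le> e * B" if e: "0 < e" for e
  proof -
    obtain p where p: "real_polynomial_function p" "\<And>x. x \<in> {-1..1} \<Longrightarrow> \<bar>g x - p x\<bar> < e"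
      using Stone_Weierstrass_real_polynomial_function[OF compact_Icc g e] by blast
    obtain a d where pa: "p = (\<lambda>x. \<Sum>i\<le>d. a i * x ^ i)"
      using p(1) unfolding real_polynomial_function_iff_sum by blast
    let ?p = "\<lambda>y. p (cos (pi * y / L))"
    have int: "set_integrable lborel {0..L} (\<lambda>y. h y * cos (pi * y / L) ^ i)" for i
      using L by (intro set_integrable_continuous continuous_intros h) auto
    have ip: "set_integrable lborel {0..L} (\<lambda>y. h y * ?p y)"
      unfolding pa using L by (intro set_integrable_continuous continuous_intros h) auto
    have "(LBINT y:{0..L}. h y * ?p y) = (LBINT y:{0..L}. (\<Sum>i\<le>d. a i * (h y * cos (pi * y / L) ^ i)))"
      unfolding pa by (simp add: sum_distrib_left ac_simps)
    also have "\<dots> = (\<Sum>i\<le>d. a i * (LBINT y:{0..L}. h y * cos (pi * y / L) ^ i))"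
      unfolding set_lebesgue_integral_def scaleR_sum_right
      using int[unfolded set_integrable_def]
      by (subst Bochner_Integration.integral_sum) (simp_all add: scaleR_conv_of_real mult.left_commute[of "indicator _ _"])
    also have "\<dots> = 0" using cos_power_orthogonal[OF h z, of _ 0] by simp
    finally have "(LBINT y:{0..L}. (h y)\<^sup>2) = (LBINT y:{0..L}. (h y)\<^sup>2) - (LBINT y:{0..L}. h y * ?p y)" by simp
    also have "\<dots> = (LBINT y:{0..L}. (h y)\<^sup>2 - h y * ?p y)"
      using set_integral_diff(2)[OF i2 ip] by simp
    also have "\<dots> \<le> (LBINT y:{0..L}. e * \<bar>h y\<bar>)"
    proof (rule set_integral_mono)
      show "set_integrable lborel {0..L} (\<lambda>y. (h y)\<^sup>2 - h y * ?p y)" by (rule set_integral_diff(1)[OF i2 ip])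
      show "set_integrable lborel {0..L} (\<lambda>y. e * \<bar>h y\<bar>)" using ih by simp
      fix y assume y: "y \<in> {0..L}"
      have "(h y)\<^sup>2 - h y * ?p y = h y * (h y - ?p y)" by (simp add: power2_eq_square algebra_simps)
      also have "\<dots> \<le> \<bar>h y\<bar> * \<bar>h y - ?p y\<bar>" by (metis abs_ge_self abs_mult)
      also have "\<dots> \<le> \<bar>h y\<bar> * e"
        using p(2)[of "cos (pi * y / L)"] hg[OF y] by (intro mult_left_mono) auto
      finally show "(h y)\<^sup>2 - h y * ?p y \<le> e * \<bar>h y\<bar>" by (simp add: mult.commute)
    qed
    finally show ?thesis by (simp add: B_def)
  qed
  then have ev: "eventually (\<lambda>e. (LBINT y:{0..L}. (h y)\<^sup>2) \<le> e * B) (at_right 0)"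
    by (auto simp: eventually_at_right_field intro: exI[of _ 1])
  have lim: "((\<lambda>e. e * B) \<longlongrightarrow> 0 * B) (at_right 0)" by (intro tendsto_intros)
  have "(LBINT y:{0..L}. (h y)\<^sup>2) \<le> 0"
    using tendsto_lowerbound[OF lim ev] by simp
  moreover have "(LBINT y:{0..L}. (h y)\<^sup>2) = integral {0..L} (\<lambda>y. (h y)\<^sup>2)"
    by (rule set_borel_integral_eq_integral(2)[OF i2])
  moreover have "0 \<le> integral {0..L} (\<lambda>y. (h y)\<^sup>2)"
    by (rule integral_nonneg[OF set_borel_integral_eq_integral(1)[OF i2]]) auto
  ultimately have "integral (cbox 0 L) (\<lambda>y. (h y)\<^sup>2) = 0" by simp
  \<comment> \<open>By continuity a vanishing integral of a square forces the value to vanish at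
    each point, endpoints included.\<close>
  then have "(h y)\<^sup>2 = 0"
    using y h L set_borel_integral_eq_integral(1)[OF i2]
    by (intro has_integral_0_cbox_imp_0[of 0 L "\<lambda>y. (h y)\<^sup>2"])
       (auto intro!: continuous_intros simp: has_integral_integral[symmetric] has_integral_iff)
  then show ?thesis by simp
qed

text \<open>Each cosine coefficient solves the linear equation a' = - \<open>mode_rate L n\<close>
  a: differentiate under the integral, use the heat equation and integrate by parts twice. The weak
  initial condition, tested against the same cosine, fixes the remaining constant.\<close>

lemma neumann_kernel_coefficient:
  assumes p: "neumann_heat_kernel L p" and x: "x \<in> {0..L}" and t: "0 < t"
  shows "(LBINT y:{0..L}. p t x y * cos_mode L n y) = exp (- mode_rate L n * t) * cos_mode L n x"
    and "continuous_on {0..L} (p t x)"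
proof -
  obtain p\<^sub>t p\<^sub>y p\<^sub>y\<^sub>y where raw: "
        (\<forall>t>0. \<forall>y\<in>{0..L}.
           ((\<lambda>s. p s x y) has_real_derivative p\<^sub>t t y) (at t) \<and>
           ((\<lambda>z. p t x z) has_real_derivative p\<^sub>y t y) (at y within {0..L}) \<and>
           ((\<lambda>z. p\<^sub>y t z) has_real_derivative p\<^sub>y\<^sub>y t y) (at y within {0..L})) \<and>
        continuous_on ({0<..} \<times> {0..L}) (\<lambda>(t, y). p t x y) \<and>
        continuous_on ({0<..} \<times> {0..L}) (\<lambda>(t, y). p\<^sub>t t y) \<and>
        continuous_on ({0<..} \<times> {0..L}) (\<lambda>(t, y). p\<^sub>y\<^sub>y t y) \<and>
        (\<forall>t>0. \<forall>y\<in>{0<..<L}. p\<^sub>t t y = 1 / 2 * p\<^sub>y\<^sub>y t y) \<and>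
        (\<forall>t>0. p\<^sub>y t 0 = 0 \<and> p\<^sub>y t L = 0) \<and>
        (\<forall>\<phi>. continuous_on {0..L} \<phi> \<longrightarrow>
           ((\<lambda>t. LBINT y:{0..L}. p t x y * \<phi> y) \<longlongrightarrow> \<phi> x) (at_right 0))"
    using bspec[OF p[unfolded neumann_heat_kernel_def] x] by (elim exE) (rule that)
  note raws = raw[THEN conjunct1] raw[THEN conjunct2]
  have d: "((\<lambda>s. p s x y) has_real_derivative p\<^sub>t t y) (at t)"
       "((\<lambda>z. p\<^sub>y t z) has_real_derivative p\<^sub>y\<^sub>y t y) (at y within {0..L})"
       "((\<lambda>z. p t x z) has_real_derivative p\<^sub>y t y) (at y within {0..L})"
    if "0 < t" "y \<in> {0..L}" for t y
    using raws(1)[rule_format, OF that] by simp_all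
  have c: "continuous_on ({0<..} \<times> {0..L}) (\<lambda>(t, y). p t x y)"
       "continuous_on ({0<..} \<times> {0..L}) (\<lambda>(t, y). p\<^sub>t t y)"
       "continuous_on ({0<..} \<times> {0..L}) (\<lambda>(t, y). p\<^sub>y\<^sub>y t y)"
    using raws(2)[THEN conjunct1] raws(2)[THEN conjunct2, THEN conjunct1]
      raws(2)[THEN conjunct2, THEN conjunct2, THEN conjunct1] .
  have heat: "p\<^sub>t t y = 1 / 2 * p\<^sub>y\<^sub>y t y" if "0 < t" "y \<in> {0<..<L}" for t y
    using raws(2)[THEN conjunct2, THEN conjunct2, THEN conjunct2, THEN conjunct1, rule_format, OF that] .
  have bc: "p\<^sub>y t 0 = 0 \<and> p\<^sub>y t L = 0" if "0 < t" for t
    using raws(2)[THEN conjunct2, THEN conjunct2, THEN conjunct2, THEN conjunct2, THEN conjunct1, rule_format, OF that] by simp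
  have init: "((\<lambda>t. LBINT y:{0..L}. p t x y * \<phi> y) \<longlongrightarrow> \<phi> x) (at_right 0)"
    if "continuous_on {0..L} \<phi>" for \<phi>
    using raws(2)[THEN conjunct2, THEN conjunct2, THEN conjunct2, THEN conjunct2, THEN conjunct2, rule_format, OF that] .
  have sec: "continuous_on {0..L} (f t)" if "0 < t" "continuous_on ({0<..} \<times> {0..L}) (\<lambda>(t, y). f t y)" for t and f :: "real \<Rightarrow> real \<Rightarrow> real"
  proof -
    have "continuous_on {0..L} (\<lambda>y. (\<lambda>(t, y). f t y) (t, y))"
      by (rule continuous_on_compose2[OF that(2)]) (use that(1) in \<open>auto intro!: continuous_intros\<close>)
    then show ?thesis by simp
  qed
  show cp: "continuous_on {0..L} (p t x)" by (rule sec[OF t c(1)])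
  define k where "k = real n * pi / L"
  have cm: "cos_mode L n y = cos (k * y)" for y by (simp add: cos_mode_def k_def)
  have rate: "mode_rate L n = k\<^sup>2 / 2" by (simp add: mode_rate_def k_def)
  \<comment> \<open>The gauge integral is used here because the Leibniz rule is stated for it;
    \<open>a_eq\<close> transfers the result to the Lebesgue integral.\<close>
  define a where "a s = integral (cbox 0 L) (\<lambda>y. p s x y * cos (k * y))" for s
  have a_eq: "(LBINT y:{0..L}. p s x y * cos (k * y)) = a s" if "0 < s" for s
    unfolding a_def cbox_interval
    by (intro set_borel_integral_eq_integral(2) set_integrable_continuous continuous_intros sec[OF that c(1)])
  have aux: "continuous_on ({0<..} \<times> cbox (0 :: real) L) (\<lambda>(s :: real, y :: real). p\<^sub>t s y * cos (k * y))"
    using c(2) unfolding cbox_interval split_beta by (intro continuous_intros)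
  have da: "(a has_real_derivative - mode_rate L n * a s) (at s within {0<..})" if s: "0 < s" for s
  proof -
    have "(a has_real_derivative integral (cbox 0 L) (\<lambda>y. p\<^sub>t s y * cos (k * y))) (at s within {0<..})"
      unfolding a_def
    proof (rule leibniz_rule_field_derivative[OF _ _ aux])
      fix s y :: real assume "s \<in> {0<..}" "y \<in> cbox 0 L"
      then have "((\<lambda>s. p s x y) has_real_derivative p\<^sub>t s y) (at s)" by (intro d(1)) auto
      then show "((\<lambda>s. p s x y * cos (k * y)) has_real_derivative p\<^sub>t s y * cos (k * y)) (at s within {0<..})"
        by (intro DERIV_cmult_right) (rule has_field_derivative_at_within)
    next
      fix s :: real assume "s \<in> {0<..}"
      then show "(\<lambda>y. p s x y * cos (k * y)) integrable_on cbox 0 L"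
        unfolding cbox_interval
        by (intro integrable_continuous_interval continuous_intros sec[OF _ c(1)]) auto
    qed (use s in auto)
    moreover have "integral (cbox 0 L) (\<lambda>y. p\<^sub>t s y * cos (k * y)) = - mode_rate L n * a s"
    proof -
      \<comment> \<open>The heat equation is given in the open interval, so the two endpoints are
        removed as a negligible set.\<close>
      have sp: "integral {0..L} (\<lambda>y. p\<^sub>t s y * cos (k * y)) = integral {0..L} (\<lambda>y. 1 / 2 * (p\<^sub>y\<^sub>y s y * cos (k * y)))"
        by (rule integral_spike[of "{0, L}"]) (use heat[OF s] in auto)
      have kL: "sin (k * L) = 0" using L by (simp add: k_def)
      have i1: "set_integrable lborel {0..L} (\<lambda>y. p\<^sub>y\<^sub>y s y * cos (k * y))"
        by (intro set_integrable_continuous continuous_intros sec[OF s c(3)])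
      have i2: "set_integrable lborel {0..L} (\<lambda>y. k\<^sup>2 * (p s x y * cos (k * y)))"
        by (intro set_integrable_continuous continuous_intros sec[OF s c(1)])
      \<comment> \<open>Both integrations by parts at once: p_y cos(ky) + k p sin(ky) is a primitive
        of the integrand, and it vanishes at 0 and L by the Neumann condition together with sin(kL)
        = 0.\<close>
      have "(LBINT y:{0..L}. p\<^sub>y\<^sub>y s y * cos (k * y) + k\<^sup>2 * (p s x y * cos (k * y))) =
        (p\<^sub>y s L * cos (k * L) + k * (p s x L * sin (k * L))) - (p\<^sub>y s 0 * cos (k * 0) + k * (p s x 0 * sin (k * 0)))"
      proof (rule integral_FTC)
        show "continuous_on {0..L} (\<lambda>y. p\<^sub>y\<^sub>y s y * cos (k * y) + k\<^sup>2 * (p s x y * cos (k * y)))"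
          by (intro continuous_intros sec[OF s c(1)] sec[OF s c(3)])
        fix y assume y: "y \<in> {0..L}"
        show "((\<lambda>y. p\<^sub>y s y * cos (k * y) + k * (p s x y * sin (k * y))) has_real_derivative
           p\<^sub>y\<^sub>y s y * cos (k * y) + k\<^sup>2 * (p s x y * cos (k * y))) (at y within {0..L})"
          by (rule derivative_eq_intros d(2)[OF s y] d(3)[OF s y] refl)+
             (simp add: power2_eq_square algebra_simps)
      qed
      also have "\<dots> = 0" using bc[OF s] kL by simp
      finally have "(LBINT y:{0..L}. p\<^sub>y\<^sub>y s y * cos (k * y)) + k\<^sup>2 * (LBINT y:{0..L}. p s x y * cos (k * y)) = 0"
        using set_integral_add(2)[OF i1 i2] by simp
      then have "integral {0..L} (\<lambda>y. p\<^sub>y\<^sub>y s y * cos (k * y)) = - k\<^sup>2 * a s"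
        unfolding a_eq[OF s] set_borel_integral_eq_integral(2)[OF i1] by simp
      then show ?thesis unfolding cbox_interval sp by (simp add: rate)
    qed
    ultimately show ?thesis by simp
  qed
  \<comment> \<open>The integrating factor makes the derivative zero on the open half-line; the
    value of the constant is read off from the limit at time 0.\<close>
  have "\<exists>C. \<forall>s\<in>{0<..}. a s * exp (mode_rate L n * s) = C"
  proof (rule has_field_derivative_zero_constant)
    fix s :: real assume s: "s \<in> {0<..}"
    show "((\<lambda>s. a s * exp (mode_rate L n * s)) has_real_derivative 0) (at s within {0<..})"
      using s by (auto intro!: derivative_eq_intros da)
  qed simp
  then obtain C where C: "\<And>s. 0 < s \<Longrightarrow> a s * exp (mode_rate L n * s) = C" by auto
  have "((\<lambda>s. LBINT y:{0..L}. p s x y * cos (k * y)) \<longlongrightarrow> cos (k * x)) (at_right 0)"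
    by (rule init) (intro continuous_intros)
  moreover have "eventually (\<lambda>s. (LBINT y:{0..L}. p s x y * cos (k * y)) = a s) (at_right 0)"
    using a_eq by (auto simp: eventually_at_right_field intro: exI[of _ 1])
  ultimately have "(a \<longlongrightarrow> cos (k * x)) (at_right 0)" by (rule Lim_transform_eventually)
  then have "((\<lambda>s. a s * exp (mode_rate L n * s)) \<longlongrightarrow> cos (k * x) * exp (mode_rate L n * 0)) (at_right 0)"
    by (intro tendsto_intros)
  moreover have "eventually (\<lambda>s. a s * exp (mode_rate L n * s) = C) (at_right 0)"
    using C by (auto simp: eventually_at_right_field intro: exI[of _ 1])
  ultimately have "((\<lambda>s. C) \<longlongrightarrow> cos (k * x) * exp (mode_rate L n * 0)) (at_right (0::real))"
    by (rule Lim_transform_eventually)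
  then have "C = cos (k * x)" by (subst (asm) tendsto_const_iff) auto
  then have "a t = exp (- mode_rate L n * t) * cos (k * x)"
    using C[OF t] by (simp add: exp_minus field_simps)
  then show "(LBINT y:{0..L}. p t x y * cos_mode L n y) = exp (- mode_rate L n * t) * cos_mode L n x"
    unfolding cm a_eq[OF t] .
qed

theorem neumann_kernel_eq_cos_kernel:
  assumes p: "neumann_heat_kernel L p" and x: "x \<in> {0..L}" and y: "y \<in> {0..L}" and t: "0 < t"
  shows "p t x y = cos_kernel L t x y"
proof -
  have c: "continuous_on {0..L} (p t x)" by (rule neumann_kernel_coefficient(2)[OF p x t])
  have "p t x y - cos_kernel L t x y = 0"
  proof (rule cos_mode_complete[OF _ _ y])
    show "continuous_on {0..L} (\<lambda>y. p t x y - cos_kernel L t x y)"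
      by (intro continuous_intros c continuous_on_cos_kernel t)
    fix n
    have i1: "set_integrable lborel {0..L} (\<lambda>y. p t x y * cos_mode L n y)"
      by (intro set_integrable_continuous continuous_intros c)
    have i2: "set_integrable lborel {0..L} (\<lambda>y. cos_kernel L t x y * cos_mode L n y)"
      by (intro set_integrable_continuous continuous_intros continuous_on_cos_kernel t)
    show "(LBINT y:{0..L}. (p t x y - cos_kernel L t x y) * cos_mode L n y) = 0"
      unfolding left_diff_distrib set_integral_diff(2)[OF i1 i2]
      using neumann_kernel_coefficient(1)[OF p x t] cos_kernel_coefficient[OF t] by simp
  qed
  then show ?thesis by simp
qed

end

section \<open>The energy identity\<close>

text \<open>The heat semigroup applied to the initial function. It is written with
  \<open>cos_kernel\<close>, since \<open>p\<close> is only specified for poles in [0,L] and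
  separately for each of them, which gives no measurability in x.\<close>

definition initial_mass :: "real \<Rightarrow> (real \<Rightarrow> real) \<Rightarrow> real \<Rightarrow> real \<Rightarrow> real" where
  "initial_mass L u0 t x = (LBINT y:{0..L}. u0 y * cos_kernel L t x y)"

definition initial_energy :: "real \<Rightarrow> (real \<Rightarrow> real) \<Rightarrow> real \<Rightarrow> ennreal" where
  "initial_energy L u0 t = (\<integral>\<^sup>+x\<in>{0..L}. ennreal ((initial_mass L u0 t x)\<^sup>2) \<partial>lborel)"

definition kernel_energy :: "real \<Rightarrow> real \<Rightarrow> real \<Rightarrow> real" where
  "kernel_energy L r y = (LBINT x:{0..L}. (cos_kernel L r x y)\<^sup>2)"

text \<open>Off the positive times and the interval the field is arbitrary. Setting it to zero there
  makes it measurable on the full product, so Tonelli can be used with integrals over the whole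
  line.\<close>

definition restricted_field :: "real \<Rightarrow> (real \<Rightarrow> real \<Rightarrow> 'w \<Rightarrow> real) \<Rightarrow> real \<Rightarrow> real \<Rightarrow> 'w \<Rightarrow> real" where
  "restricted_field L u s y \<omega> = indicator {0<..} s * indicator {0..L} y * u s y \<omega>"

text \<open>The parameter f is either the identity, for the energy, or \<sigma>, for the integrand
  of the noise term.\<close>

definition second_moment :: "'w measure \<Rightarrow> real \<Rightarrow> (real \<Rightarrow> real \<Rightarrow> 'w \<Rightarrow> real) \<Rightarrow> (real \<Rightarrow> real) \<Rightarrow> real \<Rightarrow> real \<Rightarrow> ennreal" where
  "second_moment M L u f s y = (\<integral>\<^sup>+\<omega>. ennreal ((f (restricted_field L u s y \<omega>))\<^sup>2) \<partial>M)"

definition total_energy :: "'w measure \<Rightarrow> real \<Rightarrow> (real \<Rightarrow> real \<Rightarrow> 'w \<Rightarrow> real) \<Rightarrow> real \<Rightarrow> ennreal" where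
  "total_energy M L u s = (\<integral>\<^sup>+y. second_moment M L u (\<lambda>z. z) s y \<partial>lborel)"

text \<open>Real constants are taken strictly below the infimum and strictly above the supremum,
  which avoids extended reals from here on.\<close>

lemma admissible_sigma_bounds:
  assumes "admissible_sigma \<sigma>"
  shows "\<exists>l>0. \<forall>x. l * \<bar>x\<bar> \<le> \<bar>\<sigma> x\<bar>" and "\<exists>\<Lambda>>0. \<forall>x. \<bar>\<sigma> x\<bar> \<le> \<Lambda> * \<bar>x\<bar>"
proof -
  have s: "\<sigma> 0 = 0" "0 < l_sigma \<sigma>" "l_sigma \<sigma> \<le> L_sigma \<sigma>" "L_sigma \<sigma> < \<infinity>"
    using assms by (auto simp: admissible_sigma_def)
  obtain l where l: "0 < ereal l" "ereal l < l_sigma \<sigma>" using ereal_dense2[OF s(2)] by auto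
  obtain \<Lambda> where \<Lambda>: "L_sigma \<sigma> < ereal \<Lambda>" using ereal_dense2[OF s(4)] by auto
  have "ereal l < ereal \<Lambda>" using l(2) s(3) \<Lambda> by (meson less_le_trans less_trans)
  have "l * \<bar>x\<bar> \<le> \<bar>\<sigma> x\<bar> \<and> \<bar>\<sigma> x\<bar> \<le> \<Lambda> * \<bar>x\<bar>" for x
  proof (cases "x = 0")
    case False
    have "ereal l \<le> ereal \<bar>\<sigma> x / x\<bar>"
      using l(2) False unfolding l_sigma_def by (intro order_trans[OF less_imp_le INF_lower]) auto
    moreover have "ereal \<bar>\<sigma> x / x\<bar> \<le> ereal \<Lambda>"
      using \<Lambda> False unfolding L_sigma_def by (intro order_trans[OF SUP_upper less_imp_le]) auto
    ultimately show ?thesis using False by (simp add: field_simps)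
  qed (simp add: s(1))
  moreover have "0 < l" "0 < \<Lambda>" using l(1) \<open>ereal l < ereal \<Lambda>\<close> by auto
  ultimately show "\<exists>l>0. \<forall>x. l * \<bar>x\<bar> \<le> \<bar>\<sigma> x\<bar>" "\<exists>\<Lambda>>0. \<forall>x. \<bar>\<sigma> x\<bar> \<le> \<Lambda> * \<bar>x\<bar>" by blast+
qed

section \<open>Second moments of the mild solution\<close>

locale heat_equation = white_noise_space M L W + interval L
  for M :: "'w measure" and L :: real and W :: "(real \<times> real) set \<Rightarrow> 'w \<Rightarrow> real" +
  fixes p :: "real \<Rightarrow> real \<Rightarrow> real \<Rightarrow> real" and \<sigma> u0 :: "real \<Rightarrow> real"
  assumes p: "neumann_heat_kernel L p" and \<sigma>: "admissible_sigma \<sigma>" and u0: "admissible_initial L u0"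
begin

lemma sigma_measurable [measurable]: "\<sigma> \<in> borel_measurable borel"
proof -
  obtain C where "C-lipschitz_on UNIV \<sigma>" using \<sigma> by (auto simp: admissible_sigma_def)
  then have "continuous_on UNIV \<sigma>" by (rule lipschitz_on_continuous_on)
  then show ?thesis by (rule borel_measurable_continuous_onI)
qed

lemma restricted_field_eq: "0 < s \<Longrightarrow> y \<in> {0..L} \<Longrightarrow> restricted_field L u s y \<omega> = u s y \<omega>"
  by (simp add: restricted_field_def)

lemma restricted_field_measurable:
  assumes "mild_solution M L W p \<sigma> u0 lam u"
  shows "(\<lambda>(s, y, \<omega>). restricted_field L u s y \<omega>) \<in> borel_measurable (strip_measure M)"
proof -
  have "predictable M \<F> {0..L} u" using assms by (simp add: mild_solution_def)
  from predictable_measurable[OF this] show ?thesis by (simp add: restricted_field_def)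
qed

lemma restricted_field_measurable' [measurable (raw)]:
  assumes "mild_solution M L W p \<sigma> u0 lam u"
    and [measurable]: "f \<in> borel_measurable N" "g \<in> borel_measurable N" "h \<in> measurable N M"
  shows "(\<lambda>z. restricted_field L u (f z) (g z) (h z)) \<in> borel_measurable N"
proof -
  have "(\<lambda>z. (f z, g z, h z)) \<in> measurable N (strip_measure M)"
    by measurable
  from measurable_compose[OF this restricted_field_measurable[OF assms(1)]] show ?thesis by simp
qed

lemma second_moment_measurable:
  assumes u: "mild_solution M L W p \<sigma> u0 lam u" and [measurable]: "k \<in> borel_measurable borel"
    and [measurable]: "f \<in> borel_measurable N" "g \<in> borel_measurable N"
  shows "(\<lambda>z. second_moment M L u k (f z) (g z)) \<in> borel_measurable N"
proof -
  have [measurable]: "(\<lambda>(z, \<omega>). restricted_field L u (f z) (g z) \<omega>) \<in> borel_measurable (N \<Otimes>\<^sub>M M)"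
    unfolding split_beta' by (rule restricted_field_measurable'[OF u]) measurable
  show ?thesis unfolding second_moment_def by measurable
qed

lemma second_moment_bounds:
  assumes u: "mild_solution M L W p \<sigma> u0 lam u"
    and l: "0 \<le> l" "\<And>x. l * \<bar>x\<bar> \<le> \<bar>\<sigma> x\<bar>" and \<Lambda>: "0 \<le> \<Lambda>" "\<And>x. \<bar>\<sigma> x\<bar> \<le> \<Lambda> * \<bar>x\<bar>"
  shows "ennreal (l\<^sup>2) * second_moment M L u (\<lambda>z. z) s y \<le> second_moment M L u \<sigma> s y"
    and "second_moment M L u \<sigma> s y \<le> ennreal (\<Lambda>\<^sup>2) * second_moment M L u (\<lambda>z. z) s y"
proof -
  let ?v = "restricted_field L u s y"
  have [measurable]: "?v \<in> borel_measurable M"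
    by (rule restricted_field_measurable'[OF u]) measurable
  have a: "l\<^sup>2 * z\<^sup>2 \<le> (\<sigma> z)\<^sup>2" for z
    using power_mono[OF l(2)[of z], of 2] l(1) by (simp add: power_mult_distrib)
  have b: "(\<sigma> z)\<^sup>2 \<le> \<Lambda>\<^sup>2 * z\<^sup>2" for z
    using power_mono[OF \<Lambda>(2)[of z], of 2] by (simp add: power_mult_distrib)
  show "ennreal (l\<^sup>2) * second_moment M L u (\<lambda>z. z) s y \<le> second_moment M L u \<sigma> s y"
    unfolding second_moment_def using a
    by (subst nn_integral_cmult[symmetric]) (auto intro!: nn_integral_mono ennreal_leI simp: ennreal_mult'[symmetric])
  show "second_moment M L u \<sigma> s y \<le> ennreal (\<Lambda>\<^sup>2) * second_moment M L u (\<lambda>z. z) s y"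
    unfolding second_moment_def using b
    by (subst nn_integral_cmult[symmetric]) (auto intro!: nn_integral_mono ennreal_leI simp: ennreal_mult'[symmetric])
qed

text \<open>The cross term between the deterministic part and the stochastic integral drops out
  because the latter is centred; the isometry evaluates its square. Inside the double integral s <
  t, so the lag is positive and \<open>p\<close> can be replaced by the cosine kernel.\<close>

lemma second_moment_identity:
  assumes u: "mild_solution M L W p \<sigma> u0 lam u" and t: "0 < t" and x: "x \<in> {0..L}"
  shows "second_moment M L u (\<lambda>z. z) t x = ennreal ((initial_mass L u0 t x)\<^sup>2) + ennreal (lam\<^sup>2) *
    (\<integral>\<^sup>+s. \<integral>\<^sup>+y. ennreal ((cos_kernel L (t - s) x y)\<^sup>2) * second_moment M L u \<sigma> s y *
        indicator {0<..<L} y * indicator {0<..<t} s \<partial>lborel \<partial>lborel)"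
proof -
  define F where "F = (\<lambda>s y \<omega>. indicator {0<..<t} s * p (t - s) x y * \<sigma> (u s y \<omega>))"
  obtain J where J: "has_walsh_integral M L W F J"
    and uJ: "AE \<omega> in M. u t x \<omega> = (LBINT y:{0..L}. u0 y * p t x y) + lam * J \<omega>"
    using u t x unfolding mild_solution_def F_def by blast
  define c where "c = initial_mass L u0 t x"
  have c: "(LBINT y:{0..L}. u0 y * p t x y) = c"
    unfolding c_def initial_mass_def
    by (rule set_lebesgue_integral_cong) (use neumann_kernel_eq_cos_kernel[OF p x _ t] in auto)
  note iso = walsh_isometry[OF J]
  have i: "integrable M (\<lambda>\<omega>. (c + lam * J \<omega>)\<^sup>2)"
    "expectation (\<lambda>\<omega>. (c + lam * J \<omega>)\<^sup>2) = c\<^sup>2 + lam\<^sup>2 * expectation (\<lambda>\<omega>. (J \<omega>)\<^sup>2)"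
  proof -
    have e: "(c + lam * J \<omega>)\<^sup>2 = c\<^sup>2 + (2 * c * lam) * J \<omega> + lam\<^sup>2 * (J \<omega>)\<^sup>2" for \<omega>
      by (simp add: power2_eq_square algebra_simps)
    show "integrable M (\<lambda>\<omega>. (c + lam * J \<omega>)\<^sup>2)" unfolding e using iso(2,3) by simp
    show "expectation (\<lambda>\<omega>. (c + lam * J \<omega>)\<^sup>2) = c\<^sup>2 + lam\<^sup>2 * expectation (\<lambda>\<omega>. (J \<omega>)\<^sup>2)"
      unfolding e using iso(2,3,4) by (simp add: prob_space)
  qed
  have "second_moment M L u (\<lambda>z. z) t x = (\<integral>\<^sup>+\<omega>. ennreal ((u t x \<omega>)\<^sup>2) \<partial>M)"
    unfolding second_moment_def by (simp add: restricted_field_eq[OF t x])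
  also have "\<dots> = (\<integral>\<^sup>+\<omega>. ennreal ((c + lam * J \<omega>)\<^sup>2) \<partial>M)"
    by (rule nn_integral_cong_AE) (use uJ c in \<open>auto elim!: eventually_mono\<close>)
  also have "\<dots> = ennreal (c\<^sup>2 + lam\<^sup>2 * expectation (\<lambda>\<omega>. (J \<omega>)\<^sup>2))"
    unfolding i(2)[symmetric] by (rule nn_integral_eq_integral[OF i(1)]) auto
  also have "\<dots> = ennreal (c\<^sup>2) + ennreal (lam\<^sup>2) * ennreal (expectation (\<lambda>\<omega>. (J \<omega>)\<^sup>2))"
    by (simp add: ennreal_plus ennreal_mult)
  also have "ennreal (expectation (\<lambda>\<omega>. (J \<omega>)\<^sup>2)) = (\<integral>\<^sup>+\<omega>. ennreal ((J \<omega>)\<^sup>2) \<partial>M)"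
    by (rule nn_integral_eq_integral[OF iso(2), symmetric]) auto
  also have "\<dots> = walsh_norm_sq M L F" by (rule iso(1))
  also have "\<dots> = (\<integral>\<^sup>+s. \<integral>\<^sup>+y. ennreal ((cos_kernel L (t - s) x y)\<^sup>2) * second_moment M L u \<sigma> s y *
        indicator {0<..<L} y * indicator {0<..<t} s \<partial>lborel \<partial>lborel)"
    unfolding walsh_norm_sq_def
  proof (intro nn_integral_cong)
    fix s :: real
    show "(\<integral>\<^sup>+y\<in>{0<..<L}. (\<integral>\<^sup>+\<omega>. ennreal ((F s y \<omega>)\<^sup>2) \<partial>M) \<partial>lborel) * indicator {0<..} s =
      (\<integral>\<^sup>+y. ennreal ((cos_kernel L (t - s) x y)\<^sup>2) * second_moment M L u \<sigma> s y *
        indicator {0<..<L} y * indicator {0<..<t} s \<partial>lborel)"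
    proof (cases "s \<in> {0<..<t}")
      case False
      then have "F s y \<omega> = 0" for y \<omega> by (simp add: F_def)
      then show ?thesis using False by simp
    next
      case True
      have "(\<integral>\<^sup>+\<omega>. ennreal ((F s y \<omega>)\<^sup>2) \<partial>M) = ennreal ((cos_kernel L (t - s) x y)\<^sup>2) * second_moment M L u \<sigma> s y"
        if y: "y \<in> {0<..<L}" for y
      proof -
        have y': "y \<in> {0..L}" "0 < s" "0 < t - s" using y True by auto
        have [measurable]: "restricted_field L u s y \<in> borel_measurable M"
          by (rule restricted_field_measurable'[OF u]) measurable
        have "ennreal ((F s y \<omega>)\<^sup>2) = ennreal ((cos_kernel L (t - s) x y)\<^sup>2) * ennreal ((\<sigma> (restricted_field L u s y \<omega>))\<^sup>2)" for \<omega>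
          using True y' unfolding F_def restricted_field_eq[OF y'(2,1)] neumann_kernel_eq_cos_kernel[OF p x y'(1,3)]
          by (simp add: power_mult_distrib ennreal_mult)
        then show ?thesis unfolding second_moment_def by (simp add: nn_integral_cmult)
      qed
      then show ?thesis using True
        by (auto intro!: nn_integral_cong split: split_indicator)
    qed
  qed
  finally show ?thesis by (simp add: c_def)
qed

lemma kernel_energy_eq:
  assumes "0 < r"
  shows "(\<integral>\<^sup>+x. ennreal ((cos_kernel L r x y)\<^sup>2) * indicator {0..L} x \<partial>lborel) = ennreal (kernel_energy L r y)"
proof -
  have i: "integrable lborel (\<lambda>x. indicator {0..L} x * (cos_kernel L r x y)\<^sup>2)"
    using cos_kernel_square_integral(2)[OF assms, of y] by (simp add: set_integrable_def)
  have "(\<integral>\<^sup>+x. ennreal ((cos_kernel L r x y)\<^sup>2) * indicator {0..L} x \<partial>lborel) =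
     (\<integral>\<^sup>+x. ennreal (indicator {0..L} x * (cos_kernel L r x y)\<^sup>2) \<partial>lborel)"
    by (intro nn_integral_cong) (auto split: split_indicator)
  also have "\<dots> = ennreal (kernel_energy L r y)"
    unfolding kernel_energy_def set_lebesgue_integral_def by (subst nn_integral_eq_integral[OF i]) auto
  finally show ?thesis .
qed

lemma v0_measurable [measurable]: "(\<lambda>y. indicator {0..L} y * u0 y) \<in> borel_measurable borel"
proof -
  have "u0 \<in> borel_measurable (restrict_space borel {0..L})" using u0 by (simp add: admissible_initial_def)
  then show ?thesis by (subst (asm) borel_measurable_restrict_space_iff) auto
qed

lemma initial_mass_measurable [measurable]: "initial_mass L u0 t \<in> borel_measurable borel"
proof -
  have "initial_mass L u0 t = (\<lambda>x. LBINT y. (indicator {0..L} y * u0 y) * cos_kernel L t x y)"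
    by (auto simp: initial_mass_def set_lebesgue_integral_def ac_simps)
  also have "\<dots> \<in> borel_measurable borel" by measurable
  finally show ?thesis .
qed

text \<open>Integrating over x and moving that integral innermost by Tonelli lets it act on the
  squared kernel alone, so that x disappears and only the kernel energy in y remains.\<close>

lemma energy_identity:
  assumes u: "mild_solution M L W p \<sigma> u0 lam u" and t: "0 < t"
  shows "total_energy M L u t = initial_energy L u0 t + ennreal (lam\<^sup>2) *
    (\<integral>\<^sup>+s. \<integral>\<^sup>+y. ennreal (kernel_energy L (t - s) y) * second_moment M L u \<sigma> s y *
        indicator {0<..<L} y * indicator {0<..<t} s \<partial>lborel \<partial>lborel)"
proof -
  note [measurable] = second_moment_measurable[OF u]
  define H where "H x s y = ennreal ((cos_kernel L (t - s) x y)\<^sup>2) * second_moment M L u \<sigma> s y *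
        indicator {0<..<L} y * indicator {0<..<t} s" for x s y
  have [measurable]: "(\<lambda>z. H (f z) (g z) (h z)) \<in> borel_measurable N"
    if [measurable]: "f \<in> borel_measurable N" "g \<in> borel_measurable N" "h \<in> borel_measurable N" for f g h and N :: "'b measure"
    unfolding H_def by measurable
  have "total_energy M L u t = (\<integral>\<^sup>+x. ennreal ((initial_mass L u0 t x)\<^sup>2) * indicator {0..L} x +
     ennreal (lam\<^sup>2) * (\<integral>\<^sup>+s. \<integral>\<^sup>+y. H x s y * indicator {0..L} x \<partial>lborel \<partial>lborel) \<partial>lborel)"
    unfolding total_energy_def
  proof (intro nn_integral_cong)
    fix x :: real
    show "second_moment M L u (\<lambda>z. z) t x = ennreal ((initial_mass L u0 t x)\<^sup>2) * indicator {0..L} x +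
     ennreal (lam\<^sup>2) * (\<integral>\<^sup>+s. \<integral>\<^sup>+y. H x s y * indicator {0..L} x \<partial>lborel \<partial>lborel)"
    proof (cases "x \<in> {0..L}")
      case True
      then show ?thesis using second_moment_identity[OF u t True] by (simp add: H_def)
    next
      case False
      then have "second_moment M L u (\<lambda>z. z) t x = 0"
        by (simp add: second_moment_def restricted_field_def)
      then show ?thesis using False by simp
    qed
  qed
  also have "\<dots> = initial_energy L u0 t +
     ennreal (lam\<^sup>2) * (\<integral>\<^sup>+x. \<integral>\<^sup>+s. \<integral>\<^sup>+y. H x s y * indicator {0..L} x \<partial>lborel \<partial>lborel \<partial>lborel)"
    unfolding initial_energy_def by (subst nn_integral_add) (auto simp: nn_integral_cmult)
  also have "(\<integral>\<^sup>+x. \<integral>\<^sup>+s. \<integral>\<^sup>+y. H x s y * indicator {0..L} x \<partial>lborel \<partial>lborel \<partial>lborel) =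
     (\<integral>\<^sup>+s. \<integral>\<^sup>+x. \<integral>\<^sup>+y. H x s y * indicator {0..L} x \<partial>lborel \<partial>lborel \<partial>lborel)"
    by (rule lborel_pair.Fubini') measurable
  also have "\<dots> = (\<integral>\<^sup>+s. \<integral>\<^sup>+y. \<integral>\<^sup>+x. H x s y * indicator {0..L} x \<partial>lborel \<partial>lborel \<partial>lborel)"
    by (intro nn_integral_cong lborel_pair.Fubini') measurable
  also have "\<dots> = (\<integral>\<^sup>+s. \<integral>\<^sup>+y. ennreal (kernel_energy L (t - s) y) * second_moment M L u \<sigma> s y *
        indicator {0<..<L} y * indicator {0<..<t} s \<partial>lborel \<partial>lborel)"
  proof (intro nn_integral_cong)
    fix s y :: real
    show "(\<integral>\<^sup>+x. H x s y * indicator {0..L} x \<partial>lborel) = ennreal (kernel_energy L (t - s) y) * second_moment M L u \<sigma> s y *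
        indicator {0<..<L} y * indicator {0<..<t} s"
    proof (cases "s \<in> {0<..<t}")
      case True
      have "(\<integral>\<^sup>+x. H x s y * indicator {0..L} x \<partial>lborel) =
        (\<integral>\<^sup>+x. (second_moment M L u \<sigma> s y * indicator {0<..<L} y) * (ennreal ((cos_kernel L (t - s) x y)\<^sup>2) * indicator {0..L} x) \<partial>lborel)"
        using True by (intro nn_integral_cong) (simp add: H_def ac_simps)
      also have "\<dots> = (second_moment M L u \<sigma> s y * indicator {0<..<L} y) * ennreal (kernel_energy L (t - s) y)"
        using True by (subst nn_integral_cmult) (auto simp: kernel_energy_eq)
      finally show ?thesis using True by (simp add: ac_simps)
    qed (simp add: H_def)
  qed
  finally show ?thesis .
qed

section \<open>Inequalities for the total energy\<close>

lemma total_energy_measurable: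
  assumes u: "mild_solution M L W p \<sigma> u0 lam u"
  shows "total_energy M L u \<in> borel_measurable borel"
proof -
  note [measurable] = second_moment_measurable[OF u]
  show ?thesis unfolding total_energy_def[abs_def] by measurable
qed

text \<open>The noise lives on the open interval and the energy on the closed one; the endpoints are
  null.\<close>

lemma total_energy_open:
  "(\<integral>\<^sup>+y. second_moment M L u (\<lambda>z. z) s y * indicator {0<..<L} y \<partial>lborel) = total_energy M L u s"
  unfolding total_energy_def
proof (rule nn_integral_cong_AE)
  show "AE y in lborel. second_moment M L u (\<lambda>z. z) s y * indicator {0<..<L} y = second_moment M L u (\<lambda>z. z) s y"
    using AE_lborel_singleton[of "0::real"] AE_lborel_singleton[of L]
    by eventually_elim (auto simp: second_moment_def restricted_field_def split: split_indicator)
qed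

lemma energy_ge_initial:
  assumes u: "mild_solution M L W p \<sigma> u0 lam u" and t: "0 < t"
  shows "initial_energy L u0 t \<le> total_energy M L u t"
  unfolding energy_identity[OF u t] by simp

text \<open>All terms of the energy identity are nonnegative, so the initial term and the times
  outside S may be dropped. On S the kernel is bounded below uniformly in y, and the space integral
  closes up to the total energy.\<close>

lemma energy_lower:
  assumes u: "mild_solution M L W p \<sigma> u0 lam u" and t: "0 < t"
    and l: "0 \<le> l" "\<And>x. l * \<bar>x\<bar> \<le> \<bar>\<sigma> x\<bar>"
    and S: "S \<in> sets borel" "S \<subseteq> {0<..<t}" and \<kappa>: "0 \<le> \<kappa>" "\<And>s y. s \<in> S \<Longrightarrow> \<kappa> \<le> kernel_energy L (t - s) y"
  shows "ennreal (lam\<^sup>2 * l\<^sup>2 * \<kappa>) * (\<integral>\<^sup>+s. total_energy M L u s * indicator S s \<partial>lborel) \<le> total_energy M L u t"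
proof -
  note [measurable] = second_moment_measurable[OF u] total_energy_measurable[OF u] S(1)
  obtain \<Lambda> where "0 < \<Lambda> \<and> (\<forall>x. \<bar>\<sigma> x\<bar> \<le> \<Lambda> * \<bar>x\<bar>)"
    using admissible_sigma_bounds(2)[OF \<sigma>] by (elim exE) (rule that)
  then have \<Lambda>: "0 < \<Lambda>" and \<Lambda>': "\<And>x. \<bar>\<sigma> x\<bar> \<le> \<Lambda> * \<bar>x\<bar>" by simp_all
  have "ennreal (l\<^sup>2 * \<kappa>) * (\<integral>\<^sup>+s. total_energy M L u s * indicator S s \<partial>lborel) =
    (\<integral>\<^sup>+s. \<integral>\<^sup>+y. ennreal (l\<^sup>2 * \<kappa>) * (second_moment M L u (\<lambda>z. z) s y * indicator {0<..<L} y * indicator S s) \<partial>lborel \<partial>lborel)"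
    unfolding total_energy_open[symmetric]
    by (simp add: nn_integral_cmult nn_integral_multc)
  also have "\<dots> \<le> (\<integral>\<^sup>+s. \<integral>\<^sup>+y. ennreal (kernel_energy L (t - s) y) * second_moment M L u \<sigma> s y *
        indicator {0<..<L} y * indicator {0<..<t} s \<partial>lborel \<partial>lborel)"
  proof (intro nn_integral_mono)
    fix s y :: real
    show "ennreal (l\<^sup>2 * \<kappa>) * (second_moment M L u (\<lambda>z. z) s y * indicator {0<..<L} y * indicator S s) \<le>
      ennreal (kernel_energy L (t - s) y) * second_moment M L u \<sigma> s y * indicator {0<..<L} y * indicator {0<..<t} s"
    proof (cases "s \<in> S \<and> y \<in> {0<..<L}")
      case True
      have "ennreal \<kappa> * (ennreal (l\<^sup>2) * second_moment M L u (\<lambda>z. z) s y) \<le> ennreal (kernel_energy L (t - s) y) * second_moment M L u \<sigma> s y"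
        using True \<kappa>(2)[of s y] second_moment_bounds(1)[OF u l less_imp_le[OF \<Lambda>] \<Lambda>']
        by (intro mult_mono ennreal_leI) auto
      then show ?thesis using True S(2) \<kappa>(1) by (auto simp: ennreal_mult ac_simps)
    qed (auto split: split_indicator)
  qed
  finally have "ennreal (lam\<^sup>2) * (ennreal (l\<^sup>2 * \<kappa>) * (\<integral>\<^sup>+s. total_energy M L u s * indicator S s \<partial>lborel)) \<le> total_energy M L u t"
    unfolding energy_identity[OF u t] by (intro add_increasing mult_left_mono) auto
  moreover have "ennreal (lam\<^sup>2) * ennreal (l\<^sup>2 * \<kappa>) = ennreal (lam\<^sup>2 * l\<^sup>2 * \<kappa>)"
    using \<kappa>(1) by (simp add: ennreal_mult[symmetric] mult.assoc)
  ultimately show ?thesis by (simp add: mult.assoc[symmetric])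
qed

text \<open>Since \<open>mode_decay\<close> bounds the kernel energy uniformly in y, it comes out of
  the space integral, and what remains is a scalar convolution inequality in time.\<close>

lemma energy_upper:
  assumes u: "mild_solution M L W p \<sigma> u0 lam u" and t: "0 < t"
    and \<Lambda>: "0 \<le> \<Lambda>" "\<And>x. \<bar>\<sigma> x\<bar> \<le> \<Lambda> * \<bar>x\<bar>"
  shows "total_energy M L u t \<le> initial_energy L u0 t + ennreal (lam\<^sup>2 * \<Lambda>\<^sup>2) *
    (\<integral>\<^sup>+s. mode_decay L (t - s) * total_energy M L u s * indicator {0<..<t} s \<partial>lborel)"
proof -
  note [measurable] = second_moment_measurable[OF u] total_energy_measurable[OF u]
  obtain l where "0 < l \<and> (\<forall>x. l * \<bar>x\<bar> \<le> \<bar>\<sigma> x\<bar>)"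
    using admissible_sigma_bounds(1)[OF \<sigma>] by (elim exE) (rule that)
  then have l: "0 < l" and l': "\<And>x. l * \<bar>x\<bar> \<le> \<bar>\<sigma> x\<bar>" by simp_all
  have "(\<integral>\<^sup>+s. \<integral>\<^sup>+y. ennreal (kernel_energy L (t - s) y) * second_moment M L u \<sigma> s y *
        indicator {0<..<L} y * indicator {0<..<t} s \<partial>lborel \<partial>lborel) \<le>
     (\<integral>\<^sup>+s. \<integral>\<^sup>+y. (ennreal (\<Lambda>\<^sup>2) * (mode_decay L (t - s) * indicator {0<..<t} s)) * (second_moment M L u (\<lambda>z. z) s y * indicator {0<..<L} y) \<partial>lborel \<partial>lborel)"
  proof (intro nn_integral_mono)
    fix s y :: real
    show "ennreal (kernel_energy L (t - s) y) * second_moment M L u \<sigma> s y * indicator {0<..<L} y * indicator {0<..<t} s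
      \<le> (ennreal (\<Lambda>\<^sup>2) * (mode_decay L (t - s) * indicator {0<..<t} s)) * (second_moment M L u (\<lambda>z. z) s y * indicator {0<..<L} y)"
    proof (cases "s \<in> {0<..<t} \<and> y \<in> {0<..<L}")
      case True
      have "ennreal (kernel_energy L (t - s) y) * second_moment M L u \<sigma> s y \<le> mode_decay L (t - s) * (ennreal (\<Lambda>\<^sup>2) * second_moment M L u (\<lambda>z. z) s y)"
      proof (rule mult_mono)
        show "ennreal (kernel_energy L (t - s) y) \<le> mode_decay L (t - s)"
          unfolding kernel_energy_def by (rule cos_kernel_square_le) (use True in simp)
        show "second_moment M L u \<sigma> s y \<le> ennreal (\<Lambda>\<^sup>2) * second_moment M L u (\<lambda>z. z) s y"
          by (rule second_moment_bounds(2)[OF u less_imp_le[OF l] l' \<Lambda>])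
      qed simp_all
      then show ?thesis using True by (simp add: ac_simps)
    qed (auto split: split_indicator)
  qed
  also have "\<dots> = (\<integral>\<^sup>+s. (ennreal (\<Lambda>\<^sup>2) * (mode_decay L (t - s) * indicator {0<..<t} s)) * total_energy M L u s \<partial>lborel)"
    by (simp add: nn_integral_cmult total_energy_open)
  also have "\<dots> = ennreal (\<Lambda>\<^sup>2) * (\<integral>\<^sup>+s. mode_decay L (t - s) * total_energy M L u s * indicator {0<..<t} s \<partial>lborel)"
    by (subst nn_integral_cmult[symmetric]) (auto intro!: nn_integral_cong simp: ac_simps)
  finally have "ennreal (lam\<^sup>2) * (\<integral>\<^sup>+s. \<integral>\<^sup>+y. ennreal (kernel_energy L (t - s) y) * second_moment M L u \<sigma> s y *
        indicator {0<..<L} y * indicator {0<..<t} s \<partial>lborel \<partial>lborel) \<le>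
     ennreal (lam\<^sup>2) * (ennreal (\<Lambda>\<^sup>2) * (\<integral>\<^sup>+s. mode_decay L (t - s) * total_energy M L u s * indicator {0<..<t} s \<partial>lborel))"
    by (rule mult_left_mono) simp
  then show ?thesis unfolding energy_identity[OF u t]
    by (intro add_left_mono) (simp add: ennreal_mult mult.assoc)
qed

end

section \<open>Growth of the energy\<close>

context heat_equation
begin

section \<open>Bounds for the initial term and finiteness of the energy\<close>

lemma initial_total_pos: "0 < (LBINT y:{0..L}. u0 y)"
proof -
  let ?v = "\<lambda>y. indicator {0..L} y * u0 y"
  obtain B where B: "\<And>y. y \<in> {0..L} \<Longrightarrow> norm (u0 y) \<le> B"
    using u0 unfolding admissible_initial_def bounded_iff by blast
  have i: "integrable lborel ?v"
    by (rule integrableI_bounded_set[of "{0..L}" _ _ B])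
       (use B L in \<open>auto split: split_indicator\<close>)
  have nn: "0 \<le> ?v y" for y using u0 by (auto simp: admissible_initial_def split: split_indicator)
  have "\<not> (AE y in lborel. ?v y = 0)"
  proof
    assume "AE y in lborel. ?v y = 0"
    then have "AE y in lborel. y \<in> {0..L} \<longrightarrow> u0 y = 0" by eventually_elim auto
    then show False using u0 by (simp add: admissible_initial_def)
  qed
  then have "integral\<^sup>L lborel ?v \<noteq> 0"
    using integral_nonneg_eq_0_iff_AE[OF i] nn by auto
  moreover have "0 \<le> integral\<^sup>L lborel ?v" using nn by (intro Bochner_Integration.integral_nonneg) auto
  ultimately show "0 < (LBINT y:{0..L}. u0 y)"
    by (simp add: set_lebesgue_integral_def)
qed

text \<open>The Neumann semigroup conserves total mass, so Cauchy--Schwarz bounds the energy from below.\<close>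

lemma initial_energy_ge:
  assumes t: "0 < t"
  shows "ennreal ((LBINT y:{0..L}. u0 y)\<^sup>2 / L) \<le> initial_energy L u0 t"
proof -
  let ?v = "\<lambda>y. indicator {0..L} y * u0 y"
  let ?I = "\<lambda>x. indicator {0..L} x * initial_mass L u0 t x"
  define m where "m = (LBINT y:{0..L}. u0 y)"
  obtain B where B: "\<And>y. y \<in> {0..L} \<Longrightarrow> norm (u0 y) \<le> B"
    using u0 unfolding admissible_initial_def bounded_iff by blast
  define C where "C = (\<Sum>n. 2 / L * exp (- mode_rate L n * t))"
  have C: "\<bar>cos_kernel L t x y\<bar> \<le> C" for x y unfolding C_def by (rule cos_kernel_bounded[OF t])
  define f where "f x y = indicator {0..L} x * (?v y * cos_kernel L t x y)" for x y
  have fm: "case_prod f \<in> borel_measurable (lborel \<Otimes>\<^sub>M lborel)"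
    unfolding f_def[abs_def] by measurable
  have f: "integrable (lborel \<Otimes>\<^sub>M lborel) (case_prod f)"
  proof (rule integrableI_bounded_set[OF _ fm])
    show "{0..L} \<times> {0..L} \<in> sets (lborel \<Otimes>\<^sub>M lborel)" by simp
    show "emeasure (lborel \<Otimes>\<^sub>M lborel) ({0..L} \<times> {0..L}) < \<infinity>"
      using L by (subst lborel.emeasure_pair_measure_Times) (auto simp: ennreal_mult_less_top)
    show "AE z in lborel \<Otimes>\<^sub>M lborel. z \<in> {0..L} \<times> {0..L} \<longrightarrow> norm (case_prod f z) \<le> B * C"
    proof (intro AE_I2 impI)
      fix z assume "z \<in> {0..L} \<times> {0..L}"
      then obtain x y where z: "z = (x, y)" "x \<in> {0..L}" "y \<in> {0..L}" by auto
      have "norm (u0 y) * norm (cos_kernel L t x y) \<le> B * C"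
        using B[OF z(3)] C[of x y] order_trans[OF norm_ge_zero B[OF z(3)]] by (intro mult_mono) auto
      then show "norm (case_prod f z) \<le> B * C" using z by (simp add: f_def abs_mult)
    qed
  qed (auto simp: f_def indicator_def intro!: AE_I2)
  have fx: "(LBINT y. f x y) = ?I x" for x
    unfolding f_def initial_mass_def set_lebesgue_integral_def by (simp add: mult.assoc)
  \<comment> \<open>Mass conservation is the coefficient formula for mode 0, which is constantly 1
    and has rate 0.\<close>
  have fy: "(LBINT x. f x y) = ?v y" for y
  proof -
    have "(LBINT x. f x y) = ?v y * (LBINT x:{0..L}. cos_kernel L t y x * cos_mode L 0 x)"
      unfolding f_def set_lebesgue_integral_def
      by (subst integral_mult_right_zero[symmetric]) (simp add: cos_kernel_commute[of L t _ y] mult.left_commute)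
    then show ?thesis by (simp only: cos_kernel_coefficient[OF t]) (simp add: mode_rate_def)
  qed
  have iI: "integrable lborel ?I"
    using lborel_pair.integrable_fst'[OF f] by (simp add: fx)
  have mI: "integral\<^sup>L lborel ?I = m"
    using lborel_pair.Fubini_integral[OF f] by (simp add: fx fy m_def set_lebesgue_integral_def)
  have e: "initial_energy L u0 t = (\<integral>\<^sup>+x. ennreal ((?I x)\<^sup>2) \<partial>lborel)"
    unfolding initial_energy_def by (intro nn_integral_cong) (auto split: split_indicator)
  show ?thesis
  proof (cases "initial_energy L u0 t = \<infinity>")
    case False
    then have i2: "integrable lborel (\<lambda>x. (?I x)\<^sup>2)"
      unfolding e by (intro integrableI_nonneg) (auto simp: less_top)
    \<comment> \<open>The mean value of the semigroup over the interval. Integrating (I - c)^2 >= 0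
      with this c is the Cauchy-Schwarz inequality.\<close>
    define c where "c = m / L"
    have i1: "integrable lborel (indicat_real {0..L})"
      by (rule integrable_real_indicator) (use L in auto)
    have "m\<^sup>2 / L = 2 * c * m - c\<^sup>2 * L" using L by (simp add: c_def power2_eq_square field_simps)
    also have "\<dots> = (LBINT x. 2 * c * ?I x - c\<^sup>2 * indicator {0..L} x)"
      using iI i1 mI L by (subst Bochner_Integration.integral_diff) auto
    also have "\<dots> \<le> (LBINT x. (?I x)\<^sup>2)"
    proof (rule integral_mono[OF _ i2])
      show "integrable lborel (\<lambda>x. 2 * c * ?I x - c\<^sup>2 * indicator {0..L} x)"
        using iI i1 by (intro Bochner_Integration.integrable_diff integrable_mult_right)
      fix x
      have "0 \<le> (initial_mass L u0 t x - c)\<^sup>2" by simp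
      then show "2 * c * ?I x - c\<^sup>2 * indicator {0..L} x \<le> (?I x)\<^sup>2"
        by (auto simp: power2_eq_square algebra_simps split: split_indicator)
    qed
    finally have "ennreal (m\<^sup>2 / L) \<le> ennreal (LBINT x. (?I x)\<^sup>2)" by (rule ennreal_leI)
    also have "\<dots> = initial_energy L u0 t"
      unfolding e by (rule nn_integral_eq_integral[OF i2, symmetric]) auto
    finally show ?thesis unfolding m_def .
  qed simp
qed

text \<open>The moment condition with exponent 2 bounds the second moment uniformly on [0,T] x
  [0,L]; integration over the interval costs a factor L. Without this a priori bound the renewal
  inequality would not exclude an infinite energy.\<close>

lemma total_energy_bounded:
  assumes u: "mild_solution M L W p \<sigma> u0 lam u" and T: "0 < T"
  obtains B where "0 \<le> B" "\<And>t. 0 < t \<Longrightarrow> t \<le> T \<Longrightarrow> total_energy M L u t \<le> ennreal B"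
proof -
  define S where "S = (SUP x\<in>{0..L}. SUP t\<in>{0..T}. \<integral>\<^sup>+\<omega>. ennreal (\<bar>u t x \<omega>\<bar> powr 2) \<partial>M)"
  have all: "\<forall>T>0. \<forall>k\<ge>2. (SUP x\<in>{0..L}. SUP t\<in>{0..T}. \<integral>\<^sup>+\<omega>. ennreal (\<bar>u t x \<omega>\<bar> powr k) \<partial>M) < \<infinity>"
    using u unfolding mild_solution_def by (elim conjE)
  have Sfin: "S < \<infinity>" unfolding S_def using all[rule_format, OF T, of 2] by simp
  have m: "second_moment M L u (\<lambda>z. z) t x \<le> S * indicator {0..L} x" if t: "0 < t" "t \<le> T" for t x
  proof (cases "x \<in> {0..L}")
    case True
    have "second_moment M L u (\<lambda>z. z) t x = (\<integral>\<^sup>+\<omega>. ennreal (\<bar>u t x \<omega>\<bar> powr 2) \<partial>M)"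
      unfolding second_moment_def by (simp add: restricted_field_eq[OF t(1) True])
    also have "\<dots> \<le> (SUP t\<in>{0..T}. \<integral>\<^sup>+\<omega>. ennreal (\<bar>u t x \<omega>\<bar> powr 2) \<partial>M)"
      using t by (intro SUP_upper) auto
    also have "\<dots> \<le> S" unfolding S_def using True by (intro SUP_upper) auto
    finally show ?thesis using True by simp
  next
    case False
    then show ?thesis by (simp add: second_moment_def restricted_field_def)
  qed
  obtain B where B: "S * ennreal L = ennreal B" "0 \<le> B"
    using Sfin by (cases "S * ennreal L") (auto simp: ennreal_mult_eq_top_iff)
  show thesis
  proof (rule that[OF B(2)])
    fix t assume t: "0 < t" "t \<le> T"
    have "total_energy M L u t \<le> (\<integral>\<^sup>+x. S * indicator {0..L} x \<partial>lborel)"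
      unfolding total_energy_def by (intro nn_integral_mono m t)
    also have "\<dots> = S * ennreal L" using L by (simp add: nn_integral_cmult_indicator)
    finally show "total_energy M L u t \<le> ennreal B" unfolding B(1) .
  qed
qed

section \<open>Iteration of the renewal inequalities\<close>

text \<open>\<delta> is the largest lag at which the kernel bound with parameter N is available. On
  the window (s - \<delta>, s) the induction hypothesis gives a constant lower bound for the energy,
  and \<open>gain\<close> says that kernel bound times window length, with the noise factor, is at
  least 2. So each window doubles the bound.\<close>

lemma renewal_lower:
  assumes u: "mild_solution M L W p \<sigma> u0 lam u"
    and l: "0 \<le> l" "\<And>x. l * \<bar>x\<bar> \<le> \<bar>\<sigma> x\<bar>"
    and N: "1 \<le> N" and \<delta>: "\<delta> = L\<^sup>2 / (4 * pi\<^sup>2 * (real N)\<^sup>2)"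
    and gain: "2 \<le> lam\<^sup>2 * l\<^sup>2 * (7 / (16 * exp 1 * L) * real N) * \<delta>"
    and s: "0 < s" "real n * \<delta> \<le> s"
  shows "ennreal ((LBINT y:{0..L}. u0 y)\<^sup>2 / L * 2 ^ n) \<le> total_energy M L u s"
  using s
proof (induction n arbitrary: s)
  case 0
  then show ?case
    using order_trans[OF initial_energy_ge energy_ge_initial[OF u]] by simp
next
  case (Suc n)
  define a where "a = (LBINT y:{0..L}. u0 y)\<^sup>2 / L * 2 ^ n"
  define \<kappa> where "\<kappa> = 7 / (16 * exp 1 * L) * real N"
  have \<delta>0: "0 < \<delta>" using L N by (simp add: \<delta>)
  have a0: "0 \<le> a" and \<kappa>0: "0 \<le> \<kappa>" using L by (auto simp: a_def \<kappa>_def)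
  have ds: "0 \<le> s - \<delta>" "real n * \<delta> \<le> s - \<delta>"
  proof -
    have "0 \<le> real n * \<delta>" using \<delta>0 by simp
    moreover have "real (Suc n) * \<delta> = real n * \<delta> + \<delta>" by (simp add: algebra_simps)
    ultimately show "0 \<le> s - \<delta>" "real n * \<delta> \<le> s - \<delta>" using Suc.prems by linarith+
  qed
  define S where "S = {s - \<delta><..<s}"
  have \<kappa>: "\<kappa> \<le> kernel_energy L (s - r) y" if r: "r \<in> S" for r y
    unfolding \<kappa>_def kernel_energy_def
  proof (rule cos_kernel_square_ge)
    show "0 < s - r" using r by (simp add: S_def)
    have "4 * (real N)\<^sup>2 * pi\<^sup>2 * (s - r) \<le> 4 * (real N)\<^sup>2 * pi\<^sup>2 * \<delta>"
      using r by (intro mult_left_mono) (auto simp: S_def)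
    also have "\<dots> = L\<^sup>2" using N by (simp add: \<delta>)
    finally show "4 * (real N)\<^sup>2 * pi\<^sup>2 * (s - r) \<le> L\<^sup>2" .
  qed
  have "ennreal (a * \<delta>) = (\<integral>\<^sup>+r. ennreal a * indicator S r \<partial>lborel)"
    using a0 \<delta>0 by (simp add: S_def nn_integral_cmult_indicator ennreal_mult)
  also have "\<dots> \<le> (\<integral>\<^sup>+r. total_energy M L u r * indicator S r \<partial>lborel)"
  proof (intro nn_integral_mono)
    fix r
    show "ennreal a * indicator S r \<le> total_energy M L u r * indicator S r"
    proof (cases "r \<in> S")
      case True
      then have "ennreal a \<le> total_energy M L u r"
        unfolding a_def using ds by (intro Suc.IH) (auto simp: S_def)
      then show ?thesis using True by simp
    qed simp
  qed
  finally have "ennreal (lam\<^sup>2 * l\<^sup>2 * \<kappa>) * ennreal (a * \<delta>) \<le> ennreal (lam\<^sup>2 * l\<^sup>2 * \<kappa>) * (\<integral>\<^sup>+r. total_energy M L u r * indicator S r \<partial>lborel)"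
    by (rule mult_left_mono) simp
  also have "\<dots> \<le> total_energy M L u s"
    by (rule energy_lower[OF u Suc.prems(1) l _ _ \<kappa>0 \<kappa>]) (use ds \<delta>0 in \<open>auto simp: S_def\<close>)
  finally have le: "ennreal (lam\<^sup>2 * l\<^sup>2 * \<kappa>) * ennreal (a * \<delta>) \<le> total_energy M L u s" .
  have "2 * a \<le> (lam\<^sup>2 * l\<^sup>2 * \<kappa> * \<delta>) * a"
    using gain a0 unfolding \<kappa>_def by (intro mult_right_mono)
  then have "ennreal (2 * a) \<le> ennreal ((lam\<^sup>2 * l\<^sup>2 * \<kappa>) * (a * \<delta>))"
    by (intro ennreal_leI) (simp add: ac_simps)
  also have "\<dots> = ennreal (lam\<^sup>2 * l\<^sup>2 * \<kappa>) * ennreal (a * \<delta>)"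
    using a0 \<delta>0 \<kappa>0 by (intro ennreal_mult) auto
  also note le
  finally show ?case by (simp add: a_def ac_simps)
qed

text \<open>With the weight exp(- \<beta> s) the convolution acts on a supremum norm, and its
  operator norm is at most the Laplace transform at \<beta>. The condition on \<beta> makes this at
  most 1/2, so G <= A + G/2.\<close>

lemma renewal_upper:
  assumes u: "mild_solution M L W p \<sigma> u0 lam u"
    and \<Lambda>: "0 \<le> \<Lambda>" "\<And>x. \<bar>\<sigma> x\<bar> \<le> \<Lambda> * \<bar>x\<bar>"
    and \<beta>: "1 \<le> \<beta>" "lam\<^sup>2 * \<Lambda>\<^sup>2 * ((1 / L + 4 / pi) / sqrt \<beta>) \<le> 1 / 2"
    and t: "0 < t" and A: "0 \<le> A" "\<And>s. 0 < s \<Longrightarrow> s \<le> t \<Longrightarrow> initial_energy L u0 s \<le> ennreal A"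
  shows "total_energy M L u t \<le> ennreal (2 * A * exp (\<beta> * t))"
proof -
  note [measurable] = total_energy_measurable[OF u]
  define F where "F r = ennreal (exp (- \<beta> * r)) * mode_decay L r * indicator {0<..} r" for r
  have [measurable]: "F \<in> borel_measurable borel" unfolding F_def by measurable
  have F: "(\<integral>\<^sup>+r. F r \<partial>lborel) \<le> ennreal ((1 / L + 4 / pi) / sqrt \<beta>)"
    unfolding F_def by (rule mode_laplace_le[OF \<beta>(1)])
  define G where "G = (SUP s\<in>{0<..t}. ennreal (exp (- \<beta> * s)) * total_energy M L u s)"
  obtain B where B: "0 \<le> B" "\<And>s. 0 < s \<Longrightarrow> s \<le> t \<Longrightarrow> total_energy M L u s \<le> ennreal B"
    using total_energy_bounded[OF u t] by blast
  \<comment> \<open>Finiteness of G is essential: the inequality G <= A + G/2 carries no information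
    when G is infinite.\<close>
  have "G \<le> 1 * ennreal B"
    unfolding G_def using B(2) \<beta>(1) by (intro SUP_least mult_mono) (auto simp: ennreal_le_1)
  then obtain \<gamma> where \<gamma>: "G = ennreal \<gamma>" "0 \<le> \<gamma>" by (cases G) (auto simp: top_unique)
  have "(SUP s\<in>{0<..t}. ennreal (exp (- \<beta> * s)) * total_energy M L u s) \<le> ennreal A + ennreal (1 / 2) * G"
  proof (rule SUP_least)
    fix s assume "s \<in> {0<..t}"
    then have s: "0 < s" "s \<le> t" by auto
    let ?e = "ennreal (exp (- \<beta> * s))"
    have e1: "?e \<le> 1" using s \<beta> by (simp add: ennreal_le_1)
    have "?e * total_energy M L u s \<le> ?e * (initial_energy L u0 s + ennreal (lam\<^sup>2 * \<Lambda>\<^sup>2) *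
      (\<integral>\<^sup>+r. mode_decay L (s - r) * total_energy M L u r * indicator {0<..<s} r \<partial>lborel))"
      by (intro mult_left_mono energy_upper[OF u s(1) \<Lambda>]) simp
    also have "\<dots> = ?e * initial_energy L u0 s + ennreal (lam\<^sup>2 * \<Lambda>\<^sup>2) *
      (\<integral>\<^sup>+r. ?e * (mode_decay L (s - r) * total_energy M L u r * indicator {0<..<s} r) \<partial>lborel)"
      by (simp add: nn_integral_cmult distrib_left mult.left_commute)
    also have "\<dots> \<le> 1 * ennreal A + ennreal (lam\<^sup>2 * \<Lambda>\<^sup>2) * (\<integral>\<^sup>+r. F (s - r) * G \<partial>lborel)"
    proof (rule add_mono[OF mult_mono[OF e1 A(2)[OF s]]], simp_all only: zero_le, rule mult_left_mono, rule nn_integral_mono)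
      fix r
      show "?e * (mode_decay L (s - r) * total_energy M L u r * indicator {0<..<s} r) \<le> F (s - r) * G"
      proof (cases "r \<in> {0<..<s}")
        case True
        \<comment> \<open>The weight splits along s = (s - r) + r: one factor goes to the kernel and
          forms the Laplace integrand, the other to the energy and is bounded by G.\<close>
        have "exp (- \<beta> * s) = exp (- \<beta> * (s - r)) * exp (- \<beta> * r)"
          unfolding mult_exp_exp by (simp add: algebra_simps)
        then have e: "?e = ennreal (exp (- \<beta> * (s - r))) * ennreal (exp (- \<beta> * r))"
          by (simp only: ennreal_mult'[OF exp_ge_zero])
        have g: "ennreal (exp (- \<beta> * r)) * total_energy M L u r \<le> G"
          unfolding G_def using True s by (intro SUP_upper) auto
        have "?e * (mode_decay L (s - r) * total_energy M L u r * indicator {0<..<s} r) =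
          F (s - r) * (ennreal (exp (- \<beta> * r)) * total_energy M L u r)"
          using True unfolding e F_def by (simp add: ac_simps)
        also have "\<dots> \<le> F (s - r) * G" by (rule mult_left_mono[OF g]) simp
        finally show ?thesis .
      qed simp
    qed simp_all
    also have "(\<integral>\<^sup>+r. F (s - r) * G \<partial>lborel) = (\<integral>\<^sup>+r. F (s - r) \<partial>lborel) * G"
      by (rule nn_integral_multc) measurable
    also have "(\<integral>\<^sup>+r. F (s - r) \<partial>lborel) = (\<integral>\<^sup>+r. F r \<partial>lborel)"
      using nn_integral_real_affine[of F "-1" s] by simp
    also have "1 * ennreal A + ennreal (lam\<^sup>2 * \<Lambda>\<^sup>2) * ((\<integral>\<^sup>+r. F r \<partial>lborel) * G) \<le>
       ennreal A + ennreal (1 / 2) * G"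
    proof -
      have "ennreal (lam\<^sup>2 * \<Lambda>\<^sup>2) * (\<integral>\<^sup>+r. F r \<partial>lborel) \<le> ennreal (lam\<^sup>2 * \<Lambda>\<^sup>2) * ennreal ((1 / L + 4 / pi) / sqrt \<beta>)"
        by (rule mult_left_mono[OF F]) simp
      also have "\<dots> = ennreal (lam\<^sup>2 * \<Lambda>\<^sup>2 * ((1 / L + 4 / pi) / sqrt \<beta>))"
        by (rule ennreal_mult'[symmetric]) simp
      also have "\<dots> \<le> ennreal (1 / 2)" by (rule ennreal_leI[OF \<beta>(2)])
      finally have "ennreal (lam\<^sup>2 * \<Lambda>\<^sup>2) * (\<integral>\<^sup>+r. F r \<partial>lborel) * G \<le> ennreal (1 / 2) * G"
        by (rule mult_right_mono) simp
      then show ?thesis by (simp add: mult.assoc)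
    qed
    finally show "?e * total_energy M L u s \<le> ennreal A + ennreal (1 / 2) * G" .
  qed
  then have "ennreal \<gamma> \<le> ennreal A + ennreal (1 / 2) * ennreal \<gamma>"
    unfolding G_def[symmetric] \<gamma>(1) .
  also have "\<dots> = ennreal (A + 1 / 2 * \<gamma>)"
    using A(1) \<gamma>(2) by (simp only: ennreal_plus ennreal_mult'' mult_nonneg_nonneg divide_nonneg_nonneg zero_le_one zero_le_numeral)
  finally have "\<gamma> \<le> A + 1 / 2 * \<gamma>" by (subst (asm) ennreal_le_iff) (use A(1) \<gamma>(2) in auto)
  then have "\<gamma> \<le> 2 * A" by simp
  then have "G \<le> ennreal (2 * A)" unfolding \<gamma>(1) by (rule ennreal_leI)
  moreover have "ennreal (exp (- \<beta> * t)) * total_energy M L u t \<le> G"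
    unfolding G_def using t by (intro SUP_upper) auto
  ultimately have "ennreal (exp (\<beta> * t)) * (ennreal (exp (- \<beta> * t)) * total_energy M L u t) \<le> ennreal (exp (\<beta> * t)) * ennreal (2 * A)"
    by (intro mult_left_mono) auto
  moreover have "ennreal (exp (\<beta> * t)) * ennreal (exp (- \<beta> * t)) = 1"
    by (simp add: ennreal_mult'[symmetric] mult_exp_exp)
  ultimately show ?thesis
    using A(1) by (simp add: mult.assoc[symmetric] ennreal_mult'[symmetric]) (simp add: ac_simps)
qed

text \<open>\<open>energy\<close> is built from Bochner integrals, which return 0 for a function
  that is not integrable. The finite total energy excludes this default value for almost every path,
  and then the iterated integrals agree by Tonelli.\<close>

lemma energy_eq_total_energy:
  assumes u: "mild_solution M L W p \<sigma> u0 lam u" and t: "0 < t"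
  shows "energy M L u t = sqrt (enn2real (total_energy M L u t))"
proof -
  interpret lM: pair_sigma_finite "lborel :: real measure" M ..
  define q where "q x \<omega> = (restricted_field L u t x \<omega>)\<^sup>2" for x \<omega>
  have qm [measurable]: "(\<lambda>z. q (f z) (g z)) \<in> borel_measurable N"
    if "f \<in> borel_measurable N" "g \<in> measurable N M" for f g and N :: "'z measure"
    unfolding q_def using that by (intro borel_measurable_power restricted_field_measurable'[OF u]) auto
  define Z where "Z \<omega> = (LBINT x. q x \<omega>)" for \<omega>
  have Zu: "(LBINT x:{0..L}. (u t x \<omega>)\<^sup>2) = Z \<omega>" for \<omega>
    unfolding Z_def set_lebesgue_integral_def q_def restricted_field_def
    using t by (intro Bochner_Integration.integral_cong) (auto split: split_indicator)
  have Zm [measurable]: "Z \<in> borel_measurable M" unfolding Z_def by measurable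
  have Z0: "0 \<le> Z \<omega>" for \<omega> unfolding Z_def q_def by (intro Bochner_Integration.integral_nonneg) auto
  have g: "total_energy M L u t = (\<integral>\<^sup>+\<omega>. \<integral>\<^sup>+x. ennreal (q x \<omega>) \<partial>lborel \<partial>M)"
    unfolding total_energy_def second_moment_def q_def[symmetric]
    by (rule lM.Fubini'[symmetric]) measurable
  obtain B where "total_energy M L u t \<le> ennreal B" using total_energy_bounded[OF u t] t by blast
  then have "total_energy M L u t < \<infinity>" by (rule le_less_trans) simp
  moreover have "(\<lambda>\<omega>. \<integral>\<^sup>+x. ennreal (q x \<omega>) \<partial>lborel) \<in> borel_measurable M" by measurable
  \<comment> \<open>A finite expectation forces almost every path to be square integrable over the
    interval.\<close>
  ultimately have "AE \<omega> in M. (\<integral>\<^sup>+x. ennreal (q x \<omega>) \<partial>lborel) \<noteq> \<infinity>"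
    unfolding g by (intro nn_integral_PInf_AE) auto
  then have "AE \<omega> in M. (\<integral>\<^sup>+x. ennreal (q x \<omega>) \<partial>lborel) = ennreal (Z \<omega>)"
    using AE_space
  proof eventually_elim
    case (elim \<omega>)
    have "integrable lborel (\<lambda>x. q x \<omega>)"
      by (rule integrableI_nonneg) (use elim in \<open>auto simp: q_def[symmetric] less_top intro!: qm\<close>, simp add: q_def)
    then show ?case unfolding Z_def by (rule nn_integral_eq_integral) (simp add: q_def)
  qed
  then have "total_energy M L u t = (\<integral>\<^sup>+\<omega>. ennreal (Z \<omega>) \<partial>M)"
    unfolding g by (rule nn_integral_cong_AE)
  moreover have "expectation Z = enn2real (\<integral>\<^sup>+\<omega>. ennreal (Z \<omega>) \<partial>M)"
    by (rule integral_eq_nn_integral) (use Z0 in auto)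
  ultimately show ?thesis unfolding energy_def Zu by simp
qed

section \<open>Choice of parameters in terms of the noise level\<close>

text \<open>N is taken of order lam^2, as large as the gain condition allows. Then \<delta> is of
  order lam^(-4), and the number n of doublings that fit into time t is of order lam^4.\<close>

lemma energy_lower_bound:
  assumes u: "\<And>lam. lam > 0 \<Longrightarrow> mild_solution M L W p \<sigma> u0 lam (u lam)" and t: "0 < t"
  shows "\<exists>a>0. \<exists>c>0. eventually (\<lambda>lam. a * exp (c * lam ^ 4) \<le> energy M L (u lam) t) at_top"
proof -
  obtain l where "0 < l \<and> (\<forall>x. l * \<bar>x\<bar> \<le> \<bar>\<sigma> x\<bar>)"
    using admissible_sigma_bounds(1)[OF \<sigma>] by (elim exE) (rule that)
  then have l: "0 < l" and l': "\<And>x. l * \<bar>x\<bar> \<le> \<bar>\<sigma> x\<bar>" by simp_all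
  define a0 where "a0 = (LBINT y:{0..L}. u0 y)\<^sup>2 / L"
  have a0: "0 < a0" using initial_total_pos L by (simp add: a0_def)
  \<comment> \<open>With this constant the gain equals 2 q lam^2 / N, so it is at least 2 exactly
    when N <= q lam^2.\<close>
  define q where "q = l\<^sup>2 * (7 / (16 * exp 1 * L)) * L\<^sup>2 / (8 * pi\<^sup>2)"
  have q: "0 < q" using l L by (simp add: q_def)
  \<comment> \<open>From t / \<delta> = 4 pi^2 t N^2 / L^2 and N >= q lam^2 / 2; the factor ln 2
    converts powers of 2 into exponentials.\<close>
  define c where "c = pi\<^sup>2 * t * q\<^sup>2 / L\<^sup>2 * ln 2"
  have c: "0 < c" using t q L by (simp add: c_def)
  have "sqrt (a0 / 2) * exp (c / 2 * lam ^ 4) \<le> energy M L (u lam) t" if lam: "0 < lam" "1 \<le> q * lam\<^sup>2" for lam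
  proof -
    \<comment> \<open>Since q lam^2 >= 1, rounding down loses at most a factor 2.\<close>
    define N where "N = nat \<lfloor>q * lam\<^sup>2\<rfloor>"
    have N: "1 \<le> N" "real N \<le> q * lam\<^sup>2" "q * lam\<^sup>2 / 2 \<le> real N"
    proof -
      have "1 \<le> \<lfloor>q * lam\<^sup>2\<rfloor>" using lam(2) by (simp add: le_floor_iff)
      then show "1 \<le> N" "real N \<le> q * lam\<^sup>2" "q * lam\<^sup>2 / 2 \<le> real N"
        unfolding N_def by linarith+
    qed
    define \<delta> where "\<delta> = L\<^sup>2 / (4 * pi\<^sup>2 * (real N)\<^sup>2)"
    have \<delta>: "0 < \<delta>" using L N by (simp add: \<delta>_def)
    define n where "n = nat \<lfloor>t / \<delta>\<rfloor>"
    have td: "0 \<le> t / \<delta>" using t \<delta> by simp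
    have n: "real n \<le> t / \<delta>" "t / \<delta> - 1 \<le> real n" using td unfolding n_def by linarith+
    have nt: "real n * \<delta> \<le> t" using n(1) \<delta> by (simp add: field_simps)
    have "lam\<^sup>2 * l\<^sup>2 * (7 / (16 * exp 1 * L) * real N) * \<delta> = 2 * (q * lam\<^sup>2) / real N"
      using N(1) by (simp add: q_def \<delta>_def power2_eq_square field_simps)
    moreover have "2 \<le> 2 * (q * lam\<^sup>2) / real N" using N by (simp add: field_simps)
    ultimately have gain: "2 \<le> lam\<^sup>2 * l\<^sup>2 * (7 / (16 * exp 1 * L) * real N) * \<delta>" by simp
    have low: "ennreal (a0 * 2 ^ n) \<le> total_energy M L (u lam) t"
      unfolding a0_def
      by (rule renewal_lower[OF u[OF lam(1)] less_imp_le[OF l] l' N(1) \<delta>_def gain t nt])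
    obtain B where B: "total_energy M L (u lam) t \<le> ennreal B"
      using total_energy_bounded[OF u[OF lam(1)] t] t by blast
    have low': "a0 * 2 ^ n \<le> enn2real (total_energy M L (u lam) t)"
      using enn2real_mono[OF low] le_less_trans[OF B ennreal_less_top] a0 by simp
    have "(q * lam\<^sup>2 / 2)\<^sup>2 \<le> (real N)\<^sup>2" using N q by (intro power_mono) auto
    then have "4 * pi\<^sup>2 * t / L\<^sup>2 * (q * lam\<^sup>2 / 2)\<^sup>2 \<le> 4 * pi\<^sup>2 * t / L\<^sup>2 * (real N)\<^sup>2"
      using t by (intro mult_left_mono) auto
    also have "\<dots> = t / \<delta>" using N L by (simp add: \<delta>_def field_simps)
    also have "4 * pi\<^sup>2 * t / L\<^sup>2 * (q * lam\<^sup>2 / 2)\<^sup>2 = pi\<^sup>2 * t * q\<^sup>2 / L\<^sup>2 * lam ^ 4"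
      by (simp add: power2_eq_square power4_eq_xxxx)
    finally have "(pi\<^sup>2 * t * q\<^sup>2 / L\<^sup>2 * lam ^ 4 - 1) * ln 2 \<le> real n * ln 2"
      using n(2) by (intro mult_right_mono) auto
    \<comment> \<open>Rounding t / \<delta> down to n may lose one doubling, hence the term ln 2.
      Passing from the squared energy to the energy later halves the exponent.\<close>
    then have "exp (c * lam ^ 4 - ln 2) \<le> exp (real n * ln 2)"
      by (simp add: c_def algebra_simps)
    also have "exp (real n * ln 2) = (2::real) ^ n" by (simp add: exp_of_nat_mult)
    finally have "exp (c * lam ^ 4) / 2 \<le> 2 ^ n" by (simp add: exp_diff)
    then have "a0 * (exp (c * lam ^ 4) / 2) \<le> a0 * 2 ^ n" using a0 by (intro mult_left_mono) auto
    with low' have "a0 / 2 * exp (c * lam ^ 4) \<le> enn2real (total_energy M L (u lam) t)" by simp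
    then have "sqrt (a0 / 2 * exp (c * lam ^ 4)) \<le> energy M L (u lam) t"
      unfolding energy_eq_total_energy[OF u[OF lam(1)] t] by (rule real_sqrt_le_mono)
    moreover have "sqrt (exp (c * lam ^ 4)) = exp (c / 2 * lam ^ 4)"
      by (rule real_sqrt_unique) (simp_all add: power2_eq_square mult_exp_exp)
    ultimately show ?thesis by (simp only: real_sqrt_mult)
  qed
  moreover have "eventually (\<lambda>lam. 0 < lam \<and> 1 \<le> q * lam\<^sup>2) at_top"
    using q by (intro eventually_conj) real_asymp+
  ultimately have "eventually (\<lambda>lam. sqrt (a0 / 2) * exp (c / 2 * lam ^ 4) \<le> energy M L (u lam) t) at_top"
    by (auto elim!: eventually_mono)
  then show ?thesis using a0 c by (intro exI[of _ "sqrt (a0 / 2)"] conjI exI[of _ "c / 2"]) auto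
qed

text \<open>The contraction condition asks that lam^2 be at most a constant times the square root of
  \<beta>; squaring makes \<beta> of order lam^4.\<close>

lemma energy_upper_bound:
  assumes u: "\<And>lam. lam > 0 \<Longrightarrow> mild_solution M L W p \<sigma> u0 lam (u lam)" and t: "0 < t"
  shows "\<exists>b>0. \<exists>d>0. eventually (\<lambda>lam. energy M L (u lam) t \<le> b * exp (d * lam ^ 4)) at_top"
proof -
  obtain \<Lambda> where "0 < \<Lambda> \<and> (\<forall>x. \<bar>\<sigma> x\<bar> \<le> \<Lambda> * \<bar>x\<bar>)"
    using admissible_sigma_bounds(2)[OF \<sigma>] by (elim exE) (rule that)
  then have \<Lambda>: "0 < \<Lambda>" and \<Lambda>': "\<And>x. \<bar>\<sigma> x\<bar> \<le> \<Lambda> * \<bar>x\<bar>" by simp_all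
  \<comment> \<open>The initial term does not depend on \<open>\<lambda>\<close>, so the moment bound of the solution with \<open>\<lambda> = 1\<close> controls it.\<close>
  obtain B where B: "0 \<le> B" "\<And>s. 0 < s \<Longrightarrow> s \<le> t \<Longrightarrow> total_energy M L (u 1) s \<le> ennreal B"
    using total_energy_bounded[OF u[of 1] t] by auto
  \<comment> \<open>The increment only makes A strictly positive, as required of the factor in front
    of the exponential.\<close>
  define A where "A = B + 1"
  have A: "0 < A" "initial_energy L u0 s \<le> ennreal A" if "0 < s" "s \<le> t" for s
  proof -
    have "initial_energy L u0 s \<le> total_energy M L (u 1) s"
      using that by (intro energy_ge_initial[of 1] u) auto
    also have "\<dots> \<le> ennreal B" using that by (rule B(2))
    also have "\<dots> \<le> ennreal A" by (rule ennreal_leI) (simp add: A_def)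
    finally show "initial_energy L u0 s \<le> ennreal A" .
  qed (use B in \<open>simp add: A_def\<close>)
  have A0: "0 < A" using B by (simp add: A_def)
  define C where "C = 1 / L + 4 / pi"
  have C: "0 < C" using L by (auto simp: C_def intro!: add_pos_pos)
  \<comment> \<open>With sqrt \<beta> = k lam^2 the contraction factor becomes lam^2 \<Lambda>^2 C /
    (k lam^2) = 1/2.\<close>
  define k where "k = 2 * \<Lambda>\<^sup>2 * C"
  have k: "0 < k" using \<Lambda> C by (simp add: k_def)
  have "energy M L (u lam) t \<le> sqrt (2 * A) * exp (k\<^sup>2 * t / 2 * lam ^ 4)" if lam: "0 < lam" "1 \<le> k * lam\<^sup>2" for lam
  proof -
    define \<beta> where "\<beta> = (k * lam\<^sup>2)\<^sup>2"
    have b1: "1 \<le> \<beta>" using lam(2) by (simp add: \<beta>_def)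
    have sb: "sqrt \<beta> = k * lam\<^sup>2" using lam(2) by (simp add: \<beta>_def)
    have b2: "lam\<^sup>2 * \<Lambda>\<^sup>2 * ((1 / L + 4 / pi) / sqrt \<beta>) \<le> 1 / 2"
      unfolding sb C_def[symmetric] using lam(1) \<Lambda> C by (simp add: k_def field_simps)
    have up: "total_energy M L (u lam) t \<le> ennreal (2 * A * exp (\<beta> * t))"
      by (rule renewal_upper[OF u[OF lam(1)] less_imp_le[OF \<Lambda>] \<Lambda>' b1 b2 t less_imp_le[OF A0] A(2)])
    have "enn2real (total_energy M L (u lam) t) \<le> 2 * A * exp (\<beta> * t)"
      using enn2real_mono[OF up] A0 by simp
    then have "energy M L (u lam) t \<le> sqrt (2 * A * exp (\<beta> * t))"
      unfolding energy_eq_total_energy[OF u[OF lam(1)] t] by (rule real_sqrt_le_mono)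
    moreover have "sqrt (exp (\<beta> * t)) = exp (k\<^sup>2 * t / 2 * lam ^ 4)"
    proof (rule real_sqrt_unique)
      show "(exp (k\<^sup>2 * t / 2 * lam ^ 4))\<^sup>2 = exp (\<beta> * t)"
        unfolding \<beta>_def power2_eq_square mult_exp_exp power4_eq_xxxx by (simp add: algebra_simps)
    qed simp
    ultimately show ?thesis by (simp only: real_sqrt_mult)
  qed
  moreover have "eventually (\<lambda>lam. 0 < lam \<and> 1 \<le> k * lam\<^sup>2) at_top"
    using k by (intro eventually_conj) real_asymp+
  ultimately have "eventually (\<lambda>lam. energy M L (u lam) t \<le> sqrt (2 * A) * exp (k\<^sup>2 * t / 2 * lam ^ 4)) at_top"
    by (auto elim!: eventually_mono)
  then show ?thesis using A0 k t by (intro exI[of _ "sqrt (2 * A)"] conjI exI[of _ "k\<^sup>2 * t / 2"]) auto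
qed

end

text \<open>The double logarithm of a exp(c lam^4) is ln(ln a + c lam^4) = 4 ln lam + O(1), so the
  constants disappear after division by ln lam. Both bounds have the same limit, and the squeezed
  quotient converges.\<close>

lemma excitation_index_eq_4:
  fixes E :: "real \<Rightarrow> real"
  assumes "0 < a" "0 < c" "0 < b" "0 < d"
    and low: "eventually (\<lambda>lam. a * exp (c * lam ^ 4) \<le> E lam) at_top"
    and up: "eventually (\<lambda>lam. E lam \<le> b * exp (d * lam ^ 4)) at_top"
  shows "upper_excitation_index E = 4" and "lower_excitation_index E = 4"
proof -
  \<comment> \<open>From here on ln E > 1: this puts \<open>loglog\<close> in its finite branch and
    makes the outer logarithm monotone on the values compared.\<close>
  have 1: "eventually (\<lambda>lam. 1 < ln a + c * lam ^ 4) at_top" using assms by real_asymp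
  have 2: "eventually (\<lambda>lam::real. 1 < lam) at_top" by real_asymp
  have bounds: "eventually (\<lambda>lam. loglog (E lam) / ereal (ln lam) = ereal (ln (ln (E lam)) / ln lam) \<and>
      ln (ln a + c * lam ^ 4) / ln lam \<le> ln (ln (E lam)) / ln lam \<and>
      ln (ln (E lam)) / ln lam \<le> ln (ln b + d * lam ^ 4) / ln lam) at_top"
    using low up 1 2
  proof eventually_elim
    case (elim lam)
    have E0: "0 < E lam" using elim(1) assms(1) by (meson exp_gt_zero less_le_trans mult_pos_pos)
    have "ln (a * exp (c * lam ^ 4)) \<le> ln (E lam)" using elim(1) assms(1) E0 by (subst ln_le_cancel_iff) auto
    then have l: "ln a + c * lam ^ 4 \<le> ln (E lam)" using assms(1) by (simp add: ln_mult)
    have "ln (E lam) \<le> ln (b * exp (d * lam ^ 4))" using elim(2) assms(3) E0 by (subst ln_le_cancel_iff) auto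
    then have h: "ln (E lam) \<le> ln b + d * lam ^ 4" using assms(3) by (simp add: ln_mult)
    have lE: "1 < ln (E lam)" using l elim(3) by linarith
    then have "1 < E lam" using E0 by (smt (verit) ln_le_zero_iff)
    then have 3: "loglog (E lam) / ereal (ln lam) = ereal (ln (ln (E lam)) / ln lam)"
      using elim(4) by (simp add: loglog_def)
    have "ln (ln a + c * lam ^ 4) \<le> ln (ln (E lam))" using l elim(3) lE by (subst ln_le_cancel_iff) auto
    moreover have "ln (ln (E lam)) \<le> ln (ln b + d * lam ^ 4)" using h lE by (subst ln_le_cancel_iff) auto
    ultimately show ?case using 3 elim(4) by (auto intro!: divide_right_mono)
  qed
  have "((\<lambda>lam. ln (ln (E lam)) / ln lam) \<longlongrightarrow> 4) at_top"
  proof (rule tendsto_sandwich)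
    show "((\<lambda>lam. ln (ln a + c * lam ^ 4) / ln lam) \<longlongrightarrow> 4) at_top" using assms by real_asymp
    show "((\<lambda>lam. ln (ln b + d * lam ^ 4) / ln lam) \<longlongrightarrow> 4) at_top" using assms by real_asymp
  qed (use bounds in \<open>auto elim!: eventually_mono\<close>)
  then have "((\<lambda>lam. ereal (ln (ln (E lam)) / ln lam)) \<longlongrightarrow> ereal 4) at_top" by (rule tendsto_ereal)
  then have lim: "((\<lambda>lam. loglog (E lam) / ereal (ln lam)) \<longlongrightarrow> ereal 4) at_top"
    by (rule Lim_transform_eventually) (use bounds in \<open>auto elim!: eventually_mono\<close>)
  show "upper_excitation_index E = 4"
    unfolding upper_excitation_index_def using lim_imp_Limsup[OF _ lim] by simp
  show "lower_excitation_index E = 4"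
    unfolding lower_excitation_index_def using lim_imp_Liminf[OF _ lim] by simp
qed

theorem corollary1p5:
  fixes M :: "'w measure"
    and L :: real
    and W :: "(real \<times> real) set \<Rightarrow> 'w \<Rightarrow> real"
    and p :: "real \<Rightarrow> real \<Rightarrow> real \<Rightarrow> real"
    and \<sigma> u0 :: "real \<Rightarrow> real"
    and u :: "real \<Rightarrow> real \<Rightarrow> real \<Rightarrow> 'w \<Rightarrow> real"
  assumes "0 < L"
    and "prob_space M"
    and "white_noise M L W"
    and "neumann_heat_kernel L p"
    and "admissible_sigma \<sigma>"
    and "admissible_initial L u0"
    and "\<And>lam. lam > 0 \<Longrightarrow> mild_solution M L W p \<sigma> u0 lam (u lam)"
  shows "\<forall>t>0. upper_excitation_index (\<lambda>lam. energy M L (u lam) t) = 4 \<and>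
               lower_excitation_index (\<lambda>lam. energy M L (u lam) t) = 4"
proof (intro allI impI)
  fix t :: real assume t: "0 < t"
  interpret heat_equation M L W p \<sigma> u0
    by (intro heat_equation.intro white_noise_space.intro white_noise_space_axioms.intro interval.intro
        heat_equation_axioms.intro assms)
  obtain a c where low: "0 < a" "0 < c" "eventually (\<lambda>lam. a * exp (c * lam ^ 4) \<le> energy M L (u lam) t) at_top"
    using energy_lower_bound[OF assms(7) t] by auto
  obtain b d where up: "0 < b" "0 < d" "eventually (\<lambda>lam. energy M L (u lam) t \<le> b * exp (d * lam ^ 4)) at_top"
    using energy_upper_bound[OF assms(7) t] by auto
  show "upper_excitation_index (\<lambda>lam. energy M L (u lam) t) = 4 \<and>
               lower_excitation_index (\<lambda>lam. energy M L (u lam) t) = 4"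
    using excitation_index_eq_4[OF low(1,2) up(1,2) low(3) up(3)] by (rule conjI)
qed

end
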